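(* For every (possibly infinite) pure-state source $\mathcal{E}=(\Omega,P,\varphi)$ on $\mathbb{C}^d$ and every $R\ge0$, $Q^*(R)\ge M(\mathcal{E},R):=\inf_{p:\Omega_A\to\Omega_C}\{S(A:B|C):S(A:C)\le R\}$.
   Context: Setting and source: - $\mathcal H=\mathbb{C}^d$; logarithms are base 2. - A source is a triple $(\Omega,P,\varphi)$: $(\Omega,\Sigma)$ is a measurable space, $P$ is a probability measure on it, and $\varphi:\omega\mapsto\varphi_\omega=|\varphi_\omega\rangle\langle\varphi_\omega|$ is a measurable map into the pure states on $\mathcal H$. - For $\omega=(\omega_1,\dots,\omega_n)\in\Omega^n$, write $\varphi_\omega=\varphi_{\omega_1}\otimes\cdots\otimes\varphi_{\omega_n}$. Visible codes: - A visible code of block length $n$ consists of a finite set $\Omega_C$, a finite-dimensional Hilbert space $\mathcal H_B$, a Markov kernel $E$ from $\Omega^n$ to $\mathcal S(\mathcal H_B)\times\Omega_C$ (states on $\mathcal H_B$ together with a classical symbol), and a CPTP map $D$ from operators on $\mathcal H_B\otimes\ell^2(\Omega_C)$ to operators on $\mathcal H^{\otimes n}$. - $(D\circ E)(\omega)$ denotes the average over $E(\cdot|\omega)$ of $D(\sigma\otimes|j\rangle\langle j|)$. - Fidelity: $\int P^{\otimes n}(d\omega)\,\mathrm{Tr}\big(\varphi_\omega(D\circ E)(\omega)\big)$. - Classical rate: $\frac1n\log|\Omega_C|$. Quantum rate: $\frac1n\log\dim\mathcal H_B$. - $Q^*(R)$ is the infimum of $Q$ such that for all $\epsilon,\delta>0$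 and all sufficiently large $n$ there is such a code with fidelity $\ge1-\epsilon$, classical rate $\le R+\delta$ and quantum rate $\le Q+\delta$. Definition of $M(\mathcal{E},R)$: - The infimum runs over measurable spaces $\Omega_C$ and Markov kernels $p(\cdot|\cdot)$ from $\Omega_A=\Omega$ to $\Omega_C$. - $\mu$ is the induced joint measure on $\Omega_A\times\Omega_C$, $\mu(F\times G)=\int_FP(d\omega)p(G|\omega)$; $q$ is its marginal on $\Omega_C$; and $q(\cdot|j)$ is the Bayesian inverse kernel from $\Omega_C$ to $\Omega_A$, i.e. $\mu(F\times G)=\int_Gq(dj)q(F|j)$. - $S(A:C)=D(\mu\|P\otimes q)$, where $D(\mu\|\lambda)=\int\mu(dx)\log\frac{d\mu}{d\lambda}(x)$ (and $D=\infty$ if the Radon–Nikodym derivative does not exist). - $S(A:B|C)=\int_{\Omega_C}q(dj)\,S\big(\int_{\Omega_A}q(d\omega|j)\varphi_\omega\big)$, with $S$ the von Neumann entropy. *)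

theory Defs
  imports "HOL-Probability.Probability" "Jordan_Normal_Form.Char_Poly"
begin

definition mtrace :: "complex mat \<Rightarrow> complex" where
  "mtrace A = (\<Sum>i<dim_row A. A $$ (i,i))"

definition adj :: "complex mat \<Rightarrow> complex mat" where
  "adj A = mat (dim_col A) (dim_row A) (\<lambda>(i,j). cnj (A $$ (j,i)))"

definition kron :: "complex mat \<Rightarrow> complex mat \<Rightarrow> complex mat" where
  "kron A B = mat (dim_row A * dim_row B) (dim_col A * dim_col B)
     (\<lambda>(i,j). A $$ (i div dim_row B, j div dim_col B) * B $$ (i mod dim_row B, j mod dim_col B))"

definition psd :: "nat \<Rightarrow> complex mat \<Rightarrow> bool" where
  "psd N A \<longleftrightarrow> A \<in> carrier_mat N N \<and> adj A = A \<and>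
     (\<forall>v \<in> carrier_vec N. 0 \<le> Re (conjugate v \<bullet> (A *\<^sub>v v)))"

definition density :: "nat \<Rightarrow> complex mat \<Rightarrow> bool" where
  "density N A \<longleftrightarrow> psd N A \<and> mtrace A = 1"

definition ket_bra :: "complex vec \<Rightarrow> complex mat" where
  "ket_bra v = mat (dim_vec v) (dim_vec v) (\<lambda>(i,j). v $ i * cnj (v $ j))"

definition pure_state :: "nat \<Rightarrow> complex mat \<Rightarrow> bool" where
  "pure_state N A \<longleftrightarrow> (\<exists>v \<in> carrier_vec N. conjugate v \<bullet> v = 1 \<and> A = ket_bra v)"

definition proj_basis :: "nat \<Rightarrow> nat \<Rightarrow> complex mat" where
  "proj_basis c j = mat c c (\<lambda>(a,b). if a = j \<and> b = j then 1 else 0)"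

definition vN_entropy :: "complex mat \<Rightarrow> real" where
  "vN_entropy A = - (\<Sum>l \<in> {l. poly (char_poly A) l = 0}.
      real (order l (char_poly A)) * (Re l * log 2 (Re l)))"

text \<open>Amplification id_k (x) D of a map D (from Nin x Nin to Nout x Nout matrices),
  acting blockwise on k x k block matrices with Nin x Nin blocks.\<close>
definition ampl :: "nat \<Rightarrow> nat \<Rightarrow> nat \<Rightarrow> (complex mat \<Rightarrow> complex mat) \<Rightarrow> complex mat \<Rightarrow> complex mat" where
  "ampl k Nin Nout D X = mat (k * Nout) (k * Nout) (\<lambda>(i,j).
      D (mat Nin Nin (\<lambda>(r,s). X $$ (i div Nout * Nin + r, j div Nout * Nin + s)))
        $$ (i mod Nout, j mod Nout))"

definition cptp :: "nat \<Rightarrow> nat \<Rightarrow> (complex mat \<Rightarrow> complex mat) \<Rightarrow> bool" where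
  "cptp Nin Nout D \<longleftrightarrow>
     (\<forall>A \<in> carrier_mat Nin Nin. D A \<in> carrier_mat Nout Nout) \<and>
     (\<forall>A \<in> carrier_mat Nin Nin. \<forall>B \<in> carrier_mat Nin Nin. D (A + B) = D A + D B) \<and>
     (\<forall>A \<in> carrier_mat Nin Nin. \<forall>a. D (a \<cdot>\<^sub>m A) = a \<cdot>\<^sub>m D A) \<and>
     (\<forall>A \<in> carrier_mat Nin Nin. mtrace (D A) = mtrace A) \<and>
     (\<forall>k X. psd (k * Nin) X \<longrightarrow> psd (k * Nout) (ampl k Nin Nout D X))"

definition pure_source :: "'a measure \<Rightarrow> ('a \<Rightarrow> complex mat) \<Rightarrow> nat \<Rightarrow> bool" where
  "pure_source P \<phi> d \<longleftrightarrow> prob_space P \<and> (\<forall>\<omega> \<in> space P. pure_state d (\<phi> \<omega>)) \<and>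
     (\<forall>i<d. \<forall>j<d. (\<lambda>\<omega>. \<phi> \<omega> $$ (i,j)) \<in> borel_measurable P)"

fun tensor_word :: "('a \<Rightarrow> complex mat) \<Rightarrow> nat \<Rightarrow> (nat \<Rightarrow> 'a) \<Rightarrow> complex mat" where
  "tensor_word \<phi> 0 \<omega> = 1\<^sub>m 1"
| "tensor_word \<phi> (Suc n) \<omega> = kron (tensor_word \<phi> n \<omega>) (\<phi> (\<omega> n))"

abbreviation block_measure :: "'a measure \<Rightarrow> nat \<Rightarrow> (nat \<Rightarrow> 'a) measure" where
  "block_measure P n \<equiv> PiM {..<n} (\<lambda>_. P)"

definition state_space :: "nat \<Rightarrow> complex mat measure" where
  "state_space N = vimage_algebra (Collect (density N))
     (\<lambda>\<rho>. restrict (\<lambda>ij. \<rho> $$ ij) ({..<N} \<times> {..<N}))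
     (PiM ({..<N} \<times> {..<N}) (\<lambda>_. borel))"

text \<open>A visible code of block length n: Omega_C = {..<c} (a finite set with c elements),
  H_B = C^dB, encoder E a Markov kernel from Omega^n to S(H_B) x Omega_C, decoder D a CPTP
  map from operators on H_B (x) l^2(Omega_C) to operators on (C^d)^{(x) n}.\<close>
definition visible_code ::
  "'a measure \<Rightarrow> nat \<Rightarrow> nat \<Rightarrow> nat \<Rightarrow> nat \<Rightarrow>
   ((nat \<Rightarrow> 'a) \<Rightarrow> (complex mat \<times> nat) measure) \<Rightarrow> (complex mat \<Rightarrow> complex mat) \<Rightarrow> bool" where
  "visible_code P d n c dB E D \<longleftrightarrow>
     E \<in> measurable (block_measure P n) (prob_algebra (state_space dB \<Otimes>\<^sub>M count_space {..<c})) \<and>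
     cptp (dB * c) (d ^ n) D"

definition code_output ::
  "nat \<Rightarrow> nat \<Rightarrow> nat \<Rightarrow> ((nat \<Rightarrow> 'a) \<Rightarrow> (complex mat \<times> nat) measure) \<Rightarrow> (complex mat \<Rightarrow> complex mat)
   \<Rightarrow> (nat \<Rightarrow> 'a) \<Rightarrow> complex mat" where
  "code_output d n c E D \<omega> = mat (d ^ n) (d ^ n) (\<lambda>(i,k).
      \<integral>x. D (kron (fst x) (proj_basis c (snd x))) $$ (i,k) \<partial>(E \<omega>))"

definition code_fidelity ::
  "'a measure \<Rightarrow> ('a \<Rightarrow> complex mat) \<Rightarrow> nat \<Rightarrow> nat \<Rightarrow> nat \<Rightarrow>
   ((nat \<Rightarrow> 'a) \<Rightarrow> (complex mat \<times> nat) measure) \<Rightarrow> (complex mat \<Rightarrow> complex mat) \<Rightarrow> real" where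
  "code_fidelity P \<phi> d n c E D =
     (\<integral>\<omega>. Re (mtrace (tensor_word \<phi> n \<omega> * code_output d n c E D \<omega>)) \<partial>(block_measure P n))"

definition Qstar :: "'a measure \<Rightarrow> ('a \<Rightarrow> complex mat) \<Rightarrow> nat \<Rightarrow> real \<Rightarrow> ereal" where
  "Qstar P \<phi> d R = Inf {ereal Q | Q. \<forall>\<epsilon>>0. \<forall>\<delta>>0. \<forall>\<^sub>F n in sequentially.
      \<exists>c dB E D. visible_code P d n c dB E D \<and>
        code_fidelity P \<phi> d n c E D \<ge> 1 - \<epsilon> \<and>
        log 2 (real c) / real n \<le> R + \<delta> \<and>
        log 2 (real dB) / real n \<le> Q + \<delta>}"

text \<open>Relative entropy D(mu||lambda) (base 2), +infinity if mu is not absolutely continuous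
  w.r.t. lambda.  The negative part of log(dmu/dlambda) is always mu-integrable.\<close>
definition rel_entropy :: "'a measure \<Rightarrow> 'a measure \<Rightarrow> ereal" where
  "rel_entropy \<mu> \<nu> =
     (if sets \<mu> = sets \<nu> \<and> absolutely_continuous \<nu> \<mu> then
        enn2ereal (\<integral>\<^sup>+x. ennreal (max 0 (log 2 (enn2real (RN_deriv \<nu> \<mu> x)))) \<partial>\<mu>)
        - enn2ereal (\<integral>\<^sup>+x. ennreal (max 0 (- log 2 (enn2real (RN_deriv \<nu> \<mu> x)))) \<partial>\<mu>)
      else \<infinity>)"

definition joint_measure :: "'a measure \<Rightarrow> ('a \<Rightarrow> 'c measure) \<Rightarrow> 'c measure \<Rightarrow> ('a \<times> 'c) measure" where
  "joint_measure P p C = measure_of (space P \<times> space C) (sets (P \<Otimes>\<^sub>M C))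
      (\<lambda>A. \<integral>\<^sup>+\<omega>. emeasure (p \<omega>) (Pair \<omega> -` A) \<partial>P)"

definition marginal_C :: "'a measure \<Rightarrow> ('a \<Rightarrow> 'c measure) \<Rightarrow> 'c measure \<Rightarrow> 'c measure" where
  "marginal_C P p C = distr (joint_measure P p C) C snd"

definition bayes_inverse :: "'a measure \<Rightarrow> ('a \<Rightarrow> 'c measure) \<Rightarrow> 'c measure \<Rightarrow> ('c \<Rightarrow> 'a measure) \<Rightarrow> bool" where
  "bayes_inverse P p C r \<longleftrightarrow> r \<in> measurable C (prob_algebra P) \<and>
     (\<forall>F \<in> sets P. \<forall>G \<in> sets C.
        emeasure (joint_measure P p C) (F \<times> G) = (\<integral>\<^sup>+j\<in>G. emeasure (r j) F \<partial>(marginal_C P p C)))"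

definition mutual_AC :: "'a measure \<Rightarrow> ('a \<Rightarrow> 'c measure) \<Rightarrow> 'c measure \<Rightarrow> ereal" where
  "mutual_AC P p C = rel_entropy (joint_measure P p C) (P \<Otimes>\<^sub>M marginal_C P p C)"

definition avg_state :: "nat \<Rightarrow> ('a \<Rightarrow> complex mat) \<Rightarrow> 'a measure \<Rightarrow> complex mat" where
  "avg_state d \<phi> \<nu> = mat d d (\<lambda>(i,k). \<integral>\<omega>. \<phi> \<omega> $$ (i,k) \<partial>\<nu>)"

definition cond_AB_C :: "nat \<Rightarrow> ('a \<Rightarrow> complex mat) \<Rightarrow> 'a measure \<Rightarrow> ('a \<Rightarrow> 'c measure) \<Rightarrow> 'c measure
     \<Rightarrow> ('c \<Rightarrow> 'a measure) \<Rightarrow> real" where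
  "cond_AB_C d \<phi> P p C r = (\<integral>j. vN_entropy (avg_state d \<phi> (r j)) \<partial>(marginal_C P p C))"

definition M_quantity :: "'a measure \<Rightarrow> ('a \<Rightarrow> complex mat) \<Rightarrow> nat \<Rightarrow> real \<Rightarrow> ereal" where
  "M_quantity P \<phi> d R = Inf {ereal (cond_AB_C d \<phi> P p C r) | C p r.
      (C :: ((nat \<Rightarrow> real) \<times> (nat \<Rightarrow> 'a)) measure) = C \<and>
      p \<in> measurable P (prob_algebra C) \<and> bayes_inverse P p C r \<and>
      mutual_AC P p C \<le> ereal R}"

end

theory Submission
  imports Defs
begin

text \<open>
  Given the codeword label \<open>j\<close>, the decoder \<open>D\<^sub>j\<close> maps every encoded state to some \<open>X \<le> T\<^sub>j\<close>,
  where \<open>T\<^sub>j\<close> is the image of the identity and has trace \<open>dim H\<^sub>B\<close>. If \<open>X\<close> has high fidelity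
  with a word state \<open>\<phi>\<close>, then \<open>\<phi>\<close> is close to \<open>X \<phi>\<close>, and \<open>|X \<phi>><X \<phi>| \<le> T\<^sub>j\<close> bounds its overlap
  with \<open>- log T\<^sub>j\<close> by about \<open>log dim H\<^sub>B\<close>. By Gibbs' inequality the entropy of the block averaged
  over the words with label \<open>j\<close> is, on average over \<open>j\<close>, at most \<open>log dim H\<^sub>B + o(n)\<close>.

  That entropy dominates the sum over the positions \<open>k\<close> of the entropies of the \<open>k\<close>-th letter
  given \<open>j\<close> and the later letters. This is a case of strong subadditivity; it follows from joint
  convexity of relative entropy, itself obtained by writing the logarithm as an integral of
  resolvents whose expectations are suprema of linear functionals. On the classical side the
  mutual informations of the letters with the same conditioning telescope to at most \<open>log c\<close>
  for \<open>c\<close> labels. A uniformly random \<open>k\<close> together with \<open>j\<close> and the later letters is therefore an admissible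
  single-letter symbol, up to the excess \<open>\<delta>\<close> of the rate. For \<open>R > 0\<close> the excess is removed by
  erasing the symbol with small probability; for \<open>R = 0\<close> the label is absorbed into the quantum system.
\<close>

section \<open>The spectral theorem\<close>

text \<open>The source space is an arbitrary measurable space, on which conditional distributions
  given a symbol need not exist. Every kernel used here therefore has a density \<open>h\<close>
  with values in [0, 1] with respect to a fixed finite measure, and its Bayesian inverse is
  \<open>h\<close> divided by its mean.

  Normalisation is avoided: for a positive matrix \<open>A\<close> of trace \<open>w\<close>, the
  number \<open>vN_entropy A + w * log 2 w\<close> is \<open>w\<close> times the entropy of the
  normalised matrix. It is homogeneous and vanishes at \<open>w = 0\<close>, so labels of
  probability zero cause no divisions in the entropy inequalities.

  The conditioning is on later letters because \<open>tensor_word\<close> appends letters at the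
  end: the state of the first \<open>k\<close> letters is a tensor factor next to letter
  \<open>k\<close>.

  No continuity of the single-letter bound in the rate is presupposed, which is why an excess
  \<delta> needs two devices. Erasure scales the information by R/(R + \<delta>), a factor that
  tends to 1 only for R > 0. At R = 0 the logarithm of the number of labels is itself at most n
  \<delta>, so moving them into the quantum system costs only \<delta> per letter.\<close>

definition ip :: "nat \<Rightarrow> (nat \<Rightarrow> complex) \<Rightarrow> (nat \<Rightarrow> complex) \<Rightarrow> complex" where
  "ip N u v = (\<Sum>i<N. cnj (u i) * v i)"

definition mapply :: "nat \<Rightarrow> (nat \<Rightarrow> nat \<Rightarrow> complex) \<Rightarrow> (nat \<Rightarrow> complex) \<Rightarrow> nat \<Rightarrow> complex" where
  "mapply N A v = (\<lambda>i. \<Sum>k<N. A i k * v k)"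

text \<open>Orthonormality and completeness are both recorded, so that either can be used directly;
  whenever a basis is transformed below, both are recomputed.\<close>

definition onb :: "nat \<Rightarrow> (nat \<Rightarrow> nat \<Rightarrow> complex) \<Rightarrow> bool" where
  "onb N u \<longleftrightarrow> (\<forall>i<N. \<forall>k<N. ip N (u i) (u k) = (if i = k then 1 else 0)) \<and>
     (\<forall>r<N. \<forall>s<N. (\<Sum>i<N. u i r * cnj (u i s)) = (if r = s then 1 else 0))"

lemma ip_cnj: "cnj (ip N u v) = ip N v u"
  by (simp add: ip_def mult.commute)

lemma sum_rotate:
  "(\<Sum>r\<in>A. \<Sum>p\<in>B. \<Sum>q\<in>C. f r p q) = (\<Sum>p\<in>B. \<Sum>q\<in>C. \<Sum>r\<in>A. f r p q)"
  by (rule trans[OF sum.swap]) (intro sum.cong refl sum.swap)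

lemma sum_delta_lessThan:
  fixes f :: "nat \<Rightarrow> complex"
  shows "k < N \<Longrightarrow> (\<Sum>i<N. f i * (if i = k then 1 else 0)) = f k"
    "k < N \<Longrightarrow> (\<Sum>i<N. f i * (if k = i then 1 else 0)) = f k"
    "k < N \<Longrightarrow> (\<Sum>i<N. (if i = k then 1 else 0) * f i) = f k"
    "k < N \<Longrightarrow> (\<Sum>i<N. (if k = i then 1 else 0) * f i) = f k"
  by (auto simp: if_distrib if_distribR cong: if_cong)

lemma onb_expand:
  assumes "onb N u" "r < N"
  shows "(\<Sum>i<N. ip N (u i) v * u i r) = v r"
proof -
  have "(\<Sum>i<N. ip N (u i) v * u i r) = (\<Sum>i<N. \<Sum>s<N. cnj (u i s) * v s * u i r)"
    by (simp add: ip_def sum_distrib_right)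
  also have "\<dots> = (\<Sum>s<N. (\<Sum>i<N. u i r * cnj (u i s)) * v s)"
    by (subst sum.swap) (simp add: sum_distrib_left sum_distrib_right mult_ac)
  also have "\<dots> = (\<Sum>s<N. (if r = s then 1 else 0) * v s)"
    using assms by (intro sum.cong) (auto simp: onb_def)
  also have "\<dots> = v r" using assms(2) by (rule sum_delta_lessThan)
  finally show ?thesis .
qed

lemma onb_parseval:
  assumes "onb N u"
  shows "(\<Sum>i<N. cnj (ip N (u i) v) * ip N (u i) w) = ip N v w"
proof -
  have "(\<Sum>i<N. cnj (ip N (u i) v) * ip N (u i) w)
      = (\<Sum>i<N. \<Sum>r<N. cnj (v r) * (ip N (u i) w * u i r))"
    unfolding ip_cnj ip_def[of N v] sum_distrib_right by (intro sum.cong refl) (simp only: mult_ac)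
  also have "\<dots> = (\<Sum>r<N. cnj (v r) * (\<Sum>i<N. ip N (u i) w * u i r))"
    by (subst sum.swap) (simp add: sum_distrib_left)
  also have "\<dots> = ip N v w"
    unfolding ip_def[of N v w] by (intro sum.cong) (simp_all add: onb_expand[OF assms])
  finally show ?thesis .
qed

lemma ip_self: "ip N v v = of_real (\<Sum>i<N. (cmod (v i))\<^sup>2)"
  unfolding ip_def of_real_sum by (intro sum.cong refl) (metis complex_norm_square mult.commute of_real_power)

lemma onb_parseval_norm:
  assumes "onb N u"
  shows "(\<Sum>i<N. (cmod (ip N (u i) v))\<^sup>2) = (\<Sum>i<N. (cmod (v i))\<^sup>2)"
proof -
  have "complex_of_real (\<Sum>i<N. (cmod (ip N (u i) v))\<^sup>2) = of_real (\<Sum>i<N. (cmod (v i))\<^sup>2)"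
    using onb_parseval[OF assms, of v v] unfolding ip_self[symmetric] 
    by (simp add: ip_def[of N "\<lambda>i. ip N (u i) v" "\<lambda>i. ip N (u i) v", symmetric] ip_self)
  then show ?thesis by (simp only: of_real_eq_iff)
qed

lemma onb_norm: "onb N u \<Longrightarrow> i < N \<Longrightarrow> (\<Sum>r<N. (cmod (u i r))\<^sup>2) = 1"
proof -
  assume "onb N u" "i < N"
  then have "ip N (u i) (u i) = 1" by (simp add: onb_def)
  then have "complex_of_real (\<Sum>r<N. (cmod (u i r))\<^sup>2) = of_real 1" unfolding ip_self by simp
  then show ?thesis by (simp only: of_real_eq_iff)
qed

lemma norm_lincomb:
  assumes "onb N u"
  shows "(\<Sum>r<N. (cmod (\<Sum>i<N. \<alpha> i * u i r))\<^sup>2) = (\<Sum>i<N. (cmod (\<alpha> i))\<^sup>2)"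
proof -
  have *: "ip N (u k) (\<lambda>r. \<Sum>i<N. \<alpha> i * u i r) = \<alpha> k" if "k < N" for k
  proof -
    have "ip N (u k) (\<lambda>r. \<Sum>i<N. \<alpha> i * u i r) = (\<Sum>i<N. \<alpha> i * ip N (u k) (u i))"
      unfolding ip_def by (simp add: sum_distrib_left) (subst sum.swap, simp add: mult_ac)
    also have "\<dots> = (\<Sum>i<N. \<alpha> i * (if k = i then 1 else 0))"
      using assms that by (intro sum.cong) (auto simp: onb_def)
    also have "\<dots> = \<alpha> k" using that by (rule sum_delta_lessThan)
    finally show ?thesis .
  qed
  show ?thesis
    using onb_parseval_norm[OF assms, of "\<lambda>r. \<Sum>i<N. \<alpha> i * u i r"] * by simp
qed

text \<open>An eigendecomposition into rank-one terms, with eigenvalues repeated according to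
  multiplicity and in no particular order. Only entries below \<open>N\<close> are
  constrained.\<close>

definition spectral :: "nat \<Rightarrow> (nat \<Rightarrow> nat \<Rightarrow> complex) \<Rightarrow> (nat \<Rightarrow> nat \<Rightarrow> complex) \<Rightarrow> (nat \<Rightarrow> real) \<Rightarrow> bool" where
  "spectral N A u l \<longleftrightarrow> onb N u \<and>
     (\<forall>r<N. \<forall>s<N. A r s = (\<Sum>i<N. of_real (l i) * u i r * cnj (u i s)))"

text \<open>The reflection exchanging the first basis vector with \<open>v\<close>; it is unitary because
  the first component of \<open>v\<close> is real and nonpositive.\<close>
lemma householder:
  fixes v :: "nat \<Rightarrow> complex"
  assumes N: "0 < N" and nv: "ip N v v = 1" and v0: "v 0 = of_real x" "x \<le> 0"
  shows "\<exists>H. (\<forall>r s. H r s = cnj (H s r)) \<and> (\<forall>r<N. H r 0 = v r) \<and>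
    (\<forall>r<N. \<forall>s<N. (\<Sum>q<N. H r q * H q s) = (if r = s then 1 else 0))"
proof -
  define w where "w r = (if r = 0 then 1 else 0) - v r" for r
  \<comment> \<open>As \<open>v 0 = x\<close> is real, \<open>w\<close> has squared norm
    \<open>2 - 2 * x = 2 * c\<close>, so \<open>H\<close> is the identity minus twice the projection
    onto \<open>w\<close>. The sign of \<open>x\<close> gives \<open>c >= 1\<close>, so
    \<open>w\<close> is never zero.\<close>
  define c where "c = 1 - x"
  define H where "H r s = (if r = s then 1 else 0) - w r * cnj (w s) / of_real c" for r s :: nat
  have c: "c > 0" using v0 by (simp add: c_def)
  have ww: "(\<Sum>q<N. cnj (w q) * w q) = 2 * of_real c"
  proof -
    have "(\<Sum>q<N. cnj (w q) * w q) = (\<Sum>q<N. (if q = 0 then 1 else 0) * (1 - v q - cnj (v q)) + cnj (v q) * v q)"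
      by (intro sum.cong) (auto simp: w_def algebra_simps)
    also have "\<dots> = 1 - v 0 - cnj (v 0) + ip N v v"
      unfolding sum.distrib ip_def using N by (subst sum_delta_lessThan) auto
    finally show ?thesis using nv v0 by (simp add: c_def)
  qed
  show ?thesis
  proof (intro exI[of _ H] conjI allI impI)
    show "H r s = cnj (H s r)" for r s by (simp add: H_def)
    show "H r 0 = v r" if "r < N" for r
      using c v0 by (simp add: H_def w_def c_def field_simps)
    fix r s assume rs: "r < N" "s < N"
    have alg0: "(p - a * b * i) * (q - e * f * i) = p * q - p * (e * f * i) - (a * b * i) * q
        + (b * e) * (a * f * (i * i))" for p q a b i e f :: complex
      by (simp add: algebra_simps)
    have alg: "(p - a * b / c) * (q - e * f / c) = p * q - p * (e * f / c) - (a * b / c) * q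
        + (b * e) * (a * f / (c * c))" for p q a b c e f :: complex
      unfolding divide_inverse inverse_mult_distrib by (rule alg0)
    have "(\<Sum>q<N. H r q * H q s) = (\<Sum>q<N. (if r = q then 1 else 0) * (if q = s then 1 else 0)
        - (if r = q then 1 else 0) * (w q * cnj (w s) / of_real c)
        - (w r * cnj (w q) / of_real c) * (if q = s then 1 else 0)
        + (cnj (w q) * w q) * (w r * cnj (w s) / (of_real c * of_real c)))"
      unfolding H_def by (intro sum.cong refl) (rule alg)
    also have "\<dots> = (if r = s then 1 else 0) - w r * cnj (w s) / of_real c - w r * cnj (w s) / of_real c
        + 2 * of_real c * (w r * cnj (w s) / (of_real c * of_real c))"
      unfolding sum.distrib sum_subtractf sum_distrib_right[symmetric] ww
        sum_delta_lessThan(4)[OF rs(1)] sum_delta_lessThan(1)[OF rs(2)] ..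
    also have "\<dots> = (if r = s then 1 else 0)" using c by (simp add: field_simps)
    finally show "(\<Sum>q<N. H r q * H q s) = (if r = s then 1 else 0)" .
  qed
qed

text \<open>A root of the characteristic polynomial supplies the eigenvalue; it is real because the
  quadratic form of a Hermitian matrix equals its own conjugate.\<close>

lemma hermitian_eigenvector:
  fixes A :: "nat \<Rightarrow> nat \<Rightarrow> complex"
  assumes N: "0 < N" and herm: "\<And>r s. r < N \<Longrightarrow> s < N \<Longrightarrow> A r s = cnj (A s r)"
  obtains v e x where "ip N v v = 1" "v 0 = of_real x" "x \<le> 0"
    "\<And>r. r < N \<Longrightarrow> mapply N A v r = of_real e * v r"
proof -
  define M where "M = mat N N (\<lambda>(i,j). A i j)"
  have M: "M \<in> carrier_mat N N" by (simp add: M_def)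
  have "degree (char_poly M) = N" using degree_monic_char_poly[OF M] by simp
  then have "\<not> constant (poly (char_poly M))" using N by (simp add: constant_degree)
  then obtain z where "poly (char_poly M) z = 0" using fundamental_theorem_of_algebra by blast
  then have "eigenvalue M z" using eigenvalue_root_char_poly[OF M] by simp
  then obtain y where y: "y \<in> carrier_vec N" "y \<noteq> 0\<^sub>v N" "M *\<^sub>v y = z \<cdot>\<^sub>v y"
    unfolding eigenvalue_def eigenvector_def using M by auto
  define y' where "y' i = y $ i" for i
  have ey: "mapply N A y' r = z * y' r" if "r < N" for r
  proof -
    have "(M *\<^sub>v y) $ r = z * y' r" using y that by (simp add: y'_def)
    moreover have "(M *\<^sub>v y) $ r = mapply N A y' r"
      using that y(1) by (simp add: M_def mapply_def y'_def scalar_prod_def atLeast0LessThan)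
    ultimately show ?thesis by simp
  qed
  define nn where "nn = (\<Sum>i<N. (cmod (y' i))\<^sup>2)"
  have "nn \<noteq> 0"
  proof
    assume "nn = 0"
    then have "\<forall>i<N. y' i = 0" unfolding nn_def by (subst (asm) sum_nonneg_eq_0_iff) auto
    then show False using y by (auto simp: y'_def vec_eq_iff carrier_vecD)
  qed
  then have nn: "nn > 0" unfolding nn_def by (simp add: order_less_le sum_nonneg)
  have ipy: "ip N y' y' = of_real nn" by (simp add: ip_self nn_def)
  have z1: "ip N y' (mapply N A y') = z * of_real nn"
  proof -
    have "ip N y' (mapply N A y') = (\<Sum>r<N. z * (cnj (y' r) * y' r))"
      unfolding ip_def by (intro sum.cong) (auto simp: ey)
    then show ?thesis by (simp add: ipy[symmetric] ip_def sum_distrib_left)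
  qed
  have z2: "cnj (ip N y' (mapply N A y')) = ip N y' (mapply N A y')"
  proof -
    have "cnj (ip N y' (mapply N A y')) = (\<Sum>r<N. \<Sum>s<N. cnj (y' s) * (cnj (A r s) * y' r))"
      by (simp add: ip_def mapply_def sum_distrib_left mult_ac)
    also have "\<dots> = (\<Sum>r<N. \<Sum>s<N. cnj (y' s) * (A s r * y' r))"
      by (intro sum.cong refl) (simp add: herm[symmetric])
    also have "\<dots> = ip N y' (mapply N A y')"
      by (subst sum.swap) (simp add: ip_def mapply_def sum_distrib_left)
    finally show ?thesis .
  qed
  have "cnj z = z" using z2 unfolding z1 using nn by simp
  then obtain e where e: "z = of_real e" by (metis complex_cnj_cancel_iff Reals_cnj_iff Reals_cases)
  \<comment> \<open>This phase turns the first component into minus its modulus, the real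
    nonpositive form that the reflection requires.\<close>
  define ph where "ph = (if y' 0 = 0 then 1 else - cnj (y' 0) / of_real (cmod (y' 0)))"
  have ph: "cmod ph = 1" by (simp add: ph_def norm_divide)
  define v where "v i = ph / of_real (sqrt nn) * y' i" for i
  show ?thesis
  proof (rule that)
    have "cnj (v i) * v i = of_real (1 / nn) * (cnj (y' i) * y' i)" for i
    proof -
      have "(complex_of_real (sqrt nn))\<^sup>2 = of_real nn"
        using nn by (metis less_imp_le of_real_power real_sqrt_pow2)
      moreover have "cnj ph * ph = 1"
        using complex_norm_square[of ph] ph by (simp add: mult.commute)
      moreover have "cnj (v i) * v i = (cnj ph * ph) * (cnj (y' i) * y' i) / (complex_of_real (sqrt nn))\<^sup>2"
        by (simp add: v_def power2_eq_square)
      ultimately show ?thesis by simp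
    qed
    then have "ip N v v = of_real (1 / nn) * ip N y' y'"
      unfolding ip_def sum_distrib_left by (intro sum.cong refl)
    then show "ip N v v = 1" using nn unfolding ipy by simp
    show "v 0 = of_real (- cmod (y' 0) / sqrt nn)"
    proof (cases "y' 0 = 0")
      case False
      then have "v 0 = - (y' 0 * cnj (y' 0)) / (of_real (cmod (y' 0)) * of_real (sqrt nn))"
        by (simp add: v_def ph_def mult.commute)
      also have "y' 0 * cnj (y' 0) = of_real (cmod (y' 0)) * of_real (cmod (y' 0))"
        by (metis complex_norm_square of_real_mult power2_eq_square)
      finally show ?thesis using False by simp
    qed (simp add: v_def)
    show "- cmod (y' 0) / sqrt nn \<le> 0" using nn by simp
    show "mapply N A v r = of_real e * v r" if "r < N" for r
    proof -
      have "mapply N A v r = ph / of_real (sqrt nn) * mapply N A y' r"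
        unfolding mapply_def sum_distrib_left v_def by (intro sum.cong refl) (simp only: mult_ac)
      then show ?thesis using ey[OF that] by (simp add: v_def e)
    qed
  qed
qed

text \<open>Deflation: a reflection carries the first basis vector to an eigenvector, conjugation by
  it splits the matrix into the eigenvalue and a smaller Hermitian block, and the induction
  hypothesis diagonalises that block.\<close>

lemma spectral_exists:
  fixes A :: "nat \<Rightarrow> nat \<Rightarrow> complex"
  assumes herm: "\<And>r s. r < N \<Longrightarrow> s < N \<Longrightarrow> A r s = cnj (A s r)"
  shows "\<exists>u l. spectral N A u l"
  using assms
proof (induction N arbitrary: A)
  case 0
  show ?case by (simp add: spectral_def onb_def)
next
  case (Suc N)
  have "\<exists>v e x. ip (Suc N) v v = 1 \<and> v 0 = of_real x \<and> x \<le> 0 \<and>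
      (\<forall>r<Suc N. mapply (Suc N) A v r = of_real e * v r)"
  proof (rule hermitian_eigenvector[of "Suc N" A])
    show "A r s = cnj (A s r)" if "r < Suc N" "s < Suc N" for r s using that by (rule Suc.prems)
  next
    fix v e x
    assume a: "ip (Suc N) v v = 1" "v 0 = of_real x" "x \<le> 0"
      "\<And>r. r < Suc N \<Longrightarrow> mapply (Suc N) A v r = of_real e * v r"
    show ?thesis
      by (rule exI[of _ v], rule exI[of _ e], rule exI[of _ x]) (intro conjI allI impI a)
  qed (rule zero_less_Suc)
  then obtain v e x where v: "ip (Suc N) v v = 1" "v 0 = of_real x" "x \<le> 0"
    and ev: "\<And>r. r < Suc N \<Longrightarrow> mapply (Suc N) A v r = of_real e * v r" by blast
  from householder[OF zero_less_Suc v] obtain H where "(\<forall>r s. H r s = cnj (H s r)) \<and> (\<forall>r<Suc N. H r 0 = v r) \<and>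
    (\<forall>r<Suc N. \<forall>s<Suc N. (\<Sum>q<Suc N. H r q * H q s) = (if r = s then 1 else 0))" ..
  then have Hh: "\<And>r s. H r s = cnj (H s r)" and H0: "\<And>r. r < Suc N \<Longrightarrow> H r 0 = v r"
    and HH: "\<And>r s. r < Suc N \<Longrightarrow> s < Suc N \<Longrightarrow> (\<Sum>q<Suc N. H r q * H q s) = (if r = s then 1 else 0)"
    by blast+
  define A' where "A' p q = (\<Sum>r<Suc N. H p r * (\<Sum>s<Suc N. A r s * H s q))" for p q
  have A'h: "A' p q = cnj (A' q p)" for p q
  proof -
    have "cnj (A' q p) = (\<Sum>r<Suc N. \<Sum>s<Suc N. cnj (H q r) * cnj (A r s) * cnj (H s p))"
      unfolding A'_def by (simp only: cnj_sum complex_cnj_mult sum_distrib_left mult.assoc)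
    also have "\<dots> = (\<Sum>r<Suc N. \<Sum>s<Suc N. H p s * (A s r * H r q))"
    proof (intro sum.cong refl)
      fix r s assume "r \<in> {..<Suc N}" "s \<in> {..<Suc N}"
      then have "A s r = cnj (A r s)" using Suc.prems[of s r] by simp
      then show "cnj (H q r) * cnj (A r s) * cnj (H s p) = H p s * (A s r * H r q)"
        using Hh[of r q] Hh[of p s] by (simp only: mult_ac)
    qed
    also have "\<dots> = A' p q" unfolding A'_def sum_distrib_left by (rule sum.swap)
    finally show ?thesis ..
  qed
  \<comment> \<open>The first column of the conjugated matrix; its first row follows by Hermitian
    symmetry.\<close>
  have A'0: "A' p 0 = of_real e * (if p = 0 then 1 else 0)" if p: "p < Suc N" for p
  proof -
    have "A' p 0 = (\<Sum>r<Suc N. H p r * mapply (Suc N) A v r)"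
      unfolding A'_def mapply_def by (intro sum.cong refl arg_cong2[of _ _ _ _ "(*)"]) (simp add: H0)
    also have "\<dots> = of_real e * (\<Sum>r<Suc N. H p r * H r 0)"
      unfolding sum_distrib_left by (intro sum.cong refl) (simp add: ev H0)
    finally show ?thesis using HH[OF p, of 0] by simp
  qed
  obtain u l where ul: "spectral N (\<lambda>p q. A' (Suc p) (Suc q)) u l"
    using Suc.IH[of "\<lambda>p q. A' (Suc p) (Suc q)"] A'h by blast
  \<comment> \<open>\<open>W\<close> and \<open>m\<close> diagonalise the conjugated matrix: the
    first basis vector with eigenvalue \<open>e\<close>, then the basis of the block shifted by one
    index.\<close>
  define W where "W i k = (case i of 0 \<Rightarrow> (if k = 0 then 1 else 0)
      | Suc i' \<Rightarrow> (case k of 0 \<Rightarrow> 0 | Suc k' \<Rightarrow> u i' k'))" for i k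
  define m where "m i = (case i of 0 \<Rightarrow> e | Suc i' \<Rightarrow> l i')" for i
  have W: "W 0 0 = 1" "W 0 (Suc k) = 0" "W (Suc i) 0 = 0" "W (Suc i) (Suc k) = u i k" for i k
    by (auto simp: W_def)
  have onbu: "(\<Sum>r<N. cnj (u i r) * u k r) = (if i = k then 1 else 0)"
    "(\<Sum>j<N. u j i * cnj (u j k)) = (if i = k then 1 else 0)" if "i < N" "k < N" for i k
    using ul that by (auto simp: spectral_def onb_def ip_def)
  have onbW: "(\<Sum>r<Suc N. cnj (W i r) * W k r) = (if i = k then 1 else 0)"
    "(\<Sum>j<Suc N. W j i * cnj (W j k)) = (if i = k then 1 else 0)" if "i < Suc N" "k < Suc N" for i k
    using that by (cases i; cases k; simp add: W onbu sum.lessThan_Suc_shift del: sum.lessThan_Suc)+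
  have specW: "A' p q = (\<Sum>i<Suc N. of_real (m i) * W i p * cnj (W i q))" if "p < Suc N" "q < Suc N" for p q
  proof (cases "p = 0 \<or> q = 0")
    case True
    have "A' p q = of_real e * (if p = 0 \<and> q = 0 then 1 else 0)"
      using A'0[of p] A'0[of q] A'h[of p q] True that by auto
    then show ?thesis using True
      by (cases p; cases q; simp add: W m_def sum.lessThan_Suc_shift del: sum.lessThan_Suc)
  next
    case False
    then obtain p' q' where "p = Suc p'" "q = Suc q'" by (meson not0_implies_Suc)
    then show ?thesis using ul that
      by (simp add: spectral_def W m_def sum.lessThan_Suc_shift del: sum.lessThan_Suc)
  qed
  \<comment> \<open>Transport back by \<open>H\<close>, which is its own inverse.\<close>
  define U where "U i r = (\<Sum>k<Suc N. H r k * W i k)" for i r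
  have "ip (Suc N) (U i) (U k) = (if i = k then 1 else 0)" if ik: "i < Suc N" "k < Suc N" for i k
  proof -
    have "ip (Suc N) (U i) (U k) = (\<Sum>r<Suc N. \<Sum>p<Suc N. \<Sum>q<Suc N. cnj (H r p) * cnj (W i p) * (H r q * W k q))"
      unfolding ip_def U_def by (simp only: cnj_sum complex_cnj_mult sum_product)
    also have "\<dots> = (\<Sum>r<Suc N. \<Sum>p<Suc N. \<Sum>q<Suc N. (cnj (W i p) * W k q) * (H p r * H r q))"
      using Hh[symmetric] by (simp only: mult_ac)
    also have "\<dots> = (\<Sum>p<Suc N. \<Sum>q<Suc N. (cnj (W i p) * W k q) * (\<Sum>r<Suc N. H p r * H r q))"
      unfolding sum_distrib_left by (rule sum_rotate)
    also have "\<dots> = (\<Sum>p<Suc N. \<Sum>q<Suc N. (cnj (W i p) * W k q) * (if p = q then 1 else 0))"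
      by (intro sum.cong refl) (simp add: HH del: sum.lessThan_Suc)
    also have "\<dots> = (\<Sum>p<Suc N. cnj (W i p) * W k p)"
      by (intro sum.cong refl, subst sum_delta_lessThan(2)) auto
    finally show ?thesis using onbW(1)[OF ik] by simp
  qed
  moreover have "(\<Sum>i<Suc N. U i r * cnj (U i s)) = (if r = s then 1 else 0)" if rs: "r < Suc N" "s < Suc N" for r s
  proof -
    have "(\<Sum>i<Suc N. U i r * cnj (U i s)) = (\<Sum>i<Suc N. \<Sum>p<Suc N. \<Sum>q<Suc N. H r p * W i p * (cnj (H s q) * cnj (W i q)))"
      unfolding U_def by (simp only: cnj_sum complex_cnj_mult sum_product)
    also have "\<dots> = (\<Sum>i<Suc N. \<Sum>p<Suc N. \<Sum>q<Suc N. (H r p * H q s) * (W i p * cnj (W i q)))"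
      using Hh[symmetric] by (simp only: mult_ac)
    also have "\<dots> = (\<Sum>p<Suc N. \<Sum>q<Suc N. (H r p * H q s) * (\<Sum>i<Suc N. W i p * cnj (W i q)))"
      unfolding sum_distrib_left by (rule sum_rotate)
    also have "\<dots> = (\<Sum>p<Suc N. \<Sum>q<Suc N. (H r p * H q s) * (if p = q then 1 else 0))"
      by (intro sum.cong refl) (simp add: onbW(2) del: sum.lessThan_Suc)
    also have "\<dots> = (\<Sum>p<Suc N. H r p * H p s)"
      by (intro sum.cong refl, subst sum_delta_lessThan(2)) auto
    finally show ?thesis using HH[OF rs] by simp
  qed
  moreover have "A r s = (\<Sum>i<Suc N. of_real (m i) * U i r * cnj (U i s))" if rs: "r < Suc N" "s < Suc N" for r s
  proof -
    have "(\<Sum>i<Suc N. of_real (m i) * U i r * cnj (U i s))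
        = (\<Sum>i<Suc N. \<Sum>p<Suc N. \<Sum>q<Suc N. H r p * W i p * (cnj (H s q) * cnj (W i q)) * of_real (m i))"
      unfolding U_def by (simp only: cnj_sum complex_cnj_mult sum_product sum_distrib_left mult_ac)
    also have "\<dots> = (\<Sum>i<Suc N. \<Sum>p<Suc N. \<Sum>q<Suc N. (H r p * H q s) * (of_real (m i) * W i p * cnj (W i q)))"
      using Hh[symmetric] by (simp only: mult_ac)
    also have "\<dots> = (\<Sum>p<Suc N. \<Sum>q<Suc N. (H r p * H q s) * (\<Sum>i<Suc N. of_real (m i) * W i p * cnj (W i q)))"
      unfolding sum_distrib_left by (rule sum_rotate)
    also have "\<dots> = (\<Sum>p<Suc N. \<Sum>q<Suc N. (H r p * H q s) * A' p q)"
      by (intro sum.cong refl) (simp add: specW del: sum.lessThan_Suc)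
    also have "\<dots> = (\<Sum>p<Suc N. \<Sum>q<Suc N. \<Sum>t<Suc N. \<Sum>w<Suc N. H r p * H p t * (A t w * (H w q * H q s)))"
      unfolding A'_def sum_distrib_left by (simp only: mult_ac)
    also have "\<dots> = (\<Sum>p<Suc N. \<Sum>t<Suc N. \<Sum>w<Suc N. \<Sum>q<Suc N. H r p * H p t * (A t w * (H w q * H q s)))"
      by (intro sum.cong refl sum_rotate)
    also have "\<dots> = (\<Sum>p<Suc N. \<Sum>t<Suc N. \<Sum>w<Suc N. H r p * H p t * (A t w * (if w = s then 1 else 0)))"
      unfolding sum_distrib_left[symmetric] using rs
      by (intro sum.cong refl) (simp add: HH del: sum.lessThan_Suc)
    also have "\<dots> = (\<Sum>p<Suc N. \<Sum>t<Suc N. H r p * H p t * A t s)"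
      unfolding sum_distrib_left[symmetric] sum_delta_lessThan(1)[OF rs(2)] ..
    also have "\<dots> = (\<Sum>t<Suc N. \<Sum>p<Suc N. H r p * H p t * A t s)" by (rule sum.swap)
    also have "\<dots> = (\<Sum>t<Suc N. (if r = t then 1 else 0) * A t s)"
      unfolding sum_distrib_right[symmetric] using rs
      by (intro sum.cong refl) (simp add: HH del: sum.lessThan_Suc)
    also have "\<dots> = A r s" by (rule sum_delta_lessThan(4)[OF rs(1)])
    finally show ?thesis ..
  qed
  ultimately have "spectral (Suc N) A U m" unfolding spectral_def onb_def by blast
  then show ?case by blast
qed

section \<open>Von Neumann entropy in terms of the spectrum\<close>

definition mfun :: "complex mat \<Rightarrow> nat \<Rightarrow> nat \<Rightarrow> complex" where
  "mfun A r s = A $$ (r, s)"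

definition quad :: "nat \<Rightarrow> (nat \<Rightarrow> nat \<Rightarrow> complex) \<Rightarrow> (nat \<Rightarrow> complex) \<Rightarrow> complex" where
  "quad N A v = (\<Sum>r<N. \<Sum>s<N. cnj (v r) * A r s * v s)"

text \<open>Passes from the matrix and vector types of \<open>psd\<close> to plain functions of
  indices, in which all later sums are computed.\<close>

lemma psd_iff_quad:
  "psd N A \<longleftrightarrow> A \<in> carrier_mat N N \<and> (\<forall>r<N. \<forall>s<N. mfun A r s = cnj (mfun A s r)) \<and>
     (\<forall>v. 0 \<le> Re (quad N (mfun A) v))"
proof -
  have 1: "adj A = A \<longleftrightarrow> (\<forall>r<N. \<forall>s<N. mfun A r s = cnj (mfun A s r))" if A: "A \<in> carrier_mat N N"
  proof
    assume "adj A = A"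
    then have *: "mfun A r s = mfun (adj A) r s" for r s by (simp only:)
    have "mfun (adj A) r s = cnj (mfun A s r)" if "r < N" "s < N" for r s
      using A that by (simp add: adj_def mfun_def)
    then show "\<forall>r<N. \<forall>s<N. mfun A r s = cnj (mfun A s r)"
      by (intro allI impI) (rule trans[OF *])
  next
    assume h: "\<forall>r<N. \<forall>s<N. mfun A r s = cnj (mfun A s r)"
    show "adj A = A"
    proof (intro eq_matI)
      fix i j assume "i < dim_row A" "j < dim_col A"
      then have ij: "i < N" "j < N" using A by auto
      have "adj A $$ (i, j) = cnj (mfun A j i)" using A ij by (simp add: adj_def mfun_def)
      also have "\<dots> = mfun A i j" by (rule h[rule_format, OF ij, symmetric])
      finally show "adj A $$ (i, j) = A $$ (i, j)" by (simp only: mfun_def)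
    qed (use A in \<open>auto simp: adj_def\<close>)
  qed
  have 2: "conjugate (vec N v) \<bullet> (A *\<^sub>v vec N v) = quad N (mfun A) v" if A: "A \<in> carrier_mat N N" for v
    using A by (simp add: scalar_prod_def quad_def mfun_def atLeast0LessThan sum_distrib_left mult.assoc)
  have 3: "(\<forall>v \<in> carrier_vec N. 0 \<le> Re (conjugate v \<bullet> (A *\<^sub>v v))) \<longleftrightarrow> (\<forall>v. 0 \<le> Re (quad N (mfun A) v))"
    if A: "A \<in> carrier_mat N N"
  proof
    assume *: "\<forall>v \<in> carrier_vec N. 0 \<le> Re (conjugate v \<bullet> (A *\<^sub>v v))"
    show "\<forall>v. 0 \<le> Re (quad N (mfun A) v)" using * 2[OF A] by (metis vec_carrier)
  next
    assume *: "\<forall>v. 0 \<le> Re (quad N (mfun A) v)"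
    show "\<forall>v \<in> carrier_vec N. 0 \<le> Re (conjugate v \<bullet> (A *\<^sub>v v))"
    proof
      fix v :: "complex vec" assume "v \<in> carrier_vec N"
      then have "v = vec N (\<lambda>i. v $ i)" by auto
      then show "0 \<le> Re (conjugate v \<bullet> (A *\<^sub>v v))" using 2[OF A, of "\<lambda>i. v $ i"] * by simp
    qed
  qed
  show ?thesis unfolding psd_def using 1 3 by blast
qed

lemma quad_spectral:
  assumes "spectral N A u l"
  shows "quad N A v = of_real (\<Sum>i<N. l i * (cmod (ip N (u i) v))\<^sup>2)"
proof -
  have "quad N A v = (\<Sum>r<N. \<Sum>s<N. \<Sum>i<N. cnj (v r) * (of_real (l i) * u i r * cnj (u i s)) * v s)"
    using assms unfolding quad_def spectral_def
    by (intro sum.cong refl) (simp add: sum_distrib_left sum_distrib_right)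
  also have "\<dots> = (\<Sum>r<N. \<Sum>i<N. \<Sum>s<N. cnj (v r) * (of_real (l i) * u i r * cnj (u i s)) * v s)"
    by (intro sum.cong refl sum.swap)
  also have "\<dots> = (\<Sum>i<N. \<Sum>r<N. \<Sum>s<N. cnj (v r) * (of_real (l i) * u i r * cnj (u i s)) * v s)"
    by (rule sum.swap)
  also have "\<dots> = (\<Sum>i<N. of_real (l i) * (ip N v (u i) * ip N (u i) v))"
    unfolding ip_def sum_product unfolding sum_distrib_left by (simp only: mult_ac)
  also have "\<dots> = (\<Sum>i<N. of_real (l i * (cmod (ip N (u i) v))\<^sup>2))"
  proof (intro sum.cong refl)
    fix i
    have "ip N v (u i) * ip N (u i) v = of_real ((cmod (ip N (u i) v))\<^sup>2)"
      using complex_norm_square[of "ip N (u i) v"] by (simp only: ip_cnj mult.commute)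
    then show "of_real (l i) * (ip N v (u i) * ip N (u i) v) = of_real (l i * (cmod (ip N (u i) v))\<^sup>2)"
      by (simp only: of_real_mult)
  qed
  finally show ?thesis by simp
qed

lemma ip_onb_self: "onb N u \<Longrightarrow> i < N \<Longrightarrow> k < N \<Longrightarrow> ip N (u i) (u k) = (if i = k then 1 else 0)"
  by (simp add: onb_def)

lemma quad_eigenvector:
  assumes "spectral N A u l" "k < N"
  shows "quad N A (u k) = of_real (l k)"
proof -
  have "(\<Sum>i<N. l i * (cmod (ip N (u i) (u k)))\<^sup>2) = (\<Sum>i<N. if i = k then l i else 0)"
    using assms by (intro sum.cong) (auto simp: spectral_def ip_onb_self)
  then show ?thesis using quad_spectral[OF assms(1), of "u k"] assms(2) by simp
qed

lemma psd_spectral: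
  assumes "psd N A"
  obtains u l where "spectral N (mfun A) u l" "\<And>i. i < N \<Longrightarrow> 0 \<le> l i"
proof -
  obtain u l where ul: "spectral N (mfun A) u l"
    using spectral_exists[of N "mfun A"] assms unfolding psd_iff_quad by blast
  moreover have "0 \<le> l i" if "i < N" for i
    using assms quad_eigenvector[OF ul that] unfolding psd_iff_quad by (metis Re_complex_of_real)
  ultimately show ?thesis using that by blast
qed

lemma order_prod_linear:
  fixes c :: "nat \<Rightarrow> complex"
  shows "order z (\<Prod>i<N. [:- c i, 1:]) = card {i. i < N \<and> c i = z}"
proof (induction N)
  case 0
  have "\<not> [:- z, 1:] dvd 1" by (simp add: poly_eq_0_iff_dvd[symmetric])
  then show ?case by (simp add: order_0I)
next
  case (Suc N)
  have "order z [:- c N, 1:] = (if c N = z then 1 else 0)"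
    using order_linear_power[of z "- c N" 1] by (auto simp: order_linear')
  moreover have "order z (\<Prod>i<Suc N. [:- c i, 1:]) = order z (\<Prod>i<N. [:- c i, 1:]) + order z [:- c N, 1:]"
  proof -
    have "(\<Prod>i<N. [:- c i, 1:]) * [:- c N, 1:] \<noteq> 0"
      unfolding mult_eq_0_iff prod_zero_iff[OF finite_lessThan] by auto
    then show ?thesis unfolding prod.lessThan_Suc by (rule order_mult)
  qed
  moreover have "{i. i < Suc N \<and> c i = z} = {i. i < N \<and> c i = z} \<union> (if c N = z then {N} else {})"
    by (auto simp: less_Suc_eq)
  moreover have "card ({i. i < N \<and> c i = z} \<union> (if c N = z then {N} else {}))
      = card {i. i < N \<and> c i = z} + (if c N = z then 1 else 0)"
    by (subst card_Un_disjoint) auto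
  ultimately show ?case using Suc by simp
qed

text \<open>\<open>vN_entropy\<close> sums over distinct roots weighted by their orders; this
  converts such a sum into one over a list of eigenvalues with repetitions.\<close>

lemma sum_roots_prod_linear:
  fixes c :: "nat \<Rightarrow> complex" and f :: "complex \<Rightarrow> real"
  shows "(\<Sum>z \<in> {z. poly (\<Prod>i<N. [:- c i, 1:]) z = 0}. real (order z (\<Prod>i<N. [:- c i, 1:])) * f z)
    = (\<Sum>i<N. f (c i))"
proof -
  have "{z. poly (\<Prod>i<N. [:- c i, 1:]) z = 0} = c ` {..<N}"
    by (auto simp: poly_prod)
  moreover have "(\<Sum>i<N. f (c i)) = (\<Sum>z \<in> c ` {..<N}. \<Sum>i \<in> {i \<in> {..<N}. c i = z}. f (c i))"
    by (rule sum.image_gen) simp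
  moreover have "\<dots> = (\<Sum>z \<in> c ` {..<N}. real (card {i. i < N \<and> c i = z}) * f z)"
    by (intro sum.cong refl) simp
  ultimately show ?thesis by (simp add: order_prod_linear)
qed

text \<open>\<open>A\<close> is similar to the diagonal matrix of the \<open>l i\<close>, and
  similar matrices share their characteristic polynomial. The entropy can thus be read off from any
  eigendecomposition.\<close>

lemma vN_entropy_spectral:
  assumes A: "A \<in> carrier_mat N N" and ul: "spectral N (mfun A) u l"
  shows "vN_entropy A = - (\<Sum>i<N. l i * log 2 (l i))"
proof -
  define U where "U = mat N N (\<lambda>(r,i). u i r)"
  define V where "V = mat N N (\<lambda>(i,s). cnj (u i s))"
  define D where "D = mat N N (\<lambda>(i,k). if i = k then complex_of_real (l i) else 0)"
  have c: "U \<in> carrier_mat N N" "V \<in> carrier_mat N N" "D \<in> carrier_mat N N"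
    by (simp_all add: U_def V_def D_def)
  have UV: "U * V = 1\<^sub>m N"
    using ul by (intro eq_matI) (auto simp: U_def V_def scalar_prod_def atLeast0LessThan spectral_def onb_def)
  have VU: "V * U = 1\<^sub>m N"
    using ul by (intro eq_matI) (auto simp: U_def V_def scalar_prod_def atLeast0LessThan spectral_def onb_def ip_def)
  have UD: "U * D = mat N N (\<lambda>(r,i). of_real (l i) * u i r)"
  proof (intro eq_matI)
    fix r i assume "r < dim_row (mat N N (\<lambda>(r,i). of_real (l i) * u i r))" "i < dim_col (mat N N (\<lambda>(r,i). of_real (l i) * u i r))"
    then have ri: "r < N" "i < N" by auto
    have "(U * D) $$ (r, i) = (\<Sum>k<N. u k r * of_real (l k) * (if k = i then 1 else 0))"
      using ri by (auto simp: U_def D_def scalar_prod_def atLeast0LessThan intro!: sum.cong)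
    also have "\<dots> = u i r * of_real (l i)" using ri(2) by (rule sum_delta_lessThan)
    finally show "(U * D) $$ (r, i) = mat N N (\<lambda>(r,i). of_real (l i) * u i r) $$ (r, i)" using ri by simp
  qed (simp_all add: U_def D_def)
  have "A = U * D * V"
    using A ul unfolding UD
    by (intro eq_matI) (auto simp: V_def scalar_prod_def atLeast0LessThan spectral_def mfun_def)
  then have "similar_mat_wit A D U V"
    using A c UV VU by (intro similar_mat_witI[of _ _ N]) auto
  then have "char_poly A = char_poly D" using char_poly_similar similar_mat_def by blast
  also have "\<dots> = (\<Prod>a \<leftarrow> diag_mat D. [:- a, 1:])"
    by (rule char_poly_upper_triangular[OF c(3)]) (auto simp: D_def upper_triangular_def)
  also have "diag_mat D = map (\<lambda>i. complex_of_real (l i)) [0..<N]"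
    by (auto simp: diag_mat_def D_def intro!: map_cong)
  also have "(\<Prod>a \<leftarrow> map (\<lambda>i. complex_of_real (l i)) [0..<N]. [:- a, 1:]) = (\<Prod>i<N. [:- complex_of_real (l i), 1:])"
    by (simp add: o_def prod.distinct_set_conv_list[symmetric] atLeast0LessThan)
  finally have cp: "char_poly A = (\<Prod>i<N. [:- complex_of_real (l i), 1:])" .
  show ?thesis unfolding vN_entropy_def cp
    using sum_roots_prod_linear[where N = N and c = "\<lambda>i. complex_of_real (l i)" and f = "\<lambda>z. Re z * log 2 (Re z)"] by simp
qed

lemma mtrace_spectral:
  assumes A: "A \<in> carrier_mat N N" and ul: "spectral N (mfun A) u l"
  shows "mtrace A = of_real (\<Sum>i<N. l i)"
proof -
  have "mtrace A = (\<Sum>r<N. \<Sum>i<N. of_real (l i) * (u i r * cnj (u i r)))"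
    using assms by (auto simp: mtrace_def spectral_def mfun_def mult.assoc intro!: sum.cong)
  also have "\<dots> = (\<Sum>i<N. of_real (l i) * (\<Sum>r<N. u i r * cnj (u i r)))"
    by (subst sum.swap) (simp add: sum_distrib_left)
  also have "\<dots> = (\<Sum>i<N. of_real (l i))"
    using ul by (intro sum.cong refl) (simp add: spectral_def onb_def ip_def mult.commute)
  finally show ?thesis by simp
qed

text \<open>The diagonal of \<open>A\<close> in the basis \<open>f\<close> is obtained from its spectrum by a
  doubly stochastic matrix, and \<open>x ln (x / y) \<ge> x - y\<close> is applied entrywise.\<close>
lemma gibbs_spectral:
  assumes ul: "spectral N A u p" and p: "\<And>a. a < N \<Longrightarrow> 0 \<le> p a" and f: "onb N f"
    and s: "\<And>i. i < N \<Longrightarrow> 0 < s i" "(\<Sum>i<N. s i) \<le> 1" and W: "W = (\<Sum>a<N. p a)"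
  shows "- (\<Sum>a<N. p a * log 2 (p a)) + W * log 2 W \<le> (\<Sum>i<N. Re (quad N A (f i)) * (- log 2 (s i)))"
proof -
  define c where "c a i = (cmod (ip N (u a) (f i)))\<^sup>2" for a i
  have u: "onb N u" using ul by (simp add: spectral_def)
  have c1: "(\<Sum>a<N. c a i) = 1" if "i < N" for i
    unfolding c_def onb_parseval_norm[OF u] by (rule onb_norm[OF f that])
  have c2: "(\<Sum>i<N. c a i) = 1" if "a < N" for a
  proof -
    have "c a i = (cmod (ip N (f i) (u a)))\<^sup>2" for i
      unfolding c_def by (metis complex_mod_cnj ip_cnj)
    then show ?thesis by (simp add: onb_parseval_norm[OF f] onb_norm[OF u that])
  qed
  have W0: "W \<ge> 0" unfolding W using p by (intro sum_nonneg) auto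
  have key: "p a * ln (p a) - p a * ln W - p a * ln (s i) \<ge> p a - W * s i" if "a < N" "i < N" for a i
  proof (cases "p a = 0")
    case True
    then show ?thesis using W0 s(1)[OF that(2)] by simp
  next
    case False
    then have pa: "p a > 0" using p[OF that(1)] by simp
    have "p a \<le> W" unfolding W using p that(1) by (intro member_le_sum) auto
    then have Wp: "W > 0" using pa by simp
    note si = s(1)[OF that(2)]
    have "ln (W * s i / p a) \<le> W * s i / p a - 1" using pa Wp si by (intro ln_le_minus_one) simp
    then have "p a * ln (W * s i / p a) \<le> p a * (W * s i / p a - 1)" using pa by (intro mult_left_mono) auto
    also have "\<dots> = W * s i - p a" using pa by (simp add: field_simps)
    finally show ?thesis using pa Wp si by (simp add: ln_div ln_mult algebra_simps)
  qed
  have "(\<Sum>a<N. \<Sum>i<N. c a i * (p a - W * s i)) \<le> (\<Sum>a<N. \<Sum>i<N. c a i * (p a * ln (p a) - p a * ln W - p a * ln (s i)))"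
    using key by (intro sum_mono mult_left_mono) (auto simp: c_def)
  \<comment> \<open>Both marginals of the doubly stochastic \<open>c\<close> enter here. The result
    is nonnegative because \<open>s\<close> sums to at most 1.\<close>
  moreover have "(\<Sum>a<N. \<Sum>i<N. c a i * (p a - W * s i)) = W - W * (\<Sum>i<N. s i)"
  proof -
    have "(\<Sum>a<N. \<Sum>i<N. c a i * (p a - W * s i)) = (\<Sum>a<N. (\<Sum>i<N. c a i) * p a) - (\<Sum>a<N. \<Sum>i<N. c a i * (W * s i))"
      by (simp add: right_diff_distrib sum_subtractf sum_distrib_right)
    also have "(\<Sum>a<N. \<Sum>i<N. c a i * (W * s i)) = (\<Sum>i<N. (\<Sum>a<N. c a i) * (W * s i))"
      by (subst sum.swap) (simp add: sum_distrib_right)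
    finally show ?thesis by (simp add: c1 c2 W sum_distrib_left)
  qed
  moreover have "W - W * (\<Sum>i<N. s i) \<ge> 0" using s(2) W0 by (simp add: mult_left_le)
  moreover have "(\<Sum>a<N. \<Sum>i<N. c a i * (p a * ln (p a) - p a * ln W - p a * ln (s i)))
      = (\<Sum>a<N. p a * ln (p a)) - W * ln W - (\<Sum>i<N. (\<Sum>a<N. p a * c a i) * ln (s i))"
  proof -
    have "(\<Sum>a<N. \<Sum>i<N. c a i * (p a * ln (p a) - p a * ln W - p a * ln (s i)))
      = (\<Sum>a<N. (\<Sum>i<N. c a i) * (p a * ln (p a) - p a * ln W)) - (\<Sum>a<N. \<Sum>i<N. c a i * p a * ln (s i))"
      by (simp add: right_diff_distrib sum_subtractf sum_distrib_right mult.assoc)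
    also have "(\<Sum>a<N. \<Sum>i<N. c a i * p a * ln (s i)) = (\<Sum>i<N. (\<Sum>a<N. p a * c a i) * ln (s i))"
      by (subst sum.swap) (simp add: sum_distrib_right sum_distrib_left mult_ac)
    finally show ?thesis by (simp add: c2 W sum_subtractf sum_distrib_right)
  qed
  moreover have "Re (quad N A (f i)) = (\<Sum>a<N. p a * c a i)" for i
    unfolding quad_spectral[OF ul] c_def by simp
  ultimately have "- (\<Sum>a<N. p a * ln (p a)) + W * ln W \<le> (\<Sum>i<N. Re (quad N A (f i)) * (- ln (s i)))"
    by (simp add: sum_negf)
  then have "(- (\<Sum>a<N. p a * ln (p a)) + W * ln W) / ln 2 \<le> (\<Sum>i<N. Re (quad N A (f i)) * (- ln (s i))) / ln 2"
    by (intro divide_right_mono) auto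
  then show ?thesis by (simp add: log_def sum_divide_distrib add_divide_distrib diff_divide_distrib)
qed

section \<open>High fidelity forces a small relative entropy\<close>

lemma mapply_spectral:
  assumes "spectral N A u l" "r < N"
  shows "mapply N A v r = (\<Sum>i<N. of_real (l i) * ip N (u i) v * u i r)"
proof -
  have "mapply N A v r = (\<Sum>s<N. \<Sum>i<N. of_real (l i) * u i r * (cnj (u i s) * v s))"
    using assms unfolding mapply_def spectral_def
    by (intro sum.cong refl) (simp add: sum_distrib_right mult.assoc)
  also have "\<dots> = (\<Sum>i<N. of_real (l i) * u i r * ip N (u i) v)"
    by (subst sum.swap) (simp add: sum_distrib_left ip_def)
  finally show ?thesis by (simp add: mult_ac)
qed

lemma ip_mapply_spectral:
  assumes "spectral N A u l"
  shows "ip N v (mapply N A w) = (\<Sum>i<N. of_real (l i) * cnj (ip N (u i) v) * ip N (u i) w)"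
proof -
  have "ip N v (mapply N A w) = (\<Sum>r<N. \<Sum>i<N. (of_real (l i) * ip N (u i) w) * (cnj (v r) * u i r))"
    unfolding ip_def[of N v] using assms
    by (intro sum.cong refl) (simp add: mapply_spectral sum_distrib_left mult_ac)
  also have "\<dots> = (\<Sum>i<N. (of_real (l i) * ip N (u i) w) * ip N v (u i))"
    by (subst sum.swap) (simp add: sum_distrib_left ip_def[of N v])
  finally show ?thesis by (simp add: ip_cnj mult_ac)
qed

text \<open>Cauchy-Schwarz for the semi-inner product of a positive matrix, evaluated in its
  eigenbasis.\<close>

lemma quad_cauchy_schwarz:
  assumes ul: "spectral N A u l" and l: "\<And>i. i < N \<Longrightarrow> 0 \<le> l i"
  shows "(cmod (ip N v (mapply N A w)))\<^sup>2 \<le> Re (quad N A v) * Re (quad N A w)"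
proof -
  define a where "a i = sqrt (l i) * cmod (ip N (u i) v)" for i
  define b where "b i = sqrt (l i) * cmod (ip N (u i) w)" for i
  have "cmod (ip N v (mapply N A w)) \<le> (\<Sum>i<N. cmod (of_real (l i) * cnj (ip N (u i) v) * ip N (u i) w))"
    unfolding ip_mapply_spectral[OF ul] by (rule norm_sum)
  also have "\<dots> = (\<Sum>i<N. a i * b i)"
    using l by (intro sum.cong) (auto simp: a_def b_def norm_mult)
  finally have "(cmod (ip N v (mapply N A w)))\<^sup>2 \<le> (\<Sum>i<N. a i * b i)\<^sup>2"
    by (intro power_mono) auto
  also have "\<dots> \<le> (\<Sum>i<N. (a i)\<^sup>2) * (\<Sum>i<N. (b i)\<^sup>2)" by (rule Cauchy_Schwarz_ineq_sum)
  also have "\<dots> = Re (quad N A v) * Re (quad N A w)"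
    unfolding quad_spectral[OF ul] using l
    by (auto simp: a_def b_def power_mult_distrib intro!: arg_cong2[of _ _ _ _ "(*)"] sum.cong)
  finally show ?thesis .
qed

lemma norm_mapply_spectral:
  assumes ul: "spectral N A u l"
  shows "(\<Sum>r<N. (cmod (mapply N A v r))\<^sup>2) = (\<Sum>i<N. (l i)\<^sup>2 * (cmod (ip N (u i) v))\<^sup>2)"
proof -
  have "(\<Sum>r<N. (cmod (mapply N A v r))\<^sup>2) = (\<Sum>r<N. (cmod (\<Sum>i<N. (of_real (l i) * ip N (u i) v) * u i r))\<^sup>2)"
    by (intro sum.cong refl) (simp add: mapply_spectral[OF ul])
  also have "\<dots> = (\<Sum>i<N. (cmod (of_real (l i) * ip N (u i) v))\<^sup>2)"
    using ul by (intro norm_lincomb) (simp add: spectral_def)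
  finally show ?thesis by (simp add: norm_mult power_mult_distrib)
qed

lemma ip_mapply_self: "ip N v (mapply N A v) = quad N A v"
  by (simp add: ip_def mapply_def quad_def sum_distrib_left mult.assoc)

text \<open>The main term is to keep a factor close to 1, whatever the price for the small one:
  later \<open>t\<close> tends to 0 and the small term is of order \<open>t\<close> squared, so
  \<open>1 + 1 / t\<close> is harmless.\<close>

lemma norm_add_square_le:
  fixes p q :: complex
  assumes "t > 0"
  shows "(cmod (p + q))\<^sup>2 \<le> (1 + t) * (cmod p)\<^sup>2 + (1 + 1 / t) * (cmod q)\<^sup>2"
proof -
  have "(cmod (p + q))\<^sup>2 \<le> (cmod p + cmod q)\<^sup>2"
    by (intro power_mono norm_triangle_ineq) auto
  moreover have "0 \<le> (t * cmod p - cmod q)\<^sup>2 / t" using assms by simp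
  moreover have "(t * cmod p - cmod q)\<^sup>2 / t = t * (cmod p)\<^sup>2 - 2 * (cmod p * cmod q) + (cmod q)\<^sup>2 / t"
    using assms by (simp add: power2_eq_square field_simps)
  ultimately show ?thesis by (simp add: power2_sum algebra_simps)
qed

text \<open>The vector \<open>X \<phi>\<close> is close to \<open>\<phi>\<close> when the fidelity is close to 1, and it satisfies the operator
  inequality \<open>|X \<phi>><X \<phi>| \<le> X \<le> T\<close> exactly; the latter controls its overlap with \<open>- log T\<close>.\<close>
lemma neg_log_overlap_bound:
  fixes b t :: real
  assumes T: "spectral N T u \<tau>" and \<tau>: "\<And>i. i < N \<Longrightarrow> 0 \<le> \<tau> i" "(\<Sum>i<N. \<tau> i) \<le> b" and b: "b \<ge> 1"
    and X: "spectral N X w x" and x: "\<And>i. i < N \<Longrightarrow> 0 \<le> x i" "(\<Sum>i<N. x i) = 1"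
    and XT: "\<And>v. Re (quad N X v) \<le> Re (quad N T v)"
    and \<phi>: "(\<Sum>i<N. (cmod (\<phi> i))\<^sup>2) = 1" and t: "t > 0"
  shows "(\<Sum>i<N. (cmod (ip N (u i) \<phi>))\<^sup>2 * - log 2 ((\<tau> i / b + 1 / real N) / 2))
    \<le> (1 + t) * (log 2 b + 3) + (1 + 1 / t) * ((1 - Re (quad N X \<phi>)) * (log 2 (real N) + 1))"
proof -
  have N: "0 < N" using \<phi> by (cases N) auto
  \<comment> \<open>The spectrum of \<open>T / b\<close> mixed equally with that of the maximally
    mixed state. The second half keeps \<open>- log s\<close> below \<open>log N + 1\<close>; the
    first gives \<open>\<tau> <= 2 * b * s\<close>.\<close>
  define s where "s i = (\<tau> i / b + 1 / real N) / 2" for i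
  define \<psi> where "\<psi> = mapply N X \<phi>"
  define f where "f = Re (quad N X \<phi>)"
  have onb: "onb N u" "onb N w" using T X by (auto simp: spectral_def)
  have s_ge: "s i \<ge> 1 / (2 * real N)" if "i < N" for i
    using \<tau>(1)[OF that] b by (simp add: s_def field_simps)
  have s_pos: "s i > 0" if "i < N" for i
    using s_ge[OF that] N by (smt (verit) divide_pos_pos of_nat_0_less_iff)
  have s_le: "s i \<le> 1" if "i < N" for i
  proof -
    have "\<tau> i \<le> (\<Sum>i<N. \<tau> i)" using that \<tau>(1) by (intro member_le_sum) auto
    then have "\<tau> i / b \<le> 1" using \<tau>(2) b by (simp add: field_simps)
    moreover have "1 / real N \<le> 1" using N by simp
    ultimately show ?thesis by (simp add: s_def)
  qed
  have \<tau>_le: "\<tau> i \<le> 2 * b * s i" for i using b N by (simp add: s_def field_simps)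
  have l_nonneg: "0 \<le> - ln (s i)" if "i < N" for i using s_le[OF that] s_pos[OF that] by simp
  have l_le: "- ln (s i) \<le> ln (2 * real N)" if "i < N" for i
  proof -
    have "ln (1 / (2 * real N)) \<le> ln (s i)" using s_ge[OF that] N by (intro ln_mono) auto
    then show ?thesis using N by (simp add: ln_div)
  qed
  have f1: "(\<Sum>i<N. (cmod (ip N (w i) \<phi>))\<^sup>2) = 1" using onb_parseval_norm[OF onb(2)] \<phi> by simp
  have x1: "x i \<le> 1" if "i < N" for i
    using x that member_le_sum[of i "{..<N}" x] by auto
  have f_eq: "f = (\<Sum>i<N. x i * (cmod (ip N (w i) \<phi>))\<^sup>2)" by (simp add: f_def quad_spectral[OF X])
  have f_le: "f \<le> 1"
    unfolding f_eq f1[symmetric] using x1 x(1) by (intro sum_mono) (auto simp: mult_left_le_one_le)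
  have f_nonneg: "0 \<le> f" unfolding f_eq using x(1) by (intro sum_nonneg) auto
  have \<psi>_norm: "(\<Sum>r<N. (cmod (\<psi> r))\<^sup>2) \<le> f"
    unfolding \<psi>_def norm_mapply_spectral[OF X] f_eq
  proof (intro sum_mono mult_right_mono)
    fix i assume "i \<in> {..<N}"
    then show "(x i)\<^sup>2 \<le> x i" using x1[of i] x(1)[of i] by (simp add: power2_eq_square mult_left_le_one_le)
  qed auto
  \<comment> \<open>Expanding the square gives \<open>1 - 2 * f\<close> plus the squared norm of
    \<open>\<psi>\<close>, which is at most \<open>f\<close> because the eigenvalues of
    \<open>X\<close> lie between 0 and 1.\<close>
  have diff: "(\<Sum>i<N. (cmod (\<phi> i - \<psi> i))\<^sup>2) \<le> 1 - f"
  proof -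
    have "(cmod (\<phi> i - \<psi> i))\<^sup>2 = (cmod (\<phi> i))\<^sup>2 - 2 * Re (cnj (\<phi> i) * \<psi> i) + (cmod (\<psi> i))\<^sup>2" for i
      unfolding cmod_power2 by (simp add: power2_eq_square algebra_simps)
    then have "(\<Sum>i<N. (cmod (\<phi> i - \<psi> i))\<^sup>2) = 1 - 2 * Re (ip N \<phi> \<psi>) + (\<Sum>i<N. (cmod (\<psi> i))\<^sup>2)"
      by (simp add: sum.distrib sum_subtractf \<phi> ip_def sum_distrib_left[symmetric])
    also have "ip N \<phi> \<psi> = quad N X \<phi>" by (simp add: \<psi>_def ip_mapply_self)
    finally show ?thesis using \<psi>_norm by (simp add: f_def)
  qed
  have main: "(\<Sum>i<N. (cmod (ip N (u i) \<psi>))\<^sup>2 * - ln (s i)) \<le> 1 + ln (2 * b)"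
  proof -
    \<comment> \<open>\<open>K\<close> is the expectation in \<open>\<psi>\<close> of the inverse of
      \<open>s\<close>, and \<open>v\<close> is that inverse applied to \<open>\<psi>\<close>.
      Cauchy-Schwarz for the form \<open>X\<close> bounds the square of \<open>K\<close> by the form
      \<open>X\<close> at \<open>v\<close>, hence by the form \<open>T\<close> at \<open>v\<close>,
      which is at most \<open>2 * b * K\<close>. So \<open>K <= 2 * b\<close>.\<close>
    define K where "K = (\<Sum>i<N. (cmod (ip N (u i) \<psi>))\<^sup>2 / s i)"
    define v where "v r = (\<Sum>i<N. (ip N (u i) \<psi> / of_real (s i)) * u i r)" for r
    have iv: "ip N (u k) v = ip N (u k) \<psi> / of_real (s k)" if "k < N" for k
    proof -
      have "ip N (u k) v = (\<Sum>i<N. (ip N (u i) \<psi> / of_real (s i)) * ip N (u k) (u i))"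
        unfolding v_def ip_def[of N "u k"] sum_distrib_left by (subst sum.swap) (simp add: mult_ac)
      also have "\<dots> = (\<Sum>i<N. (ip N (u i) \<psi> / of_real (s i)) * (if k = i then 1 else 0))"
        using onb(1) that by (intro sum.cong) (auto simp: ip_onb_self)
      also have "\<dots> = ip N (u k) \<psi> / of_real (s k)" using that by (rule sum_delta_lessThan)
      finally show ?thesis .
    qed
    have "ip N v \<psi> = (\<Sum>i<N. cnj (ip N (u i) v) * ip N (u i) \<psi>)"
      using onb_parseval[OF onb(1)] by simp
    also have "\<dots> = (\<Sum>i<N. of_real ((cmod (ip N (u i) \<psi>))\<^sup>2 / s i))"
      by (intro sum.cong refl)
        (simp only: iv lessThan_iff complex_cnj_divide complex_cnj_complex_of_real times_divide_eq_left
          mult.commute[of "cnj _"] complex_norm_square[symmetric] of_real_divide)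
    finally have ivp: "ip N v \<psi> = of_real K" by (simp add: K_def)
    have K0: "K \<ge> 0" unfolding K_def using s_pos by (intro sum_nonneg divide_nonneg_pos) auto
    have "K\<^sup>2 \<le> Re (quad N X v) * f"
      using quad_cauchy_schwarz[OF X x(1), of v \<phi>] ivp by (simp add: \<psi>_def f_def)
    also have "\<dots> \<le> Re (quad N T v) * 1"
    proof (intro mult_mono)
      show "0 \<le> Re (quad N T v)" unfolding quad_spectral[OF T] using \<tau>(1) by (auto intro!: sum_nonneg)
    qed (use XT f_le f_nonneg in auto)
    also have "Re (quad N T v) = (\<Sum>i<N. \<tau> i * (cmod (ip N (u i) v))\<^sup>2)" by (simp add: quad_spectral[OF T])
    also have "\<dots> \<le> (\<Sum>i<N. (2 * b * s i) * (cmod (ip N (u i) v))\<^sup>2)"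
      by (intro sum_mono mult_right_mono \<tau>_le) auto
    also have "\<dots> = 2 * b * K"
      unfolding K_def sum_distrib_left
    proof (intro sum.cong refl)
      fix i assume "i \<in> {..<N}"
      then have "i < N" by simp
      then show "2 * b * s i * (cmod (ip N (u i) v))\<^sup>2 = 2 * b * ((cmod (ip N (u i) \<psi>))\<^sup>2 / s i)"
        using s_pos[of i] by (simp add: iv norm_divide power_divide power2_eq_square)
    qed
    finally have "K * K \<le> 2 * b * K" by (simp add: power2_eq_square)
    then have K: "K \<le> 2 * b" using K0 b by (cases "K = 0") auto
    \<comment> \<open>The inequality \<open>ln z <= z - 1\<close> at
      \<open>z = 1 / (2 * b * s i)\<close> trades the logarithm for the inverse, whose expectation
      is \<open>K\<close>.\<close>
    have "(\<Sum>i<N. (cmod (ip N (u i) \<psi>))\<^sup>2 * - ln (s i))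
        \<le> (\<Sum>i<N. (cmod (ip N (u i) \<psi>))\<^sup>2 * (1 / (s i * (2 * b)) + ln (2 * b)))"
    proof (intro sum_mono mult_left_mono)
      fix i assume "i \<in> {..<N}"
      then have si: "s i > 0" using s_pos by simp
      then have "ln (1 / (s i * (2 * b))) \<le> 1 / (s i * (2 * b)) - 1" using b by (intro ln_le_minus_one) simp
      moreover have "ln (1 / (s i * (2 * b))) = - ln (s i) - ln (2 * b)" using si b by (simp add: ln_div ln_mult)
      ultimately show "- ln (s i) \<le> 1 / (s i * (2 * b)) + ln (2 * b)" by simp
    qed auto
    also have "\<dots> = K / (2 * b) + (\<Sum>i<N. (cmod (ip N (u i) \<psi>))\<^sup>2) * ln (2 * b)"
      by (simp add: K_def distrib_left sum.distrib sum_divide_distrib sum_distrib_right)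
    also have "\<dots> \<le> 1 + 1 * ln (2 * b)"
      using K b \<psi>_norm f_le unfolding onb_parseval_norm[OF onb(1)]
      by (intro add_mono mult_right_mono) auto
    finally show ?thesis by simp
  qed
  have "(\<Sum>i<N. (cmod (ip N (u i) \<phi>))\<^sup>2 * - ln (s i))
      \<le> (\<Sum>i<N. ((1 + t) * (cmod (ip N (u i) \<psi>))\<^sup>2 + (1 + 1 / t) * (cmod (ip N (u i) (\<lambda>r. \<phi> r - \<psi> r)))\<^sup>2) * - ln (s i))"
  proof (intro sum_mono mult_right_mono)
    fix i
    have "ip N (u i) \<phi> = ip N (u i) \<psi> + ip N (u i) (\<lambda>r. \<phi> r - \<psi> r)"
      by (simp add: ip_def sum.distrib[symmetric] algebra_simps)
    then show "(cmod (ip N (u i) \<phi>))\<^sup>2 \<le> (1 + t) * (cmod (ip N (u i) \<psi>))\<^sup>2 + (1 + 1 / t) * (cmod (ip N (u i) (\<lambda>r. \<phi> r - \<psi> r)))\<^sup>2"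
      using norm_add_square_le[OF t] by simp
  qed (use l_nonneg in auto)
  also have "\<dots> = (1 + t) * (\<Sum>i<N. (cmod (ip N (u i) \<psi>))\<^sup>2 * - ln (s i))
      + (1 + 1 / t) * (\<Sum>i<N. (cmod (ip N (u i) (\<lambda>r. \<phi> r - \<psi> r)))\<^sup>2 * - ln (s i))"
    unfolding sum_distrib_left sum.distrib[symmetric] by (intro sum.cong refl) (simp only: distrib_right mult.assoc)
  also have "\<dots> \<le> (1 + t) * (1 + ln (2 * b)) + (1 + 1 / t) * ((1 - f) * ln (2 * real N))"
  proof (intro add_mono mult_left_mono main)
    have "(\<Sum>i<N. (cmod (ip N (u i) (\<lambda>r. \<phi> r - \<psi> r)))\<^sup>2 * - ln (s i))
        \<le> (\<Sum>i<N. (cmod (ip N (u i) (\<lambda>r. \<phi> r - \<psi> r)))\<^sup>2 * ln (2 * real N))"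
      using l_le by (intro sum_mono mult_left_mono) auto
    also have "\<dots> = (\<Sum>i<N. (cmod (\<phi> i - \<psi> i))\<^sup>2) * ln (2 * real N)"
      unfolding sum_distrib_right[symmetric] onb_parseval_norm[OF onb(1)] ..
    also have "\<dots> \<le> (1 - f) * ln (2 * real N)"
      using diff N by (intro mult_right_mono) auto
    finally show "(\<Sum>i<N. (cmod (ip N (u i) (\<lambda>r. \<phi> r - \<psi> r)))\<^sup>2 * - ln (s i)) \<le> (1 - f) * ln (2 * real N)" .
  qed (use t in auto)
  finally have "(\<Sum>i<N. (cmod (ip N (u i) \<phi>))\<^sup>2 * - ln (s i)) / ln 2
      \<le> ((1 + t) * (1 + ln (2 * b)) + (1 + 1 / t) * ((1 - f) * ln (2 * real N))) / ln 2"
    by (intro divide_right_mono) auto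
  also have "\<dots> = (1 + t) * ((1 + ln (2 * b)) / ln 2) + (1 + 1 / t) * ((1 - f) * (ln (2 * real N) / ln 2))"
    by (simp only: add_divide_distrib[of "(1 + t) * (1 + ln (2 * b))"] times_divide_eq_right)
  also have "ln (2 * real N) / ln 2 = log 2 (real N) + 1" using N by (simp add: ln_mult log_def add_divide_distrib)
  also have "(1 + ln (2 * b)) / ln 2 = 1 / ln 2 + 1 + log 2 b" using b by (simp add: ln_mult log_def add_divide_distrib)
  \<comment> \<open>The constant 3 consists of \<open>1 / ln 2 <= 2\<close> and one bit from the
    factor 2 in \<open>2 * b\<close>.\<close>
  also have "(1 + t) * (1 / ln 2 + 1 + log 2 b) \<le> (1 + t) * (log 2 b + 3)"
  proof -
    have "1 / ln 2 \<le> (2::real)" using ln2_ge_two_thirds by (simp add: field_simps)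
    then show ?thesis using t by (intro mult_left_mono) auto
  qed
  finally show ?thesis by (simp add: s_def f_def log_def sum_divide_distrib)
qed

section \<open>Joint convexity of relative entropy\<close>

definition trace_prod :: "nat \<Rightarrow> (nat \<Rightarrow> nat \<Rightarrow> complex) \<Rightarrow> (nat \<Rightarrow> nat \<Rightarrow> complex) \<Rightarrow> complex" where
  "trace_prod N K M = (\<Sum>r<N. \<Sum>s<N. K r s * M s r)"

lemma trace_prod_decomp:
  assumes "\<And>r s. r < N \<Longrightarrow> s < N \<Longrightarrow> K r s = (\<Sum>m<n. of_real (c m) * \<xi> m r * cnj (\<xi> m s))"
  shows "trace_prod N K M = (\<Sum>m<n. of_real (c m) * quad N M (\<xi> m))"
proof -
  have "trace_prod N K M = (\<Sum>r<N. \<Sum>s<N. \<Sum>m<n. of_real (c m) * (cnj (\<xi> m s) * M s r * \<xi> m r))"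
    unfolding trace_prod_def using assms by (intro sum.cong refl) (simp add: sum_distrib_left sum_distrib_right mult_ac)
  also have "\<dots> = (\<Sum>r<N. \<Sum>m<n. \<Sum>s<N. of_real (c m) * (cnj (\<xi> m s) * M s r * \<xi> m r))"
    by (intro sum.cong refl sum.swap)
  also have "\<dots> = (\<Sum>m<n. \<Sum>s<N. \<Sum>r<N. of_real (c m) * (cnj (\<xi> m s) * M s r * \<xi> m r))"
    by (rule sum_rotate)
  finally show ?thesis by (simp add: quad_def sum_distrib_left)
qed

definition mult_adjoint :: "nat \<Rightarrow> (nat \<Rightarrow> nat \<Rightarrow> complex) \<Rightarrow> nat \<Rightarrow> nat \<Rightarrow> complex" where
  "mult_adjoint N X r s = (\<Sum>q<N. X r q * cnj (X s q))"

definition adjoint_mult :: "nat \<Rightarrow> (nat \<Rightarrow> nat \<Rightarrow> complex) \<Rightarrow> nat \<Rightarrow> nat \<Rightarrow> complex" where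
  "adjoint_mult N X r s = (\<Sum>q<N. cnj (X q r) * X q s)"

lemma quad_adjoint_mult: "quad N (adjoint_mult N X) v = of_real (\<Sum>q<N. (cmod (mapply N X v q))\<^sup>2)"
proof -
  have "quad N (adjoint_mult N X) v = (\<Sum>r<N. \<Sum>s<N. \<Sum>q<N. (cnj (X q r) * cnj (v r)) * (X q s * v s))"
    unfolding quad_def adjoint_mult_def by (simp add: sum_distrib_left sum_distrib_right mult_ac)
  also have "\<dots> = (\<Sum>q<N. \<Sum>r<N. \<Sum>s<N. (cnj (X q r) * cnj (v r)) * (X q s * v s))"
    by (rule sum_rotate[symmetric])
  also have "\<dots> = ip N (mapply N X v) (mapply N X v)"
    unfolding ip_def mapply_def by (simp add: sum_product)
  finally show ?thesis by (simp add: ip_self)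
qed

lemma quad_mult_adjoint: "quad N (mult_adjoint N X) v = of_real (\<Sum>q<N. (cmod (mapply N (\<lambda>q r. cnj (X r q)) v q))\<^sup>2)"
  using quad_adjoint_mult[of N "\<lambda>q r. cnj (X r q)" v] by (simp add: adjoint_mult_def[abs_def] mult_adjoint_def[abs_def])

text \<open>For fixed \<open>X\<close> this is linear in the pair \<open>(K, L)\<close>, and its supremum over \<open>X\<close> is the
  quasi-entropy with kernel \<open>p^2 / (s + t p)\<close>, whose integral over \<open>t\<close> is the relative entropy.
  Hence the joint convexity of the latter.\<close>
definition quasi :: "nat \<Rightarrow> real \<Rightarrow> (nat \<Rightarrow> nat \<Rightarrow> complex) \<Rightarrow> (nat \<Rightarrow> nat \<Rightarrow> complex) \<Rightarrow> (nat \<Rightarrow> nat \<Rightarrow> complex) \<Rightarrow> real" where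
  "quasi N t X K L = 2 * Re (trace_prod N K X) - Re (trace_prod N L (mult_adjoint N X)) - t * Re (trace_prod N K (adjoint_mult N X))"

lemma cauchy_schwarz_ip: "(cmod (ip N u v))\<^sup>2 \<le> (\<Sum>i<N. (cmod (u i))\<^sup>2) * (\<Sum>i<N. (cmod (v i))\<^sup>2)"
proof -
  have "cmod (ip N u v) \<le> (\<Sum>i<N. cmod (u i) * cmod (v i))"
    unfolding ip_def by (rule order_trans[OF norm_sum]) (simp add: norm_mult)
  then have "(cmod (ip N u v))\<^sup>2 \<le> (\<Sum>i<N. cmod (u i) * cmod (v i))\<^sup>2" by (intro power_mono) auto
  also have "\<dots> \<le> (\<Sum>i<N. (cmod (u i))\<^sup>2) * (\<Sum>i<N. (cmod (v i))\<^sup>2)" by (rule Cauchy_Schwarz_ineq_sum)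
  finally show ?thesis .
qed

lemma ip_mapply_adjoint: "ip N (mapply N (\<lambda>q r. cnj (X r q)) v) w = ip N v (mapply N X w)"
proof -
  have "ip N (mapply N (\<lambda>q r. cnj (X r q)) v) w = (\<Sum>q<N. \<Sum>r<N. cnj (v r) * (X r q * w q))"
    unfolding ip_def mapply_def by (simp add: sum_distrib_left sum_distrib_right mult_ac)
  then show ?thesis by (subst (asm) sum.swap) (simp add: ip_def mapply_def sum_distrib_left)
qed

text \<open>When both arguments are combinations of the same projections, Cauchy-Schwarz reduces
  each summand to a concave quadratic in \<open>q\<close>, the modulus of
  \<open>quad N X (\<xi> m)\<close>, whose maximum is the kernel value on the right.\<close>

lemma quasi_le:
  assumes K: "\<And>r s. r < N \<Longrightarrow> s < N \<Longrightarrow> K r s = (\<Sum>m<n. of_real (c m) * \<xi> m r * cnj (\<xi> m s))"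
    and L: "\<And>r s. r < N \<Longrightarrow> s < N \<Longrightarrow> L r s = (\<Sum>m<n. of_real w * \<xi> m r * cnj (\<xi> m s))"
    and \<xi>: "\<And>m. m < n \<Longrightarrow> (\<Sum>i<N. (cmod (\<xi> m i))\<^sup>2) = 1"
    and c: "\<And>m. m < n \<Longrightarrow> 0 \<le> c m" and w: "0 \<le> w" and t: "0 < t"
  shows "quasi N t X K L \<le> (\<Sum>m<n. (c m)\<^sup>2 / (w + t * c m))"
proof -
  define y1 where "y1 m = (\<Sum>q<N. (cmod (mapply N (\<lambda>q r. cnj (X r q)) (\<xi> m) q))\<^sup>2)" for m
  define y2 where "y2 m = (\<Sum>q<N. (cmod (mapply N X (\<xi> m) q))\<^sup>2)" for m
  have trK: "trace_prod N K M = (\<Sum>m<n. of_real (c m) * quad N M (\<xi> m))" for M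
    by (rule trace_prod_decomp) (rule K)
  have trL: "trace_prod N L M = (\<Sum>m<n. of_real w * quad N M (\<xi> m))" for M
    by (rule trace_prod_decomp) (rule L)
  have "quasi N t X K L = (\<Sum>m<n. 2 * (c m * Re (quad N X (\<xi> m))) - w * y1 m - t * (c m * y2 m))"
    unfolding quasi_def trK trL quad_mult_adjoint quad_adjoint_mult
    by (simp add: y1_def[symmetric] y2_def[symmetric] sum_subtractf sum_distrib_left)
  also have "\<dots> \<le> (\<Sum>m<n. (c m)\<^sup>2 / (w + t * c m))"
  proof (intro sum_mono)
    fix m assume "m \<in> {..<n}"
    then have m: "m < n" by simp
    define q where "q = cmod (quad N X (\<xi> m))"
    have "q\<^sup>2 \<le> y1 m"
      using cauchy_schwarz_ip[of N "mapply N (\<lambda>q r. cnj (X r q)) (\<xi> m)" "\<xi> m"] \<xi>[OF m]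
      by (simp add: ip_mapply_adjoint ip_mapply_self q_def y1_def)
    moreover have "q\<^sup>2 \<le> y2 m"
      using cauchy_schwarz_ip[of N "\<xi> m" "mapply N X (\<xi> m)"] \<xi>[OF m]
      by (simp add: ip_mapply_self q_def y2_def)
    ultimately have a: "w * q\<^sup>2 \<le> w * y1 m" "t * (c m * q\<^sup>2) \<le> t * (c m * y2 m)"
      using w t c[OF m] by (auto intro!: mult_left_mono)
    have b: "c m * Re (quad N X (\<xi> m)) \<le> c m * q"
      using c[OF m] by (intro mult_left_mono) (auto simp: q_def complex_Re_le_cmod)
    \<comment> \<open>Completing the square; if the denominator vanishes then so does
      \<open>c m\<close>.\<close>
    have "2 * (c m * q) - w * q\<^sup>2 - t * (c m * q\<^sup>2) \<le> (c m)\<^sup>2 / (w + t * c m)"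
    proof (cases "w + t * c m = 0")
      case True
      then have "c m = 0" using w t c[OF m] by (smt (verit) mult_nonneg_nonneg mult_pos_pos)
      then show ?thesis using w by simp
    next
      case False
      then have pos: "w + t * c m > 0" using w t c[OF m] by (smt (verit) mult_nonneg_nonneg)
      have "0 \<le> ((w + t * c m) * q - c m)\<^sup>2 / (w + t * c m)" using pos by simp
      also have "\<dots> = (w + t * c m) * q\<^sup>2 - 2 * (c m * q) + (c m)\<^sup>2 / (w + t * c m)"
        using pos by (simp add: power2_eq_square field_simps)
      finally show ?thesis by (simp add: algebra_simps)
    qed
    then show "2 * (c m * Re (quad N X (\<xi> m))) - w * y1 m - t * (c m * y2 m) \<le> (c m)\<^sup>2 / (w + t * c m)"
      using a b by linarith
  qed
  finally show ?thesis .
qed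

text \<open>The maximiser solves the stationarity equation
  \<open>\<sigma> X + t X \<rho> = \<rho>\<close>, which is diagonal when rows are expanded in the
  eigenbasis of \<open>\<sigma>\<close> and columns in that of \<open>\<rho>\<close>.\<close>

lemma quasi_attained:
  assumes \<rho>: "spectral N \<rho> e p" and \<sigma>: "spectral N \<sigma> g s"
    and p: "\<And>a. a < N \<Longrightarrow> 0 \<le> p a" and s: "\<And>b. b < N \<Longrightarrow> 0 \<le> s b" and t: "0 < t"
  obtains X where "quasi N t X \<rho> \<sigma> = (\<Sum>a<N. \<Sum>b<N. (cmod (ip N (g b) (e a)))\<^sup>2 * ((p a)\<^sup>2 / (s b + t * p a)))"
proof -
  define c where "c b a = ip N (g b) (e a)" for b a
  \<comment> \<open>When \<open>s b\<close> and \<open>p a\<close> both vanish this is a division by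
    zero with value 0, which is the right coefficient for such pairs.\<close>
  define z where "z b a = p a / (s b + t * p a)" for b a
  define X where "X r q = (\<Sum>b<N. \<Sum>a<N. of_real (z b a) * c b a * g b r * cnj (e a q))" for r q
  have onb: "onb N e" "onb N g" using \<rho> \<sigma> by (auto simp: spectral_def)
  have Xe: "mapply N X (e a) r = (\<Sum>b<N. (of_real (z b a) * c b a) * g b r)" if a: "a < N" for a r
  proof -
    have "mapply N X (e a) r = (\<Sum>q<N. \<Sum>b<N. \<Sum>a'<N. of_real (z b a') * c b a' * g b r * (cnj (e a' q) * e a q))"
      unfolding mapply_def X_def by (simp add: sum_distrib_left sum_distrib_right mult_ac)
    also have "\<dots> = (\<Sum>b<N. \<Sum>a'<N. of_real (z b a') * c b a' * g b r * ip N (e a') (e a))"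
      by (subst sum_rotate) (simp add: ip_def sum_distrib_left)
    also have "\<dots> = (\<Sum>b<N. \<Sum>a'<N. of_real (z b a') * c b a' * g b r * (if a' = a then 1 else 0))"
      using onb a by (intro sum.cong refl) (simp add: ip_onb_self)
    also have "\<dots> = (\<Sum>b<N. of_real (z b a) * c b a * g b r)"
      by (intro sum.cong refl sum_delta_lessThan a)
    finally show ?thesis by simp
  qed
  have Xg: "mapply N (\<lambda>q r. cnj (X r q)) (g b) q = (\<Sum>a<N. (of_real (z b a) * cnj (c b a)) * e a q)" if b: "b < N" for b q
  proof -
    have "mapply N (\<lambda>q r. cnj (X r q)) (g b) q
        = (\<Sum>r<N. \<Sum>b'<N. \<Sum>a<N. of_real (z b' a) * cnj (c b' a) * e a q * (cnj (g b' r) * g b r))"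
      unfolding mapply_def X_def by (simp add: sum_distrib_left sum_distrib_right mult_ac)
    also have "\<dots> = (\<Sum>b'<N. \<Sum>a<N. of_real (z b' a) * cnj (c b' a) * e a q * ip N (g b') (g b))"
      by (subst sum_rotate) (simp add: ip_def sum_distrib_left)
    also have "\<dots> = (\<Sum>a<N. \<Sum>b'<N. of_real (z b' a) * cnj (c b' a) * e a q * (if b' = b then 1 else 0))"
      using onb b by (subst sum.swap) (intro sum.cong refl, simp add: ip_onb_self)
    also have "\<dots> = (\<Sum>a<N. of_real (z b a) * cnj (c b a) * e a q)"
      by (intro sum.cong refl sum_delta_lessThan b)
    finally show ?thesis by simp
  qed
  have q1: "quad N X (e a) = of_real (\<Sum>b<N. z b a * (cmod (c b a))\<^sup>2)" if a: "a < N" for a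
  proof -
    have "quad N X (e a) = (\<Sum>r<N. \<Sum>b<N. of_real (z b a) * c b a * (cnj (e a r) * g b r))"
      unfolding ip_mapply_self[symmetric] ip_def Xe[OF a] by (simp add: sum_distrib_left mult_ac)
    also have "\<dots> = (\<Sum>b<N. of_real (z b a) * (c b a * cnj (c b a)))"
      by (subst sum.swap) (simp add: c_def ip_cnj ip_def[of N "e a"] sum_distrib_left mult.assoc)
    finally show ?thesis by (simp only: complex_norm_square[symmetric] of_real_mult of_real_sum)
  qed
  have q2: "quad N (adjoint_mult N X) (e a) = of_real (\<Sum>b<N. (z b a)\<^sup>2 * (cmod (c b a))\<^sup>2)" if a: "a < N" for a
    unfolding quad_adjoint_mult Xe[OF a] norm_lincomb[OF onb(2)] by (simp add: norm_mult power_mult_distrib)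
  have q3: "quad N (mult_adjoint N X) (g b) = of_real (\<Sum>a<N. (z b a)\<^sup>2 * (cmod (c b a))\<^sup>2)" if b: "b < N" for b
    unfolding quad_mult_adjoint Xg[OF b] norm_lincomb[OF onb(1)] by (simp add: norm_mult power_mult_distrib)
  have K: "\<And>r s. r < N \<Longrightarrow> s < N \<Longrightarrow> \<rho> r s = (\<Sum>m<N. of_real (p m) * e m r * cnj (e m s))"
    using \<rho> by (auto simp: spectral_def)
  have L: "\<And>r q. r < N \<Longrightarrow> q < N \<Longrightarrow> \<sigma> r q = (\<Sum>m<N. of_real (s m) * g m r * cnj (g m q))"
    using \<sigma> by (auto simp: spectral_def)
  have trK: "trace_prod N \<rho> M = (\<Sum>m<N. of_real (p m) * quad N M (e m))" for M
    by (rule trace_prod_decomp) (rule K)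
  have trL: "trace_prod N \<sigma> M = (\<Sum>m<N. of_real (s m) * quad N M (g m))" for M
    by (rule trace_prod_decomp) (rule L)
  have "quasi N t X \<rho> \<sigma> = 2 * (\<Sum>a<N. p a * (\<Sum>b<N. z b a * (cmod (c b a))\<^sup>2))
      - (\<Sum>b<N. s b * (\<Sum>a<N. (z b a)\<^sup>2 * (cmod (c b a))\<^sup>2)) - t * (\<Sum>a<N. p a * (\<Sum>b<N. (z b a)\<^sup>2 * (cmod (c b a))\<^sup>2))"
    unfolding quasi_def trK trL by (simp add: q1 q2 q3 del: of_real_sum)
  also have "(\<Sum>b<N. s b * (\<Sum>a<N. (z b a)\<^sup>2 * (cmod (c b a))\<^sup>2)) = (\<Sum>a<N. \<Sum>b<N. s b * ((z b a)\<^sup>2 * (cmod (c b a))\<^sup>2))"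
    unfolding sum_distrib_left by (rule sum.swap)
  also have "2 * (\<Sum>a<N. p a * (\<Sum>b<N. z b a * (cmod (c b a))\<^sup>2))
      - (\<Sum>a<N. \<Sum>b<N. s b * ((z b a)\<^sup>2 * (cmod (c b a))\<^sup>2)) - t * (\<Sum>a<N. p a * (\<Sum>b<N. (z b a)\<^sup>2 * (cmod (c b a))\<^sup>2))
      = (\<Sum>a<N. \<Sum>b<N. 2 * (p a * (z b a * (cmod (c b a))\<^sup>2)) - s b * ((z b a)\<^sup>2 * (cmod (c b a))\<^sup>2) - t * (p a * ((z b a)\<^sup>2 * (cmod (c b a))\<^sup>2)))"
    by (simp add: sum_distrib_left sum_subtractf)
  also have "\<dots> = (\<Sum>a<N. \<Sum>b<N. (cmod (c b a))\<^sup>2 * ((p a)\<^sup>2 / (s b + t * p a)))"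
  proof (intro sum.cong refl)
    fix a b assume "a \<in> {..<N}" "b \<in> {..<N}"
    then have ab: "0 \<le> p a" "0 \<le> s b" using p s by auto
    have "2 * (p a * z b a) - s b * (z b a)\<^sup>2 - t * (p a * (z b a)\<^sup>2) = (p a)\<^sup>2 / (s b + t * p a)"
    proof (cases "s b + t * p a = 0")
      case True
      then have "p a = 0" using ab t by (smt (verit) mult_nonneg_nonneg mult_pos_pos)
      then show ?thesis by (simp add: z_def)
    next
      case False
      then have "z b a * (s b + t * p a) = p a" by (simp add: z_def)
      moreover have "s b * (z b a)\<^sup>2 + t * (p a * (z b a)\<^sup>2) = (z b a * (s b + t * p a)) * z b a"
        by (simp add: power2_eq_square algebra_simps)
      ultimately have "s b * (z b a)\<^sup>2 + t * (p a * (z b a)\<^sup>2) = p a * z b a" by (simp only:)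
      moreover have "(p a)\<^sup>2 / (s b + t * p a) = p a * z b a" by (simp add: z_def power2_eq_square)
      ultimately show ?thesis by simp
    qed
    moreover have "2 * (p a * (z b a * (cmod (c b a))\<^sup>2)) - s b * ((z b a)\<^sup>2 * (cmod (c b a))\<^sup>2) - t * (p a * ((z b a)\<^sup>2 * (cmod (c b a))\<^sup>2))
        = (cmod (c b a))\<^sup>2 * (2 * (p a * z b a) - s b * (z b a)\<^sup>2 - t * (p a * (z b a)\<^sup>2))"
      by (simp add: algebra_simps)
    ultimately show "2 * (p a * (z b a * (cmod (c b a))\<^sup>2)) - s b * ((z b a)\<^sup>2 * (cmod (c b a))\<^sup>2) - t * (p a * ((z b a)\<^sup>2 * (cmod (c b a))\<^sup>2))
        = (cmod (c b a))\<^sup>2 * ((p a)\<^sup>2 / (s b + t * p a))"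
      by (simp only:)
  qed
  finally show ?thesis using that[of X] by (simp only: c_def)
qed

text \<open>Riemann sums with right endpoints stand for the integral over \<open>t\<close>, so that the averages over
  the source are only ever exchanged with finite sums.\<close>
lemma riemann_upper:
  fixes c w :: real
  assumes c: "0 \<le> c" and w: "c \<le> w" and M: "0 < M"
  shows "(\<Sum>i=1..M*M. (1 / real M) * (c\<^sup>2 / (w + real i / real M * c))) \<le> c * ln (real M) + c * ln c + w / real M - c * ln w"
proof (cases "c = 0")
  case True
  then show ?thesis using w by simp
next
  case False
  then have c0: "c > 0" and w0: "w > 0" using c w by auto
  \<comment> \<open>The grid has step \<open>1 / M\<close> and ends at \<open>M\<close>, so a single
    limit refines the mesh and removes the cutoff. The integrand is decreasing, so right endpoints
    stay below the integral, whose primitive is \<open>c * ln (w + t * c)\<close>.\<close>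
  have "(\<Sum>i=1..k. (1 / real M) * (c\<^sup>2 / (w + real i / real M * c))) \<le> c * (ln (w + real k / real M * c) - ln w)" for k
  proof (induction k)
    case (Suc k)
    define x y where "x = w + real k / real M * c" and "y = w + real (Suc k) / real M * c"
    have xy: "x > 0" "y > 0" using c0 w0 M by (auto simp: x_def y_def intro!: add_pos_nonneg)
    have "y - x = c / real M" using M by (simp add: x_def y_def field_simps)
    have "ln (x / y) \<le> x / y - 1" using xy by (intro ln_le_minus_one) simp
    then have "1 - x / y \<le> ln y - ln x" using xy by (simp add: ln_div)
    moreover have "1 - x / y = (c / real M) / y" using xy \<open>y - x = c / real M\<close> by (simp add: field_simps)
    ultimately have "c * ((c / real M) / y) \<le> c * (ln y - ln x)" using c0 by (intro mult_left_mono) auto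
    then have "(1 / real M) * (c\<^sup>2 / y) \<le> c * (ln y - ln x)" by (simp add: power2_eq_square)
    moreover have "(\<Sum>i=1..Suc k. (1 / real M) * (c\<^sup>2 / (w + real i / real M * c)))
       = (\<Sum>i=1..k. (1 / real M) * (c\<^sup>2 / (w + real i / real M * c))) + (1 / real M) * (c\<^sup>2 / y)"
      by (simp add: y_def)
    ultimately show ?case using Suc unfolding x_def[symmetric] y_def[symmetric] right_diff_distrib by linarith
  qed simp
  from this[of "M * M"] have "(\<Sum>i=1..M*M. (1 / real M) * (c\<^sup>2 / (w + real i / real M * c))) \<le> c * (ln (w + real M * c) - ln w)"
    using M by simp
  also have "ln (w + real M * c) \<le> ln (real M) + ln c + w / (real M * c)"
  proof -
    have "w + real M * c = (real M * c) * (1 + w / (real M * c))" using c0 M by (simp add: field_simps)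
    moreover have "1 + w / (real M * c) > 0" using c0 w0 M by (simp add: add_pos_pos)
    ultimately have "ln (w + real M * c) = ln (real M) + ln c + ln (1 + w / (real M * c))"
      using c0 M by (simp add: ln_mult)
    also have "ln (1 + w / (real M * c)) \<le> w / (real M * c)"
      using c0 w0 M by (intro ln_add_one_self_le_self) simp
    finally show ?thesis by simp
  qed
  then have "c * (ln (w + real M * c) - ln w) \<le> c * (ln (real M) + ln c + w / (real M * c) - ln w)"
    using c0 by (intro mult_left_mono) auto
  also have "\<dots> = c * ln (real M) + c * ln c + w / real M - c * ln w"
    using c0 by (simp add: algebra_simps)
  finally show ?thesis .
qed

text \<open>Read from the other side, the same nodes are left endpoints of intervals starting at
  \<open>1 / M\<close>, so the sum exceeds the integral from there on. That start explains the term
  \<open>p / M\<close> inside the logarithm and keeps its argument positive when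
  \<open>s = 0\<close> and \<open>p > 0\<close>.\<close>

lemma riemann_lower:
  fixes p s :: real
  assumes p: "0 \<le> p" and s: "0 \<le> s" and M: "0 < M"
  shows "p * ln (real M) + p * ln p - p * ln (s + p / real M) \<le> (\<Sum>i=1..M*M. (1 / real M) * (p\<^sup>2 / (s + real i / real M * p)))"
proof (cases "p = 0")
  case False
  then have p0: "p > 0" using p by simp
  have "p * (ln (s + real (Suc k) / real M * p) - ln (s + 1 / real M * p)) \<le> (\<Sum>i=1..k. (1 / real M) * (p\<^sup>2 / (s + real i / real M * p)))" for k
  proof (induction k)
    case (Suc k)
    define x y where "x = s + real (Suc k) / real M * p" and "y = s + real (Suc (Suc k)) / real M * p"
    have xy: "x > 0" "y > 0" using p0 s M by (auto simp: x_def y_def intro!: add_nonneg_pos)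
    have "y - x = p / real M" using M by (simp add: x_def y_def field_simps)
    have "ln (y / x) \<le> y / x - 1" using xy by (intro ln_le_minus_one) simp
    then have "ln y - ln x \<le> y / x - 1" using xy by (simp add: ln_div)
    moreover have "y / x - 1 = (p / real M) / x" using xy \<open>y - x = p / real M\<close> by (simp add: field_simps)
    ultimately have "p * (ln y - ln x) \<le> p * ((p / real M) / x)" using p0 by (intro mult_left_mono) auto
    then have "p * (ln y - ln x) \<le> (1 / real M) * (p\<^sup>2 / x)" by (simp add: power2_eq_square)
    moreover have "(\<Sum>i=1..Suc k. (1 / real M) * (p\<^sup>2 / (s + real i / real M * p)))
       = (\<Sum>i=1..k. (1 / real M) * (p\<^sup>2 / (s + real i / real M * p))) + (1 / real M) * (p\<^sup>2 / x)"
      by (simp add: x_def)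
    ultimately show ?case using Suc unfolding x_def[symmetric] y_def[symmetric] right_diff_distrib by linarith
  qed simp
  from this[of "M * M"] have "p * (ln (s + real (Suc (M * M)) / real M * p) - ln (s + 1 / real M * p))
      \<le> (\<Sum>i=1..M*M. (1 / real M) * (p\<^sup>2 / (s + real i / real M * p)))" .
  moreover have "ln (real M) + ln p \<le> ln (s + real (Suc (M * M)) / real M * p)"
  proof -
    have "real M * p \<le> s + real (Suc (M * M)) / real M * p"
      using p0 s M by (simp add: field_simps)
    then have "ln (real M * p) \<le> ln (s + real (Suc (M * M)) / real M * p)" using p0 M by (intro ln_mono) auto
    then show ?thesis using p0 M by (simp add: ln_mult)
  qed
  then have "p * (ln (real M) + ln p - ln (s + 1 / real M * p)) \<le> p * (ln (s + real (Suc (M * M)) / real M * p) - ln (s + 1 / real M * p))"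
    using p0 by (intro mult_left_mono) auto
  ultimately show ?thesis by (simp add: algebra_simps)
qed simp

text \<open>The right side averages the relative entropies of \<open>K \<omega>\<close> and
  \<open>L \<omega>\<close>, the left side is that of the two averages. Condition
  \<open>supp\<close> says that the support of the first average lies in that of the second: a term
  with \<open>s b = 0\<close> and positive weight would have to be infinite, which the total
  function \<open>ln\<close> does not express.\<close>

lemma joint_convexity:
  fixes K L :: "'a \<Rightarrow> nat \<Rightarrow> nat \<Rightarrow> complex" and P :: "'a measure" and n :: nat
  assumes intK: "\<And>r s. r < N \<Longrightarrow> s < N \<Longrightarrow> integrable P (\<lambda>\<omega>. K \<omega> r s)"
    and intL: "\<And>r s. r < N \<Longrightarrow> s < N \<Longrightarrow> integrable P (\<lambda>\<omega>. L \<omega> r s)"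
    and \<rho>: "spectral N (\<lambda>r s. \<integral>\<omega>. K \<omega> r s \<partial>P) e p" and \<sigma>: "spectral N (\<lambda>r s. \<integral>\<omega>. L \<omega> r s \<partial>P) g s"
    and p: "\<And>a. a < N \<Longrightarrow> 0 \<le> p a" and s: "\<And>b. b < N \<Longrightarrow> 0 \<le> s b"
    and supp: "\<And>a b. a < N \<Longrightarrow> b < N \<Longrightarrow> s b = 0 \<Longrightarrow> p a * (cmod (ip N (g b) (e a)))\<^sup>2 = 0"
    and K: "\<And>\<omega> r s. \<omega> \<in> space P \<Longrightarrow> r < N \<Longrightarrow> s < N \<Longrightarrow> K \<omega> r s = (\<Sum>m<n. of_real (c \<omega> m) * \<xi> \<omega> m r * cnj (\<xi> \<omega> m s))"
    and L: "\<And>\<omega> r s. \<omega> \<in> space P \<Longrightarrow> r < N \<Longrightarrow> s < N \<Longrightarrow> L \<omega> r s = (\<Sum>m<n. of_real (w \<omega>) * \<xi> \<omega> m r * cnj (\<xi> \<omega> m s))"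
    and \<xi>: "\<And>\<omega> m. \<omega> \<in> space P \<Longrightarrow> m < n \<Longrightarrow> (\<Sum>i<N. (cmod (\<xi> \<omega> m i))\<^sup>2) = 1"
    and c: "\<And>\<omega> m. \<omega> \<in> space P \<Longrightarrow> m < n \<Longrightarrow> 0 \<le> c \<omega> m"
    and w: "\<And>\<omega>. \<omega> \<in> space P \<Longrightarrow> w \<omega> = (\<Sum>m<n. c \<omega> m)" and intw: "integrable P w" and Ww: "(\<integral>\<omega>. w \<omega> \<partial>P) = (\<Sum>a<N. p a)"
    and inth: "integrable P (\<lambda>\<omega>. (\<Sum>m<n. c \<omega> m * ln (c \<omega> m)) - w \<omega> * ln (w \<omega>))"
  shows "(\<Sum>a<N. p a * ln (p a)) - (\<Sum>a<N. \<Sum>b<N. p a * (cmod (ip N (g b) (e a)))\<^sup>2 * ln (s b))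
    \<le> (\<integral>\<omega>. (\<Sum>m<n. c \<omega> m * ln (c \<omega> m)) - w \<omega> * ln (w \<omega>) \<partial>P)"
proof -
  define d where "d b a = (cmod (ip N (g b) (e a)))\<^sup>2" for b a
  define h where "h \<omega> = (\<Sum>m<n. c \<omega> m * ln (c \<omega> m)) - w \<omega> * ln (w \<omega>)" for \<omega>
  define W where "W = (\<Sum>a<N. p a)"
  define G where "G t = (\<Sum>a<N. \<Sum>b<N. d b a * ((p a)\<^sup>2 / (s b + t * p a)))" for t
  have onb: "onb N e" "onb N g" using \<rho> \<sigma> by (auto simp: spectral_def)
  have d1: "(\<Sum>b<N. d b a) = 1" if "a < N" for a
    unfolding d_def onb_parseval_norm[OF onb(2)] by (rule onb_norm[OF onb(1) that])
  have tr_int: "integrable P (\<lambda>\<omega>. trace_prod N (F \<omega>) Y)" "trace_prod N (\<lambda>r s. \<integral>\<omega>. F \<omega> r s \<partial>P) Y = (\<integral>\<omega>. trace_prod N (F \<omega>) Y \<partial>P)"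
    if F: "\<And>r s. r < N \<Longrightarrow> s < N \<Longrightarrow> integrable P (\<lambda>\<omega>. F \<omega> r s)" for F :: "'a \<Rightarrow> nat \<Rightarrow> nat \<Rightarrow> complex" and Y
  proof -
    have i: "integrable P (\<lambda>\<omega>. F \<omega> r s * Y s r)" if "r < N" "s < N" for r s
      using F[OF that] by simp
    then have i': "integrable P (\<lambda>\<omega>. \<Sum>s<N. F \<omega> r s * Y s r)" if "r < N" for r
      using that by (intro Bochner_Integration.integrable_sum) auto
    show "integrable P (\<lambda>\<omega>. trace_prod N (F \<omega>) Y)"
      unfolding trace_prod_def by (intro Bochner_Integration.integrable_sum i) auto
    have "(\<integral>\<omega>. trace_prod N (F \<omega>) Y \<partial>P) = (\<Sum>r<N. \<integral>\<omega>. (\<Sum>s<N. F \<omega> r s * Y s r) \<partial>P)"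
      unfolding trace_prod_def using i' by (intro Bochner_Integration.integral_sum) auto
    also have "\<dots> = (\<Sum>r<N. \<Sum>s<N. (\<integral>\<omega>. F \<omega> r s * Y s r \<partial>P))"
      using i by (intro sum.cong refl Bochner_Integration.integral_sum) auto
    finally show "trace_prod N (\<lambda>r s. \<integral>\<omega>. F \<omega> r s \<partial>P) Y = (\<integral>\<omega>. trace_prod N (F \<omega>) Y \<partial>P)"
      by (simp add: trace_prod_def)
  qed
  \<comment> \<open>Take the \<open>X\<close> that attains the supremum for the averaged pair. By
    linearity the mean of \<open>B\<close> is exactly \<open>G t\<close>, while pointwise
    \<open>B\<close> stays below the bound of \<open>quasi_le\<close>.\<close>
  have exB: "\<exists>B. integrable P B \<and> (\<integral>\<omega>. B \<omega> \<partial>P) = G t \<and>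
      (\<forall>\<omega>\<in>space P. B \<omega> \<le> (\<Sum>m<n. (c \<omega> m)\<^sup>2 / (w \<omega> + t * c \<omega> m)))" if t: "t > 0" for t
  proof -
    obtain X where X: "quasi N t X (\<lambda>r s. \<integral>\<omega>. K \<omega> r s \<partial>P) (\<lambda>r s. \<integral>\<omega>. L \<omega> r s \<partial>P) = G t"
      using quasi_attained[OF \<rho> \<sigma> p s t] unfolding G_def d_def by blast
    define B where "B \<omega> = quasi N t X (K \<omega>) (L \<omega>)" for \<omega>
    have "integrable P B" unfolding B_def quasi_def
      by (intro Bochner_Integration.integrable_diff integrable_mult_right integrable_Re tr_int(1) intK intL)
    moreover have K': "trace_prod N (\<lambda>r s. \<integral>\<omega>. K \<omega> r s \<partial>P) Y = (\<integral>\<omega>. trace_prod N (K \<omega>) Y \<partial>P)"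
      and L': "trace_prod N (\<lambda>r s. \<integral>\<omega>. L \<omega> r s \<partial>P) Y = (\<integral>\<omega>. trace_prod N (L \<omega>) Y \<partial>P)" for Y
      by (rule tr_int(2), rule intK, assumption+) (rule tr_int(2), rule intL, assumption+)
    moreover have "(\<integral>\<omega>. B \<omega> \<partial>P) = G t"
      unfolding X[symmetric] B_def quasi_def K' L'
      using tr_int(1)[of K, OF intK] tr_int(1)[of L, OF intL]
      by (simp add: integral_Re)
    moreover have "B \<omega> \<le> (\<Sum>m<n. (c \<omega> m)\<^sup>2 / (w \<omega> + t * c \<omega> m))" if \<omega>: "\<omega> \<in> space P" for \<omega>
      unfolding B_def
      by (rule quasi_le[OF K[OF \<omega>] L[OF \<omega>] \<xi>[OF \<omega>] c[OF \<omega>] _ t]) (auto simp: w[OF \<omega>] intro!: sum_nonneg c[OF \<omega>])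
    ultimately show ?thesis by blast
  qed
  have bound: "(\<Sum>a<N. p a * ln (p a)) - (\<Sum>a<N. \<Sum>b<N. p a * d b a * ln (s b + p a / real M))
      \<le> (\<integral>\<omega>. h \<omega> \<partial>P) + real n * W / real M" if M: "0 < M" for M
  proof -
    have "\<forall>i\<in>{1..M*M}. \<exists>B. integrable P B \<and> (\<integral>\<omega>. B \<omega> \<partial>P) = G (real i / real M) \<and>
      (\<forall>\<omega>\<in>space P. B \<omega> \<le> (\<Sum>m<n. (c \<omega> m)\<^sup>2 / (w \<omega> + real i / real M * c \<omega> m)))"
      using M by (intro ballI exB) auto
    from bchoice[OF this] obtain B where "\<forall>i\<in>{1..M*M}. integrable P (B i) \<and> (\<integral>\<omega>. B i \<omega> \<partial>P) = G (real i / real M) \<and>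
      (\<forall>\<omega>\<in>space P. B i \<omega> \<le> (\<Sum>m<n. (c \<omega> m)\<^sup>2 / (w \<omega> + real i / real M * c \<omega> m)))" ..
    then have B: "\<And>i. i \<in> {1..M*M} \<Longrightarrow> integrable P (B i)"
      "\<And>i. i \<in> {1..M*M} \<Longrightarrow> (\<integral>\<omega>. B i \<omega> \<partial>P) = G (real i / real M)"
      "\<And>i \<omega>. i \<in> {1..M*M} \<Longrightarrow> \<omega> \<in> space P \<Longrightarrow> B i \<omega> \<le> (\<Sum>m<n. (c \<omega> m)\<^sup>2 / (w \<omega> + real i / real M * c \<omega> m))"
      by blast+
    have "(\<Sum>i=1..M*M. (1 / real M) * G (real i / real M)) = (\<integral>\<omega>. (\<Sum>i=1..M*M. (1 / real M) * B i \<omega>) \<partial>P)"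
      using B by (subst Bochner_Integration.integral_sum) auto
    also have "\<dots> \<le> (\<integral>\<omega>. w \<omega> * ln (real M) + h \<omega> + real n * w \<omega> / real M \<partial>P)"
    proof (intro integral_mono)
      show "integrable P (\<lambda>\<omega>. \<Sum>i=1..M*M. (1 / real M) * B i \<omega>)" using B by auto
      show "integrable P (\<lambda>\<omega>. w \<omega> * ln (real M) + h \<omega> + real n * w \<omega> / real M)"
        using intw inth by (auto simp: h_def)
      fix \<omega> assume \<omega>: "\<omega> \<in> space P"
      have "(\<Sum>i=1..M*M. (1 / real M) * B i \<omega>) \<le> (\<Sum>i=1..M*M. (1 / real M) * (\<Sum>m<n. (c \<omega> m)\<^sup>2 / (w \<omega> + real i / real M * c \<omega> m)))"
        using B(3) \<omega> by (intro sum_mono mult_left_mono) auto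
      also have "\<dots> = (\<Sum>m<n. \<Sum>i=1..M*M. (1 / real M) * ((c \<omega> m)\<^sup>2 / (w \<omega> + real i / real M * c \<omega> m)))"
        unfolding sum_distrib_left by (rule sum.swap)
      also have "\<dots> \<le> (\<Sum>m<n. c \<omega> m * ln (real M) + c \<omega> m * ln (c \<omega> m) + w \<omega> / real M - c \<omega> m * ln (w \<omega>))"
      proof (intro sum_mono riemann_upper M)
        fix m assume "m \<in> {..<n}"
        then show "c \<omega> m \<le> w \<omega>" unfolding w[OF \<omega>] using c[OF \<omega>] by (intro member_le_sum) auto
      qed (use c[OF \<omega>] in auto)
      also have "\<dots> = w \<omega> * ln (real M) + h \<omega> + real n * w \<omega> / real M"
        by (simp add: sum.distrib sum_subtractf h_def sum_distrib_right[symmetric] w[OF \<omega>])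
      finally show "(\<Sum>i=1..M*M. (1 / real M) * B i \<omega>) \<le> w \<omega> * ln (real M) + h \<omega> + real n * w \<omega> / real M" .
    qed
    also have "\<dots> = W * ln (real M) + (\<integral>\<omega>. h \<omega> \<partial>P) + real n * W / real M"
      using intw inth by (simp add: h_def W_def Ww[symmetric])
    finally have u: "(\<Sum>i=1..M*M. (1 / real M) * G (real i / real M)) \<le> W * ln (real M) + (\<integral>\<omega>. h \<omega> \<partial>P) + real n * W / real M" .
    have "(\<Sum>a<N. \<Sum>b<N. d b a * (p a * ln (real M) + p a * ln (p a) - p a * ln (s b + p a / real M)))
        \<le> (\<Sum>a<N. \<Sum>b<N. d b a * (\<Sum>i=1..M*M. (1 / real M) * ((p a)\<^sup>2 / (s b + real i / real M * p a))))"
      using p s M by (intro sum_mono mult_left_mono riemann_lower) (auto simp: d_def)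
    also have "\<dots> = (\<Sum>a<N. \<Sum>b<N. \<Sum>i=1..M*M. (1 / real M) * (d b a * ((p a)\<^sup>2 / (s b + real i / real M * p a))))"
      by (simp add: sum_distrib_left mult_ac)
    also have "\<dots> = (\<Sum>i=1..M*M. (1 / real M) * G (real i / real M))"
      unfolding G_def sum_distrib_left by (rule sum_rotate[symmetric])
    finally have l: "(\<Sum>a<N. \<Sum>b<N. d b a * (p a * ln (real M) + p a * ln (p a) - p a * ln (s b + p a / real M)))
        \<le> (\<Sum>i=1..M*M. (1 / real M) * G (real i / real M))" .
    have "(\<Sum>a<N. \<Sum>b<N. d b a * (p a * ln (real M) + p a * ln (p a) - p a * ln (s b + p a / real M)))
        = (\<Sum>a<N. (\<Sum>b<N. d b a) * (p a * ln (real M) + p a * ln (p a))) - (\<Sum>a<N. \<Sum>b<N. p a * d b a * ln (s b + p a / real M))"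
      by (simp add: right_diff_distrib sum_subtractf sum_distrib_right mult_ac)
    also have "(\<Sum>a<N. (\<Sum>b<N. d b a) * (p a * ln (real M) + p a * ln (p a))) = W * ln (real M) + (\<Sum>a<N. p a * ln (p a))"
      by (simp add: d1 W_def sum.distrib sum_distrib_right)
    \<comment> \<open>The divergent terms \<open>W * ln M\<close> of the two estimates cancel, as
      both sides have total mass \<open>W\<close>.\<close>
    finally show ?thesis using u l by linarith
  qed
  \<comment> \<open>As \<open>M\<close> grows the regularisation \<open>p a / M\<close> disappears;
    at \<open>s b = 0\<close>, where \<open>ln\<close> is discontinuous, the coefficient is zero by
    \<open>supp\<close>.\<close>
  have "(\<lambda>M. (\<Sum>a<N. p a * ln (p a)) - (\<Sum>a<N. \<Sum>b<N. p a * d b a * ln (s b + p a / real M)))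
      \<longlonglongrightarrow> (\<Sum>a<N. p a * ln (p a)) - (\<Sum>a<N. \<Sum>b<N. p a * d b a * ln (s b))"
  proof (intro tendsto_diff tendsto_const tendsto_sum)
    fix a b assume "a \<in> {..<N}" "b \<in> {..<N}"
    then have ab: "a < N" "b < N" by auto
    show "(\<lambda>M. p a * d b a * ln (s b + p a / real M)) \<longlonglongrightarrow> p a * d b a * ln (s b)"
    proof (cases "s b = 0")
      case True
      then have "p a * d b a = 0" using supp[OF ab] by (simp only: d_def)
      then show ?thesis by (simp only: mult_zero_left tendsto_const)
    next
      case False
      have "(\<lambda>M. s b + p a / real M) \<longlonglongrightarrow> s b + 0"
        by (intro tendsto_add tendsto_const lim_const_over_n)
      then show ?thesis using False by (intro tendsto_mult tendsto_const tendsto_ln) auto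
    qed
  qed
  moreover have "(\<lambda>M. (\<integral>\<omega>. h \<omega> \<partial>P) + real n * W / real M) \<longlonglongrightarrow> (\<integral>\<omega>. h \<omega> \<partial>P) + 0"
    by (intro tendsto_add tendsto_const lim_const_over_n)
  ultimately have "(\<Sum>a<N. p a * ln (p a)) - (\<Sum>a<N. \<Sum>b<N. p a * d b a * ln (s b)) \<le> (\<integral>\<omega>. h \<omega> \<partial>P) + 0"
    by (rule LIMSEQ_le) (use bound in \<open>auto intro!: exI[of _ 1]\<close>)
  then show ?thesis by (simp add: d_def h_def)
qed

section \<open>The entropy as a power series: measurability and bounds\<close>

lemma ln_power_series:
  fixes l :: real
  assumes "0 \<le> l" "l \<le> 1"
  shows "(\<lambda>m. l * (1 - l) ^ m / real m) sums (- (l * ln l))"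
proof (cases "l = 0")
  case False
  then have "\<bar>l - 1\<bar> < 1" using assms by auto
  from ln_series'[OF this] have "(\<lambda>m. - ((- (l - 1)) ^ m) / real m) sums ln l" by simp
  then have "(\<lambda>m. (- l) * (- ((- (l - 1)) ^ m) / real m)) sums ((- l) * ln l)" by (rule sums_mult)
  then show ?thesis by simp
qed simp

text \<open>The entries of the \<open>m\<close>-th power of \<open>1 - A\<close>, which are
  polynomials in the entries of \<open>A\<close>.\<close>

fun compl_power :: "nat \<Rightarrow> (nat \<Rightarrow> nat \<Rightarrow> complex) \<Rightarrow> nat \<Rightarrow> nat \<Rightarrow> nat \<Rightarrow> complex" where
  "compl_power N A 0 r s = (if r = s then 1 else 0)"
| "compl_power N A (Suc m) r s = (\<Sum>q<N. compl_power N A m r q * ((if q = s then 1 else 0) - A q s))"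

lemma spectral_compl_power:
  assumes ul: "spectral N A u l"
  shows "spectral N (compl_power N A m) u (\<lambda>i. (1 - l i) ^ m)"
proof -
  have onb: "onb N u" using ul by (simp add: spectral_def)
  have "compl_power N A m r s = (\<Sum>i<N. of_real ((1 - l i) ^ m) * u i r * cnj (u i s))" if "r < N" "s < N" for r s
    using that
  proof (induction m arbitrary: s)
    case 0
    then show ?case using onb by (simp add: onb_def)
  next
    case (Suc m)
    have B: "(if q = s then 1 else 0) - A q s = (\<Sum>k<N. of_real (1 - l k) * u k q * cnj (u k s))" if "q < N" for q
    proof -
      have "(if q = s then 1 else 0) - A q s = (\<Sum>k<N. u k q * cnj (u k s)) - (\<Sum>k<N. of_real (l k) * u k q * cnj (u k s))"
        using ul that Suc.prems by (simp add: spectral_def onb_def)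
      then show ?thesis by (simp add: sum_subtractf[symmetric] algebra_simps)
    qed
    have "compl_power N A (Suc m) r s = (\<Sum>q<N. (\<Sum>i<N. of_real ((1 - l i) ^ m) * u i r * cnj (u i q)) * (\<Sum>k<N. of_real (1 - l k) * u k q * cnj (u k s)))"
      unfolding compl_power.simps using Suc.IH Suc.prems by (intro sum.cong refl arg_cong2[of _ _ _ _ "(*)"] B) auto
    also have "\<dots> = (\<Sum>q<N. \<Sum>i<N. \<Sum>k<N. (of_real ((1 - l i) ^ m) * of_real (1 - l k) * u i r * cnj (u k s)) * (cnj (u i q) * u k q))"
      unfolding sum_product by (simp only: mult_ac)
    also have "\<dots> = (\<Sum>i<N. \<Sum>k<N. (of_real ((1 - l i) ^ m) * of_real (1 - l k) * u i r * cnj (u k s)) * ip N (u i) (u k))"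
      unfolding ip_def sum_distrib_left by (rule sum_rotate)
    also have "\<dots> = (\<Sum>i<N. \<Sum>k<N. (of_real ((1 - l i) ^ m) * of_real (1 - l k) * u i r * cnj (u k s)) * (if i = k then 1 else 0))"
      by (intro sum.cong refl arg_cong2[of _ _ _ _ "(*)"] ip_onb_self[OF onb]) auto
    also have "\<dots> = (\<Sum>i<N. of_real ((1 - l i) ^ m) * of_real (1 - l i) * u i r * cnj (u i s))"
      by (intro sum.cong refl sum_delta_lessThan(2)) auto
    finally show ?case by (simp add: mult_ac)
  qed
  then show ?thesis using onb by (simp add: spectral_def)
qed

text \<open>The logarithm series around 1, applied to every eigenvalue. The term
  \<open>m = 0\<close> is a division by zero and contributes 0.\<close>

lemma vN_entropy_sums:
  assumes A: "psd N A" "Re (mtrace A) \<le> 1"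
  shows "(\<lambda>m. Re (trace_prod N (mfun A) (compl_power N (mfun A) m)) / real m / ln 2) sums vN_entropy A"
proof -
  have cA: "A \<in> carrier_mat N N" using A by (simp add: psd_def)
  obtain u l where ul: "spectral N (mfun A) u l" and l: "\<And>i. i < N \<Longrightarrow> 0 \<le> l i"
    using psd_spectral[OF A(1)] by blast
  have "(\<Sum>i<N. l i) \<le> 1" using A(2) by (simp add: mtrace_spectral[OF cA ul])
  then have l1: "l i \<le> 1" if "i < N" for i
    using member_le_sum[of i "{..<N}" l] that l by simp
  have "trace_prod N (mfun A) (compl_power N (mfun A) m) = (\<Sum>i<N. of_real (l i) * quad N (compl_power N (mfun A) m) (u i))" for m
    by (rule trace_prod_decomp) (use ul in \<open>simp add: spectral_def\<close>)
  then have eq: "Re (trace_prod N (mfun A) (compl_power N (mfun A) m)) / real m / ln 2 = (\<Sum>i<N. l i * (1 - l i) ^ m / real m / ln 2)" for m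
    by (simp add: quad_eigenvector[OF spectral_compl_power[OF ul]] sum_divide_distrib del: of_real_power of_real_diff of_real_sum)
  have "(\<lambda>m. \<Sum>i<N. l i * (1 - l i) ^ m / real m / ln 2) sums (\<Sum>i<N. - (l i * ln (l i)) / ln 2)"
    using l l1 by (intro sums_sum sums_divide ln_power_series) auto
  then show ?thesis unfolding eq vN_entropy_spectral[OF cA ul] by (simp add: log_def sum_negf)
qed

text \<open>Eigenvalues and eigenvectors come from bare existence statements and carry no
  measurability in the parameter. A convergent series of polynomials in the entries does.\<close>

lemma vN_entropy_measurable:
  assumes "\<And>x. x \<in> space M \<Longrightarrow> psd N (R x)" "\<And>x. x \<in> space M \<Longrightarrow> Re (mtrace (R x)) \<le> 1"
    and [measurable]: "\<And>r s. r < N \<Longrightarrow> s < N \<Longrightarrow> (\<lambda>x. R x $$ (r, s)) \<in> borel_measurable M"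
  shows "(\<lambda>x. vN_entropy (R x)) \<in> borel_measurable M"
proof -
  have m1: "(\<lambda>x. compl_power N (mfun (R x)) m r s) \<in> borel_measurable M" if "r < N" "s < N" for m r s
    using that
  proof (induction m arbitrary: s)
    case (Suc m)
    show ?case unfolding compl_power.simps mfun_def
      by (intro borel_measurable_sum borel_measurable_times borel_measurable_diff borel_measurable_const)
        (use Suc in \<open>auto simp: mfun_def intro: assms\<close>)
  qed simp
  have "(\<lambda>x. Re (trace_prod N (mfun (R x)) (compl_power N (mfun (R x)) m))) \<in> borel_measurable M" for m
    unfolding trace_prod_def
    by (intro measurable_compose[OF _ borel_measurable_Re] borel_measurable_sum borel_measurable_times m1)
      (auto simp: mfun_def intro: assms)
  then have "(\<lambda>x. \<Sum>m. Re (trace_prod N (mfun (R x)) (compl_power N (mfun (R x)) m)) / real m / ln 2) \<in> borel_measurable M"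
    by (intro borel_measurable_suminf) auto
  also have "?this \<longleftrightarrow> ?thesis"
    using vN_entropy_sums[OF assms(1,2)] by (intro measurable_cong) (auto simp: sums_iff)
  finally show ?thesis .
qed

lemma neg_x_log_x_bounds:
  fixes x :: real
  assumes "0 \<le> x" "x \<le> 1"
  shows "0 \<le> - (x * log 2 x)" "- (x * log 2 x) \<le> 2"
proof -
  show "0 \<le> - (x * log 2 x)" using assms by (cases "x = 0") (auto simp: mult_nonneg_nonpos)
  show "- (x * log 2 x) \<le> 2"
  proof (cases "x = 0")
    case False
    then have x: "x > 0" using assms by simp
    have "ln (1 / x) \<le> 1 / x - 1" using x by (intro ln_le_minus_one) simp
    then have "x * - ln x \<le> x * (1 / x - 1)" using x by (intro mult_left_mono) (auto simp: ln_div)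
    also have "\<dots> \<le> 1" using x by (simp add: field_simps)
    finally have "x * - ln x / ln 2 \<le> 1 / ln 2" by (intro divide_right_mono) auto
    also have "\<dots> \<le> 2" using ln2_ge_two_thirds by (simp add: field_simps)
    finally show ?thesis by (simp add: log_def)
  qed simp
qed

text \<open>The upper bound is crude; it serves only to make entropies integrable.\<close>

lemma vN_entropy_bounds:
  assumes A: "psd N A" "Re (mtrace A) \<le> 1"
  shows "0 \<le> vN_entropy A" "vN_entropy A \<le> 2 * real N"
proof -
  have cA: "A \<in> carrier_mat N N" using A by (simp add: psd_def)
  obtain u l where ul: "spectral N (mfun A) u l" and l: "\<And>i. i < N \<Longrightarrow> 0 \<le> l i"
    using psd_spectral[OF A(1)] by blast
  have "(\<Sum>i<N. l i) \<le> 1" using A(2) by (simp add: mtrace_spectral[OF cA ul])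
  then have l1: "l i \<le> 1" if "i < N" for i
    using member_le_sum[of i "{..<N}" l] that l by simp
  have eq: "vN_entropy A = (\<Sum>i<N. - (l i * log 2 (l i)))" by (simp add: vN_entropy_spectral[OF cA ul] sum_negf)
  show "0 \<le> vN_entropy A" unfolding eq using l l1 by (intro sum_nonneg neg_x_log_x_bounds) auto
  have "vN_entropy A \<le> (\<Sum>i<N. 2)" unfolding eq using l l1 by (intro sum_mono neg_x_log_x_bounds) auto
  then show "vN_entropy A \<le> 2 * real N" by simp
qed

section \<open>Averages of positive matrices\<close>

lemma psd_trace_real:
  assumes A: "psd N A"
  shows "mtrace A = of_real (Re (mtrace A))" "0 \<le> Re (mtrace A)"
proof -
  have cA: "A \<in> carrier_mat N N" using A by (simp add: psd_def)
  obtain u l where ul: "spectral N (mfun A) u l" and l: "\<And>i. i < N \<Longrightarrow> 0 \<le> l i"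
    using psd_spectral[OF A(1)] by blast
  show "mtrace A = of_real (Re (mtrace A))" "0 \<le> Re (mtrace A)"
    using l by (auto simp: mtrace_spectral[OF cA ul] intro!: sum_nonneg)
qed

lemma psd_entry_bound:
  assumes A: "psd N A" and "r < N" "s < N"
  shows "cmod (A $$ (r, s)) \<le> Re (mtrace A)"
proof -
  have cA: "A \<in> carrier_mat N N" using A by (simp add: psd_def)
  obtain u l where ul: "spectral N (mfun A) u l" and l: "\<And>i. i < N \<Longrightarrow> 0 \<le> l i"
    using psd_spectral[OF A(1)] by blast
  have u1: "cmod (u i r) \<le> 1" if "i < N" "r < N" for i r
  proof -
    have "(cmod (u i r))\<^sup>2 \<le> (\<Sum>r<N. (cmod (u i r))\<^sup>2)" using that by (intro member_le_sum) auto
    also have "\<dots> = 1" using ul that by (intro onb_norm) (auto simp: spectral_def)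
    finally show ?thesis by (simp add: power_le_one_iff)
  qed
  have "A $$ (r, s) = (\<Sum>i<N. of_real (l i) * u i r * cnj (u i s))" using ul assms by (simp add: spectral_def mfun_def)
  also have "cmod \<dots> \<le> (\<Sum>i<N. l i * (cmod (u i r) * cmod (u i s)))"
    using l by (intro sum_norm_le) (simp add: norm_mult)
  also have "\<dots> \<le> (\<Sum>i<N. l i * 1)"
    using l u1 assms by (intro sum_mono mult_left_mono) (auto intro!: mult_le_one)
  finally show ?thesis by (simp add: mtrace_spectral[OF cA ul])
qed

lemma quad_integral:
  fixes F :: "'x \<Rightarrow> nat \<Rightarrow> nat \<Rightarrow> complex"
  assumes int: "\<And>r s. r < N \<Longrightarrow> s < N \<Longrightarrow> integrable M (\<lambda>x. F x r s)"
  shows "integrable M (\<lambda>x. quad N (F x) v)"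
    "quad N (\<lambda>r s. \<integral>x. F x r s \<partial>M) v = (\<integral>x. quad N (F x) v \<partial>M)"
proof -
  have i: "integrable M (\<lambda>x. cnj (v r) * F x r s * v s)" if "r < N" "s < N" for r s
    using int[OF that] by simp
  have i': "integrable M (\<lambda>x. \<Sum>s<N. cnj (v r) * F x r s * v s)" if "r < N" for r
    using i[OF that] by (intro Bochner_Integration.integrable_sum) auto
  show "integrable M (\<lambda>x. quad N (F x) v)"
    unfolding quad_def by (intro Bochner_Integration.integrable_sum i) auto
  have "quad N (\<lambda>r s. \<integral>x. F x r s \<partial>M) v = (\<Sum>r<N. \<Sum>s<N. (\<integral>x. cnj (v r) * F x r s * v s \<partial>M))"
    unfolding quad_def by (intro sum.cong refl) (simp add: int)
  also have "\<dots> = (\<Sum>r<N. (\<integral>x. (\<Sum>s<N. cnj (v r) * F x r s * v s) \<partial>M))"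
    using i by (intro sum.cong refl Bochner_Integration.integral_sum[symmetric]) auto
  also have "\<dots> = (\<integral>x. quad N (F x) v \<partial>M)"
    unfolding quad_def using i' by (intro Bochner_Integration.integral_sum[symmetric]) auto
  finally show "quad N (\<lambda>r s. \<integral>x. F x r s \<partial>M) v = (\<integral>x. quad N (F x) v \<partial>M)" .
qed

lemma psd_integral:
  assumes psd: "\<And>x. x \<in> space M \<Longrightarrow> psd N (F x)"
    and int: "\<And>r s. r < N \<Longrightarrow> s < N \<Longrightarrow> integrable M (\<lambda>x. F x $$ (r, s))"
  shows "psd N (mat N N (\<lambda>(r,s). \<integral>x. F x $$ (r, s) \<partial>M))"
  unfolding psd_iff_quad
proof (intro conjI allI impI)
  fix r s assume rs: "r < N" "s < N"
  have "(\<integral>x. F x $$ (r, s) \<partial>M) = (\<integral>x. cnj (F x $$ (s, r)) \<partial>M)"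
  proof (rule Bochner_Integration.integral_cong[OF refl])
    fix x assume "x \<in> space M"
    from psd[OF this] show "F x $$ (r, s) = cnj (F x $$ (s, r))"
      unfolding psd_iff_quad mfun_def using rs by blast
  qed
  then show "mfun (mat N N (\<lambda>(r,s). \<integral>x. F x $$ (r, s) \<partial>M)) r s = cnj (mfun (mat N N (\<lambda>(r,s). \<integral>x. F x $$ (r, s) \<partial>M)) s r)"
    using rs by (simp add: mfun_def)
next
  fix v
  note q = quad_integral[of N M "\<lambda>x. mfun (F x)", unfolded mfun_def, OF int, folded mfun_def, of v]
  have "quad N (mfun (mat N N (\<lambda>(r,s). \<integral>x. F x $$ (r, s) \<partial>M))) v = (\<integral>x. quad N (mfun (F x)) v \<partial>M)"
    using q(2) by (simp add: quad_def mfun_def)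
  then have "Re (quad N (mfun (mat N N (\<lambda>(r,s). \<integral>x. F x $$ (r, s) \<partial>M))) v) = (\<integral>x. Re (quad N (mfun (F x)) v) \<partial>M)"
    using q(1) by simp
  also have "\<dots> \<ge> 0" using psd unfolding psd_iff_quad by (intro Bochner_Integration.integral_nonneg) auto
  finally show "0 \<le> Re (quad N (mfun (mat N N (\<lambda>(r,s). \<integral>x. F x $$ (r, s) \<partial>M))) v)" .
qed simp

section \<open>Tensor products with a pure state\<close>

lemma sum_lessThan_mult:
  fixes f :: "nat \<Rightarrow> 'b::comm_monoid_add"
  shows "(\<Sum>r<n*d. f r) = (\<Sum>x<n. \<Sum>y<d. f (x * d + y))"
proof -
  have "(\<Sum>r<n*d. f r) = (\<Sum>x<n. sum f {x*d..<x*d+d})" by (rule sum.nat_group[symmetric])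
  also have "\<dots> = (\<Sum>x<n. \<Sum>y<d. f (x * d + y))"
  proof (rule sum.cong[OF refl])
    fix x
    have "sum f {0 + x*d..<d + x*d} = sum (\<lambda>y. f (y + x*d)) {0..<d}" by (rule sum.shift_bounds_nat_ivl)
    then show "sum f {x*d..<x*d+d} = (\<Sum>y<d. f (x * d + y))" by (simp add: add.commute atLeast0LessThan)
  qed
  finally show ?thesis .
qed

lemma pure_stateD:
  assumes "pure_state N A"
  shows "\<exists>v. (\<Sum>i<N. (cmod (v i))\<^sup>2) = 1 \<and> (\<forall>i<N. \<forall>k<N. A $$ (i, k) = v i * cnj (v k)) \<and>
    A \<in> carrier_mat N N"
proof -
  obtain y :: "complex vec" where y: "y \<in> carrier_vec N" "conjugate y \<bullet> y = 1" "A = ket_bra y"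
    using assms by (auto simp: pure_state_def)
  have "ip N (\<lambda>i. y $ i) (\<lambda>i. y $ i) = 1"
    using y by (simp add: ip_def scalar_prod_def atLeast0LessThan)
  then have "complex_of_real (\<Sum>i<N. (cmod (y $ i))\<^sup>2) = of_real 1" by (simp only: ip_self of_real_1)
  then have "(\<Sum>i<N. (cmod (y $ i))\<^sup>2) = 1" by (simp only: of_real_eq_iff)
  then show ?thesis using y by (intro exI[of _ "\<lambda>i. y $ i"]) (auto simp: ket_bra_def)
qed

lemma div_mod_less:
  fixes r n d :: nat
  assumes "r < n * d"
  shows "r div d < n" "r mod d < d"
  using assms by (auto simp: less_mult_imp_div_less) (metis mod_less_divisor mult_0_right neq0_conv not_less0)

lemma mult_add_less:
  fixes x y n d :: nat
  assumes "x < n" "y < d"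
  shows "x * d + y < n * d"
proof -
  have "x * d + y < Suc x * d" using assms by simp
  also have "\<dots> \<le> n * d" using assms by (intro mult_le_mono1) simp
  finally show ?thesis .
qed

lemma kron_index:
  assumes "A \<in> carrier_mat n n" "B \<in> carrier_mat d d" "r < n * d" "s < n * d"
  shows "kron A B $$ (r, s) = A $$ (r div d, s div d) * B $$ (r mod d, s mod d)"
  using assms by (simp add: kron_def)

text \<open>A rank-one second factor preserves the eigenvalues of the first and the number of terms,
  so the weights are those of \<open>A\<close> alone.\<close>

lemma quad_product_decomp:
  fixes y :: "nat \<Rightarrow> nat \<Rightarrow> complex" and v :: "nat \<Rightarrow> complex"
  assumes A: "A \<in> carrier_mat n n" and B: "B \<in> carrier_mat d d"
    and yl: "spectral n (mfun A) y l" and v: "\<And>i k. i < d \<Longrightarrow> k < d \<Longrightarrow> B $$ (i, k) = v i * cnj (v k)"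
    and rs: "r < n * d" "s < n * d"
  shows "kron A B $$ (r, s) = (\<Sum>m<n. of_real (l m) * (y m (r div d) * v (r mod d)) * cnj (y m (s div d) * v (s mod d)))"
proof -
  have "A $$ (r div d, s div d) = (\<Sum>m<n. of_real (l m) * y m (r div d) * cnj (y m (s div d)))"
    using yl div_mod_less[OF rs(1)] div_mod_less[OF rs(2)] by (simp add: spectral_def mfun_def)
  then show ?thesis
    using v[of "r mod d" "s mod d"] div_mod_less[OF rs(1)] div_mod_less[OF rs(2)]
    by (simp add: kron_index[OF A B rs] sum_distrib_left sum_distrib_right mult_ac)
qed

lemma norm_product_vector:
  fixes y v :: "nat \<Rightarrow> complex" and n d :: nat
  assumes "(\<Sum>x<n. (cmod (y x))\<^sup>2) = 1" "(\<Sum>i<d. (cmod (v i))\<^sup>2) = 1"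
  shows "(\<Sum>r<n*d. (cmod (y (r div d) * v (r mod d)))\<^sup>2) = 1"
proof -
  have "(\<Sum>r<n*d. (cmod (y (r div d) * v (r mod d)))\<^sup>2) = (\<Sum>x<n. \<Sum>i<d. (cmod (y x))\<^sup>2 * (cmod (v i))\<^sup>2)"
    unfolding sum_lessThan_mult by (intro sum.cong refl) (simp add: norm_mult power_mult_distrib)
  then show ?thesis using assms by (simp add: sum_distrib_left[symmetric])
qed

lemma psd_kron_pure:
  assumes A: "psd n A" and B: "pure_state d B"
  shows "psd (n * d) (kron A B)"
proof -
  have cA: "A \<in> carrier_mat n n" using A by (simp add: psd_def)
  obtain v where v: "(\<Sum>i<d. (cmod (v i))\<^sup>2) = 1" "\<And>i k. i < d \<Longrightarrow> k < d \<Longrightarrow> B $$ (i, k) = v i * cnj (v k)"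
    "B \<in> carrier_mat d d" using pure_stateD[OF B] by blast
  obtain y l where yl: "spectral n (mfun A) y l" and l: "\<And>i. i < n \<Longrightarrow> 0 \<le> l i"
    using psd_spectral[OF A] by blast
  define x where "x m r = y m (r div d) * v (r mod d)" for m r
  have dec: "kron A B $$ (r, s) = (\<Sum>m<n. of_real (l m) * x m r * cnj (x m s))" if "r < n * d" "s < n * d" for r s
    unfolding x_def by (rule quad_product_decomp[OF cA v(3) yl v(2) that])
  show ?thesis unfolding psd_iff_quad
  proof (intro conjI allI impI)
    show "kron A B \<in> carrier_mat (n * d) (n * d)" using cA v(3) by (simp add: kron_def)
    fix r s assume "r < n * d" "s < n * d"
    then show "mfun (kron A B) r s = cnj (mfun (kron A B) s r)" by (simp add: mfun_def dec mult_ac)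
  next
    fix z
    have "quad (n * d) (mfun (kron A B)) z = trace_prod (n * d) (mfun (kron A B)) (\<lambda>s r. cnj (z r) * z s)" 
      unfolding quad_def trace_prod_def by (intro sum.cong refl) (simp only: mult_ac)
    also have "\<dots> = (\<Sum>m<n. of_real (l m) * quad (n * d) (\<lambda>s r. cnj (z r) * z s) (x m))"
      by (rule trace_prod_decomp) (simp add: mfun_def dec)
    also have "\<dots> = (\<Sum>m<n. of_real (l m) * (ip (n * d) (x m) z * cnj (ip (n * d) (x m) z)))"
      unfolding ip_cnj unfolding quad_def ip_def sum_product by (simp only: mult_ac)
    also have "\<dots> = of_real (\<Sum>m<n. l m * (cmod (ip (n * d) (x m) z))\<^sup>2)"
      by (simp only: complex_norm_square[symmetric] of_real_mult of_real_sum)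
    finally show "0 \<le> Re (quad (n * d) (mfun (kron A B)) z)"
      using l by (auto intro!: sum_nonneg)
  qed
qed

lemma mtrace_kron_pure:
  assumes A: "A \<in> carrier_mat n n" and B: "pure_state d B"
  shows "mtrace (kron A B) = mtrace A"
proof -
  obtain v where v: "(\<Sum>i<d. (cmod (v i))\<^sup>2) = 1" "\<And>i k. i < d \<Longrightarrow> k < d \<Longrightarrow> B $$ (i, k) = v i * cnj (v k)"
    "B \<in> carrier_mat d d" using pure_stateD[OF B] by blast
  have "mtrace B = of_real (\<Sum>i<d. (cmod (v i))\<^sup>2)"
    unfolding mtrace_def of_real_sum using v(2,3)
    by (intro sum.cong) (auto simp: complex_norm_square simp del: of_real_power)
  then have tB: "(\<Sum>i<d. B $$ (i, i)) = 1" using v(1,3) by (simp add: mtrace_def)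
  have "mtrace (kron A B) = (\<Sum>x<n. \<Sum>i<d. A $$ (x, x) * B $$ (i, i))"
    using A v(3) by (simp add: mtrace_def kron_def sum_lessThan_mult mult_add_less)
  then show ?thesis using A by (simp add: sum_distrib_left[symmetric] tB mtrace_def)
qed

lemma psd_smult:
  assumes "psd N A" "0 \<le> c"
  shows "psd N (of_real c \<cdot>\<^sub>m A)"
  unfolding psd_iff_quad
proof (intro conjI allI impI)
  have cA: "A \<in> carrier_mat N N" using assms(1) by (simp add: psd_def)
  then show "of_real c \<cdot>\<^sub>m A \<in> carrier_mat N N" by simp
  have e: "mfun (of_real c \<cdot>\<^sub>m A) r s = of_real c * mfun A r s" if "r < N" "s < N" for r s
    using cA that by (simp add: mfun_def)
  show "mfun (of_real c \<cdot>\<^sub>m A) r s = cnj (mfun (of_real c \<cdot>\<^sub>m A) s r)" if rs: "r < N" "s < N" for r s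
  proof -
    have "mfun A r s = cnj (mfun A s r)" using assms(1) rs unfolding psd_iff_quad by blast
    then have "of_real c * mfun A r s = cnj (of_real c * mfun A s r)" by simp
    then show ?thesis by (simp only: e rs)
  qed
  have "quad N (mfun (of_real c \<cdot>\<^sub>m A)) v = of_real c * quad N (mfun A) v" for v
    unfolding quad_def sum_distrib_left by (intro sum.cong refl) (simp add: e)
  moreover have "0 \<le> Re (quad N (mfun A) v)" for v using assms(1) unfolding psd_iff_quad by blast
  ultimately show "0 \<le> Re (quad N (mfun (of_real c \<cdot>\<^sub>m A)) v)" for v using assms(2) by simp
qed

lemma pure_state_density:
  assumes "pure_state N A"
  shows "density N A"
proof -
  obtain v where v: "(\<Sum>i<N. (cmod (v i))\<^sup>2) = 1" "\<And>i k. i < N \<Longrightarrow> k < N \<Longrightarrow> A $$ (i, k) = v i * cnj (v k)"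
    "A \<in> carrier_mat N N" using pure_stateD[OF assms] by blast
  have "quad N (mfun A) z = of_real ((cmod (ip N v z))\<^sup>2)" for z
  proof -
    have "quad N (mfun A) z = (\<Sum>i<N. \<Sum>k<N. (cnj (z i) * v i) * (cnj (v k) * z k))"
      unfolding quad_def mfun_def by (intro sum.cong refl) (simp add: v(2) mult_ac)
    also have "\<dots> = ip N v z * cnj (ip N v z)"
      unfolding ip_cnj unfolding ip_def sum_product[symmetric] by (rule mult.commute)
    finally show ?thesis by (simp only: complex_norm_square)
  qed
  then have "psd N A" unfolding psd_iff_quad using v(3) by (auto simp: mfun_def v(2))
  moreover have "mtrace A = of_real (\<Sum>i<N. (cmod (v i))\<^sup>2)"
    unfolding mtrace_def of_real_sum using v(2,3)
    by (intro sum.cong) (auto simp: complex_norm_square simp del: of_real_power)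
  ultimately show ?thesis using v(1) by (simp add: density_def)
qed

text \<open>Every averaged state below is an instance: words weighted by the probability of a label,
  letters weighted by a conditional probability or a kernel density, and plain averages with weight
  1.\<close>

lemma weighted_mixture:
  fixes F :: "'x \<Rightarrow> complex mat" and c :: "'x \<Rightarrow> real"
  assumes M: "prob_space M" and F: "\<And>x. x \<in> space M \<Longrightarrow> density N (F x)"
    and mF: "\<And>r s. r < N \<Longrightarrow> s < N \<Longrightarrow> (\<lambda>x. F x $$ (r, s)) \<in> borel_measurable M"
    and mc: "c \<in> borel_measurable M" and c: "\<And>x. x \<in> space M \<Longrightarrow> 0 \<le> c x \<and> c x \<le> 1"
  shows "r < N \<Longrightarrow> s < N \<Longrightarrow> integrable M (\<lambda>x. of_real (c x) * F x $$ (r, s))"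
    and "psd N (mat N N (\<lambda>(r,s). \<integral>x. of_real (c x) * F x $$ (r, s) \<partial>M))"
    and "mtrace (mat N N (\<lambda>(r,s). \<integral>x. of_real (c x) * F x $$ (r, s) \<partial>M)) = of_real (\<integral>x. c x \<partial>M)"
proof -
  interpret prob_space M by fact
  have cF: "F x \<in> carrier_mat N N" and tF: "mtrace (F x) = 1" if "x \<in> space M" for x
    using F[OF that] by (auto simp: density_def psd_def)
  have e: "(of_real (c x) \<cdot>\<^sub>m F x) $$ (r, s) = of_real (c x) * F x $$ (r, s)"
    if "x \<in> space M" "r < N" "s < N" for x r s using cF[OF that(1)] that(2,3) by simp
  show int: "integrable M (\<lambda>x. of_real (c x) * F x $$ (r, s))" if "r < N" "s < N" for r s
  proof (rule integrable_const_bound[of _ 1])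
    have "cmod (F x $$ (r, s)) \<le> 1" if x: "x \<in> space M" for x
      using psd_entry_bound[OF _ \<open>r < N\<close> \<open>s < N\<close>, of "F x"] F[OF x] by (simp add: density_def)
    then show "AE x in M. norm (of_real (c x) * F x $$ (r, s)) \<le> 1"
      using c by (intro AE_I2) (simp add: norm_mult mult_le_one)
  qed (use mF[OF that] mc in simp)
  have "psd N (mat N N (\<lambda>(r,s). \<integral>x. (of_real (c x) \<cdot>\<^sub>m F x) $$ (r, s) \<partial>M))"
  proof (rule psd_integral)
    show "psd N (of_real (c x) \<cdot>\<^sub>m F x)" if "x \<in> space M" for x
      using F[OF that] c[OF that] by (intro psd_smult) (auto simp: density_def)
    show "integrable M (\<lambda>x. (of_real (c x) \<cdot>\<^sub>m F x) $$ (r, s))" if "r < N" "s < N" for r s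
      using int[OF that] by (rule Bochner_Integration.integrable_cong[OF refl, THEN iffD1, rotated]) (simp add: e that)
  qed
  also have "mat N N (\<lambda>(r,s). \<integral>x. (of_real (c x) \<cdot>\<^sub>m F x) $$ (r, s) \<partial>M)
      = mat N N (\<lambda>(r,s). \<integral>x. of_real (c x) * F x $$ (r, s) \<partial>M)"
    by (intro eq_matI) (auto simp: e intro!: Bochner_Integration.integral_cong)
  finally show "psd N (mat N N (\<lambda>(r,s). \<integral>x. of_real (c x) * F x $$ (r, s) \<partial>M))" .
  have "mtrace (mat N N (\<lambda>(r,s). \<integral>x. of_real (c x) * F x $$ (r, s) \<partial>M))
      = (\<integral>x. (\<Sum>r<N. of_real (c x) * F x $$ (r, r)) \<partial>M)"
    using int by (simp add: mtrace_def Bochner_Integration.integral_sum)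
  also have "\<dots> = (\<integral>x. of_real (c x) \<partial>M)"
  proof (rule Bochner_Integration.integral_cong[OF refl])
    fix x assume x: "x \<in> space M"
    show "(\<Sum>r<N. of_real (c x) * F x $$ (r, r)) = complex_of_real (c x)"
      using tF[OF x] carrier_matD[OF cF[OF x]] by (simp add: mtrace_def sum_distrib_left[symmetric])
  qed
  finally show "mtrace (mat N N (\<lambda>(r,s). \<integral>x. of_real (c x) * F x $$ (r, s) \<partial>M)) = of_real (\<integral>x. c x \<partial>M)" by simp
qed

section \<open>The entropy chain inequality\<close>

lemma vN_entropy_scale:
  assumes A: "psd N A" and A': "A' \<in> carrier_mat N N" and W: "W = Re (mtrace A)" "W > 0"
    and eq: "\<And>r s. r < N \<Longrightarrow> s < N \<Longrightarrow> A' $$ (r, s) = A $$ (r, s) / of_real W"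
  shows "W * vN_entropy A' = vN_entropy A + W * log 2 W"
proof -
  have cA: "A \<in> carrier_mat N N" using A by (simp add: psd_def)
  obtain u l where ul: "spectral N (mfun A) u l" and l: "\<And>i. i < N \<Longrightarrow> 0 \<le> l i"
    using psd_spectral[OF A] by blast
  have Wl: "W = (\<Sum>i<N. l i)" using W by (simp add: mtrace_spectral[OF cA ul])
  have "spectral N (mfun A') u (\<lambda>i. l i / W)"
    using ul eq by (simp add: spectral_def mfun_def sum_divide_distrib)
  then have "vN_entropy A' = - (\<Sum>i<N. l i / W * log 2 (l i / W))"
    by (rule vN_entropy_spectral[OF A'])
  then have "W * vN_entropy A' = - (\<Sum>i<N. W * (l i / W * log 2 (l i / W)))"
    by (simp only: sum_distrib_left mult_minus_right)
  also have "(\<Sum>i<N. W * (l i / W * log 2 (l i / W))) = (\<Sum>i<N. l i * log 2 (l i) - l i * log 2 W)"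
  proof (intro sum.cong refl)
    fix i assume "i \<in> {..<N}"
    then have "0 \<le> l i" using l by simp
    then show "W * (l i / W * log 2 (l i / W)) = l i * log 2 (l i) - l i * log 2 W"
      using W(2) by (cases "l i = 0") (simp_all add: log_divide algebra_simps)
  qed
  finally show ?thesis
    by (simp add: vN_entropy_spectral[OF cA ul] sum_subtractf sum_distrib_right[symmetric] Wl)
qed

text \<open>Gibbs' inequality against the uniform spectrum \<open>1 / N\<close>.\<close>

lemma vN_entropy_le_log_dim:
  assumes A: "psd N A" and N: "0 < N" and W: "W = Re (mtrace A)"
  shows "vN_entropy A + W * log 2 W \<le> W * log 2 (real N)"
proof -
  have cA: "A \<in> carrier_mat N N" using A by (simp add: psd_def)
  obtain u l where ul: "spectral N (mfun A) u l" and l: "\<And>i. i < N \<Longrightarrow> 0 \<le> l i"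
    using psd_spectral[OF A] by blast
  have Wl: "W = (\<Sum>i<N. l i)" using W by (simp add: mtrace_spectral[OF cA ul])
  have onb: "onb N u" using ul by (simp add: spectral_def)
  have "- (\<Sum>a<N. l a * log 2 (l a)) + W * log 2 W \<le> (\<Sum>i<N. Re (quad N (mfun A) (u i)) * (- log 2 (1 / real N)))"
    using N by (intro gibbs_spectral[OF ul l onb _ _ Wl]) auto
  also have "\<dots> = W * log 2 (real N)"
    using N by (simp add: quad_eigenvector[OF ul] sum_distrib_right[symmetric] Wl log_divide)
  finally show ?thesis by (simp add: vN_entropy_spectral[OF cA ul])
qed

text \<open>Joint convexity is applied to \<open>K\<close>, the tensor product of
  \<open>R \<omega>\<close> and \<open>\<phi> \<omega>\<close>, and to \<open>L\<close>, the
  identity tensored with \<open>mtrace (R \<omega>)\<close> times \<open>\<phi> \<omega>\<close>.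
  Since \<open>\<phi> \<omega>\<close> is pure, both are combinations of the product vectors
  \<open>\<xi>\<close>, and their relative entropy is minus the integrand here. The relative entropy
  of the averages is the difference of the two outer entropies.\<close>

lemma entropy_chain:
  fixes P :: "'a measure" and R \<phi> :: "'a \<Rightarrow> complex mat"
  assumes src: "pure_source P \<phi> d"
    and R: "\<And>\<omega>. \<omega> \<in> space P \<Longrightarrow> psd n (R \<omega>)" "\<And>\<omega>. \<omega> \<in> space P \<Longrightarrow> Re (mtrace (R \<omega>)) \<le> 1"
    and mR: "\<And>r s. r < n \<Longrightarrow> s < n \<Longrightarrow> (\<lambda>\<omega>. R \<omega> $$ (r, s)) \<in> borel_measurable P"
  shows "vN_entropy (mat d d (\<lambda>(i,k). \<integral>\<omega>. mtrace (R \<omega>) * \<phi> \<omega> $$ (i, k) \<partial>P))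
      + (\<integral>\<omega>. vN_entropy (R \<omega>) + Re (mtrace (R \<omega>)) * log 2 (Re (mtrace (R \<omega>))) \<partial>P)
    \<le> vN_entropy (mat (n * d) (n * d) (\<lambda>(i,k). \<integral>\<omega>. kron (R \<omega>) (\<phi> \<omega>) $$ (i, k) \<partial>P))"
proof -
  interpret prob_space P using src by (simp add: pure_source_def)
  have pure: "pure_state d (\<phi> \<omega>)" if "\<omega> \<in> space P" for \<omega> using src that by (simp add: pure_source_def)
  have m\<phi>: "(\<lambda>\<omega>. \<phi> \<omega> $$ (i, k)) \<in> borel_measurable P" if "i < d" "k < d" for i k
    using src that by (simp add: pure_source_def)
  have cR: "R \<omega> \<in> carrier_mat n n" if "\<omega> \<in> space P" for \<omega> using R(1)[OF that] by (simp add: psd_def)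
  have "\<forall>\<omega>\<in>space P. \<exists>v. (\<Sum>i<d. (cmod (v i))\<^sup>2) = 1 \<and> (\<forall>i<d. \<forall>k<d. \<phi> \<omega> $$ (i, k) = v i * cnj (v k)) \<and>
    \<phi> \<omega> \<in> carrier_mat d d" using pure_stateD[OF pure] by blast
  from bchoice[OF this] obtain v where v: "\<forall>\<omega>\<in>space P. (\<Sum>i<d. (cmod (v \<omega> i))\<^sup>2) = 1 \<and> 
    (\<forall>i<d. \<forall>k<d. \<phi> \<omega> $$ (i, k) = v \<omega> i * cnj (v \<omega> k)) \<and> \<phi> \<omega> \<in> carrier_mat d d" by blast
  have "\<forall>\<omega>\<in>space P. \<exists>yl. spectral n (mfun (R \<omega>)) (fst yl) (snd yl) \<and> (\<forall>i<n. 0 \<le> snd yl i)"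
  proof
    fix \<omega> assume "\<omega> \<in> space P"
    from psd_spectral[OF R(1)[OF this]] obtain y l where "spectral n (mfun (R \<omega>)) y l \<and> (\<forall>i<n. 0 \<le> l i)" by blast
    then show "\<exists>yl. spectral n (mfun (R \<omega>)) (fst yl) (snd yl) \<and> (\<forall>i<n. 0 \<le> snd yl i)"
      by (intro exI[of _ "(y, l)"]) simp
  qed
  from bchoice[OF this] obtain yl where yl: "\<forall>\<omega>\<in>space P. spectral n (mfun (R \<omega>)) (fst (yl \<omega>)) (snd (yl \<omega>)) \<and> (\<forall>i<n. 0 \<le> snd (yl \<omega>) i)" ..
  define y where "y \<omega> = fst (yl \<omega>)" for \<omega>
  define lam where "lam \<omega> = snd (yl \<omega>)" for \<omega>
  define w where "w \<omega> = Re (mtrace (R \<omega>))" for \<omega>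
  have v1: "(\<Sum>i<d. (cmod (v \<omega> i))\<^sup>2) = 1" and v2: "i < d \<Longrightarrow> k < d \<Longrightarrow> \<phi> \<omega> $$ (i, k) = v \<omega> i * cnj (v \<omega> k)"
    and c\<phi>: "\<phi> \<omega> \<in> carrier_mat d d" if "\<omega> \<in> space P" for \<omega> i k using v that by blast+
  have spR: "spectral n (mfun (R \<omega>)) (y \<omega>) (lam \<omega>)" and lam: "i < n \<Longrightarrow> 0 \<le> lam \<omega> i" if "\<omega> \<in> space P" for \<omega> i
    using yl that by (auto simp: y_def lam_def)
  have w_eq: "w \<omega> = (\<Sum>i<n. lam \<omega> i)" if "\<omega> \<in> space P" for \<omega>
    by (simp add: w_def mtrace_spectral[OF cR spR] that)
  have trR: "mtrace (R \<omega>) = of_real (w \<omega>)" if "\<omega> \<in> space P" for \<omega>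
    using psd_trace_real(1)[OF R(1)[OF that]] by (simp add: w_def)
  have w01: "0 \<le> w \<omega>" "w \<omega> \<le> 1" if "\<omega> \<in> space P" for \<omega>
    using psd_trace_real(2)[OF R(1)[OF that]] R(2)[OF that] by (auto simp: w_def)
  have mtr: "(\<lambda>\<omega>. mtrace (R \<omega>)) \<in> borel_measurable P"
  proof -
    have "(\<lambda>\<omega>. \<Sum>i<n. R \<omega> $$ (i, i)) \<in> borel_measurable P" using mR by (intro borel_measurable_sum) auto
    also have "?this \<longleftrightarrow> ?thesis" using cR by (intro measurable_cong) (auto simp: mtrace_def)
    finally show ?thesis .
  qed
  have mw: "w \<in> borel_measurable P" unfolding w_def using mtr by simp
  have intw: "integrable P w"
    using w01 by (intro integrable_const_bound[of _ 1] AE_I2 mw) auto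
  have \<phi>1: "cmod (\<phi> \<omega> $$ (i, k)) \<le> 1" if "\<omega> \<in> space P" "i < d" "k < d" for \<omega> i k
  proof -
    have "cmod (v \<omega> i) \<le> 1" if "i < d" for i
    proof -
      have "(cmod (v \<omega> i))\<^sup>2 \<le> (\<Sum>i<d. (cmod (v \<omega> i))\<^sup>2)" using that by (intro member_le_sum) auto
      then show ?thesis using v1[OF \<open>\<omega> \<in> space P\<close>] by (simp add: power_le_one_iff)
    qed
    then show ?thesis using that v2[OF that] by (simp add: norm_mult mult_le_one)
  qed
  have R1: "cmod (R \<omega> $$ (i, k)) \<le> 1" if "\<omega> \<in> space P" "i < n" "k < n" for \<omega> i k
    using psd_entry_bound[OF R(1)[OF that(1)] that(2,3)] R(2)[OF that(1)] by simp
  define K where "K \<omega> r s = kron (R \<omega>) (\<phi> \<omega>) $$ (r, s)" for \<omega> r s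
  \<comment> \<open>The identity on the first factor tensored with \<open>w \<omega>\<close> times
    \<open>\<phi> \<omega>\<close>; its average is the identity tensored with
    \<open>A2\<close>.\<close>
  define L where "L \<omega> r s = (if r div d = s div d then of_real (w \<omega>) * \<phi> \<omega> $$ (r mod d, s mod d) else 0)" for \<omega> r s
  define \<xi> where "\<xi> \<omega> m r = y \<omega> m (r div d) * v \<omega> (r mod d)" for \<omega> m r
  have K_eq: "K \<omega> r s = R \<omega> $$ (r div d, s div d) * \<phi> \<omega> $$ (r mod d, s mod d)" 
    if "\<omega> \<in> space P" "r < n * d" "s < n * d" for \<omega> r s
    unfolding K_def using kron_index[OF cR[OF that(1)] c\<phi>[OF that(1)] that(2,3)] .
  have intK: "integrable P (\<lambda>\<omega>. K \<omega> r s)" if "r < n * d" "s < n * d" for r s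
  proof (rule integrable_const_bound[of _ 1])
    show "AE \<omega> in P. norm (K \<omega> r s) \<le> 1"
      using that div_mod_less[OF that(1)] div_mod_less[OF that(2)]
      by (intro AE_I2) (simp add: K_eq norm_mult R1 \<phi>1 mult_le_one)
    have "(\<lambda>\<omega>. R \<omega> $$ (r div d, s div d) * \<phi> \<omega> $$ (r mod d, s mod d)) \<in> borel_measurable P"
      using div_mod_less[OF that(1)] div_mod_less[OF that(2)] by (intro borel_measurable_times mR m\<phi>)
    also have "?this \<longleftrightarrow> (\<lambda>\<omega>. K \<omega> r s) \<in> borel_measurable P"
      using that by (intro measurable_cong) (simp add: K_eq)
    finally show "(\<lambda>\<omega>. K \<omega> r s) \<in> borel_measurable P" .
  qed
  note mix = weighted_mixture[OF prob_space_axioms pure_state_density[OF pure] m\<phi> mw]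
  have intw\<phi>: "integrable P (\<lambda>\<omega>. of_real (w \<omega>) * \<phi> \<omega> $$ (i, k))" if "i < d" "k < d" for i k
    using that w01 by (intro mix(1)) auto
  have intL: "integrable P (\<lambda>\<omega>. L \<omega> r s)" if "r < n * d" "s < n * d" for r s
    unfolding L_def using intw\<phi>[OF div_mod_less(2)[OF that(1)] div_mod_less(2)[OF that(2)]]
    by (cases "r div d = s div d") simp_all
  define A12 where "A12 = mat (n * d) (n * d) (\<lambda>(i,k). \<integral>\<omega>. kron (R \<omega>) (\<phi> \<omega>) $$ (i, k) \<partial>P)"
  define A2 where "A2 = mat d d (\<lambda>(i,k). \<integral>\<omega>. mtrace (R \<omega>) * \<phi> \<omega> $$ (i, k) \<partial>P)"
  have c12: "A12 \<in> carrier_mat (n * d) (n * d)" "A2 \<in> carrier_mat d d" by (simp_all add: A12_def A2_def)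
  have psd12: "psd (n * d) A12"
    unfolding A12_def by (rule psd_integral) (use intK R pure in \<open>auto simp: K_def intro: psd_kron_pure\<close>)
  have A2_eq: "A2 $$ (i, k) = (\<integral>\<omega>. of_real (w \<omega>) * \<phi> \<omega> $$ (i, k) \<partial>P)" if "i < d" "k < d" for i k
    using that trR by (auto simp: A2_def intro!: Bochner_Integration.integral_cong)
  have psd2: "psd d A2"
  proof -
    have "A2 = mat d d (\<lambda>(i,k). \<integral>\<omega>. of_real (w \<omega>) * \<phi> \<omega> $$ (i, k) \<partial>P)"
      by (intro eq_matI) (auto simp: A2_def trR intro!: Bochner_Integration.integral_cong)
    moreover have "psd d (mat d d (\<lambda>(i,k). \<integral>\<omega>. of_real (w \<omega>) * \<phi> \<omega> $$ (i, k) \<partial>P))" using w01 by (intro mix(2)) auto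
    ultimately show ?thesis by simp
  qed
  obtain e p where ep: "spectral (n * d) (mfun A12) e p" and p: "\<And>i. i < n * d \<Longrightarrow> 0 \<le> p i"
    using psd_spectral[OF psd12] by blast
  obtain f s' where fs: "spectral d (mfun A2) f s'" and s': "\<And>i. i < d \<Longrightarrow> 0 \<le> s' i"
    using psd_spectral[OF psd2] by blast
  have onbf: "onb d f" using fs by (simp add: spectral_def)
  \<comment> \<open>An eigenbasis of the averaged \<open>L\<close>: standard basis vectors tensored
    with the eigenvectors of \<open>A2\<close>. The eigenvalue depends only on the second
    index.\<close>
  define g where "g b r = (if r div d = b div d then f (b mod d) (r mod d) else 0)" for b r
  define s where "s b = s' (b mod d)" for b
  have g_eq: "g (x * d + b) (x' * d + k) = (if x = x' then f b k else 0)" if "b < d" "k < d" for x b x' k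
    using that by (auto simp: g_def)
  have prod_delta: "(\<Sum>x'<n. (if x = x' then c else 0)) = c" if "x < n" for x and c :: complex
    using that by simp
  have expand: "(\<Sum>b<n*d. of_real (h (b mod d)) * g b r * cnj (g b q))
      = (if r div d = q div d then (\<Sum>b<d. of_real (h b) * f b (r mod d) * cnj (f b (q mod d))) else 0)"
    if "r < n * d" "q < n * d" for r q and h :: "nat \<Rightarrow> real"
  proof -
    have "(\<Sum>b<n*d. of_real (h (b mod d)) * g b r * cnj (g b q))
      = (\<Sum>x<n. \<Sum>b<d. if r div d = x then (if r div d = q div d then of_real (h b) * f b (r mod d) * cnj (f b (q mod d)) else 0) else 0)"
      unfolding sum_lessThan_mult by (intro sum.cong refl) (auto simp: g_def)
    also have "\<dots> = (\<Sum>b<d. \<Sum>x<n. if r div d = x then (if r div d = q div d then of_real (h b) * f b (r mod d) * cnj (f b (q mod d)) else 0) else 0)"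
      by (rule sum.swap)
    also have "\<dots> = (\<Sum>b<d. if r div d = q div d then of_real (h b) * f b (r mod d) * cnj (f b (q mod d)) else 0)"
      by (intro sum.cong refl prod_delta div_mod_less that)
    finally show ?thesis by simp
  qed
  have onbg: "onb (n * d) g"
    unfolding onb_def
  proof (intro conjI allI impI)
    fix b c assume bc: "b < n * d" "c < n * d"
    have "ip (n * d) (g b) (g c) = (\<Sum>x<n. \<Sum>k<d. if b div d = x then (if b div d = c div d then cnj (f (b mod d) k) * f (c mod d) k else 0) else 0)"
      unfolding ip_def sum_lessThan_mult by (intro sum.cong refl) (auto simp: g_def)
    also have "\<dots> = (\<Sum>k<d. \<Sum>x<n. if b div d = x then (if b div d = c div d then cnj (f (b mod d) k) * f (c mod d) k else 0) else 0)"
      by (rule sum.swap)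
    also have "\<dots> = (\<Sum>k<d. if b div d = c div d then cnj (f (b mod d) k) * f (c mod d) k else 0)"
      by (intro sum.cong refl prod_delta div_mod_less bc)
    also have "\<dots> = (if b div d = c div d then ip d (f (b mod d)) (f (c mod d)) else 0)" by (simp add: ip_def)
    also have "\<dots> = (if b = c then 1 else 0)"
      using div_mod_less(2)[OF bc(1)] div_mod_less(2)[OF bc(2)]
      by (auto simp: ip_onb_self[OF onbf]) (metis div_mult_mod_eq)
    finally show "ip (n * d) (g b) (g c) = (if b = c then 1 else 0)" .
  next
    fix r q assume rq: "r < n * d" "q < n * d"
    have "(\<Sum>b<n*d. g b r * cnj (g b q)) = (if r div d = q div d then (\<Sum>b<d. f b (r mod d) * cnj (f b (q mod d))) else 0)"
      using expand[OF rq, of "\<lambda>_. 1"] by simp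
    also have "\<dots> = (if r div d = q div d then (if r mod d = q mod d then 1 else 0) else 0)"
      using onbf div_mod_less(2)[OF rq(1)] div_mod_less(2)[OF rq(2)] by (simp add: onb_def)
    also have "\<dots> = (if r = q then 1 else 0)" by (auto) (metis div_mult_mod_eq)
    finally show "(\<Sum>b<n*d. g b r * cnj (g b q)) = (if r = q then 1 else 0)" .
  qed
  have \<sigma>: "spectral (n * d) (\<lambda>r q. \<integral>\<omega>. L \<omega> r q \<partial>P) g s"
    unfolding spectral_def
  proof (intro conjI onbg allI impI)
    fix r q assume rq: "r < n * d" "q < n * d"
    note rq' = div_mod_less[OF rq(1)] div_mod_less[OF rq(2)]
    have "(\<Sum>b<n*d. of_real (s b) * g b r * cnj (g b q)) = (if r div d = q div d then mfun A2 (r mod d) (q mod d) else 0)"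
      unfolding s_def expand[OF rq] using fs rq' by (simp add: spectral_def)
    then show "(\<integral>\<omega>. L \<omega> r q \<partial>P) = (\<Sum>b<n*d. of_real (s b) * g b r * cnj (g b q))"
      using rq' by (auto simp: L_def mfun_def A2_eq)
  qed
  have \<rho>: "spectral (n * d) (\<lambda>r q. \<integral>\<omega>. K \<omega> r q \<partial>P) e p"
    using ep by (simp add: spectral_def mfun_def A12_def K_def)
  \<comment> \<open>Tracing out the first factor of \<open>A12\<close> gives \<open>A2\<close>, here
    tested on an eigenvector of \<open>A2\<close>.\<close>
  have partial_trace: "(\<Sum>x<n. quad (n * d) (mfun A12) (g (x * d + b))) = of_real (s' b)" if b: "b < d" for b
  proof -
    have "quad (n * d) (mfun A12) (g (x * d + b)) = (\<Sum>i<d. \<Sum>k<d. cnj (f b i) * mfun A12 (x * d + i) (x * d + k) * f b k)" if x: "x < n" for x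
    proof -
      have "quad (n * d) (mfun A12) (g (x * d + b))
          = (\<Sum>x'<n. \<Sum>i<d. \<Sum>x''<n. \<Sum>k<d. (if x = x' then if x = x'' then cnj (f b i) * mfun A12 (x * d + i) (x * d + k) * f b k else 0 else 0))"
        unfolding quad_def sum_lessThan_mult by (intro sum.cong refl) (auto simp: g_eq b)
      also have "\<dots> = (\<Sum>i<d. \<Sum>x'<n. \<Sum>x''<n. \<Sum>k<d. (if x = x' then if x = x'' then cnj (f b i) * mfun A12 (x * d + i) (x * d + k) * f b k else 0 else 0))"
        by (rule sum.swap)
      also have "\<dots> = (\<Sum>i<d. \<Sum>x'<n. \<Sum>k<d. \<Sum>x''<n. (if x = x' then if x = x'' then cnj (f b i) * mfun A12 (x * d + i) (x * d + k) * f b k else 0 else 0))"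
        by (intro sum.cong refl sum.swap)
      also have "\<dots> = (\<Sum>i<d. \<Sum>k<d. \<Sum>x''<n. \<Sum>x'<n. (if x = x' then if x = x'' then cnj (f b i) * mfun A12 (x * d + i) (x * d + k) * f b k else 0 else 0))"
        by (rule sum.cong[OF refl], subst sum.swap, rule sum.cong[OF refl], rule sum.swap)
      also have "\<dots> = (\<Sum>i<d. \<Sum>k<d. \<Sum>x''<n. if x = x'' then cnj (f b i) * mfun A12 (x * d + i) (x * d + k) * f b k else 0)"
        by (intro sum.cong refl prod_delta x)
      also have "\<dots> = (\<Sum>i<d. \<Sum>k<d. cnj (f b i) * mfun A12 (x * d + i) (x * d + k) * f b k)"
        by (intro sum.cong refl prod_delta x)
      finally show ?thesis .
    qed
    then have "(\<Sum>x<n. quad (n * d) (mfun A12) (g (x * d + b)))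
        = (\<Sum>x<n. \<Sum>i<d. \<Sum>k<d. cnj (f b i) * mfun A12 (x * d + i) (x * d + k) * f b k)"
      by (intro sum.cong refl) simp
    also have "\<dots> = (\<Sum>i<d. \<Sum>k<d. \<Sum>x<n. cnj (f b i) * mfun A12 (x * d + i) (x * d + k) * f b k)"
      by (rule sum_rotate)
    also have "\<dots> = (\<Sum>i<d. \<Sum>k<d. cnj (f b i) * mfun A2 i k * f b k)"
    proof (intro sum.cong refl)
      fix i k assume "i \<in> {..<d}" "k \<in> {..<d}"
      then have ik: "i < d" "k < d" by auto
      have xi: "x * d + i < n * d" "x * d + k < n * d" if "x < n" for x using ik that by (auto intro: mult_add_less)
      have "(\<Sum>x<n. mfun A12 (x * d + i) (x * d + k)) = (\<Sum>x<n. \<integral>\<omega>. K \<omega> (x * d + i) (x * d + k) \<partial>P)"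
        using xi by (intro sum.cong) (auto simp: mfun_def A12_def K_def)
      also have "\<dots> = (\<integral>\<omega>. (\<Sum>x<n. K \<omega> (x * d + i) (x * d + k)) \<partial>P)"
        using intK xi by (intro Bochner_Integration.integral_sum[symmetric]) auto
      also have "\<dots> = (\<integral>\<omega>. mtrace (R \<omega>) * \<phi> \<omega> $$ (i, k) \<partial>P)"
      proof (rule Bochner_Integration.integral_cong[OF refl])
        fix \<omega> assume \<omega>: "\<omega> \<in> space P"
        have "(\<Sum>x<n. K \<omega> (x * d + i) (x * d + k)) = (\<Sum>x<n. R \<omega> $$ (x, x) * \<phi> \<omega> $$ (i, k))"
          using ik xi by (intro sum.cong) (auto simp: K_eq[OF \<omega>])
        then show "(\<Sum>x<n. K \<omega> (x * d + i) (x * d + k)) = mtrace (R \<omega>) * \<phi> \<omega> $$ (i, k)"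
          using cR[OF \<omega>] by (simp add: mtrace_def sum_distrib_right)
      qed
      also have "\<dots> = mfun A2 i k" using ik by (simp add: mfun_def A2_def)
      finally show "(\<Sum>x<n. cnj (f b i) * mfun A12 (x * d + i) (x * d + k) * f b k) = cnj (f b i) * mfun A2 i k * f b k"
        by (simp add: sum_distrib_left[symmetric] sum_distrib_right[symmetric])
    qed
    also have "\<dots> = quad d (mfun A2) (f b)" by (simp add: quad_def)
    also have "\<dots> = of_real (s' b)" by (rule quad_eigenvector[OF fs b])
    finally show ?thesis .
  qed
  define D where "D b = Re (quad (n * d) (mfun A12) (g b))" for b
  have D_eq: "D b = (\<Sum>a<n*d. p a * (cmod (ip (n * d) (g b) (e a)))\<^sup>2)" for b
  proof -
    have "cmod (ip (n * d) (g b) (e a)) = cmod (ip (n * d) (e a) (g b))" for a by (metis complex_mod_cnj ip_cnj)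
    then show ?thesis by (simp add: D_def quad_spectral[OF ep])
  qed
  have D_nonneg: "0 \<le> D b" for b unfolding D_eq using p by (auto intro!: sum_nonneg)
  have D_sum: "(\<Sum>x<n. D (x * d + b)) = s' b" if "b < d" for b
    using arg_cong[OF partial_trace[OF that], of Re] by (simp add: D_def)
  \<comment> \<open>A zero eigenvalue of \<open>A2\<close> is the sum of the nonnegative diagonal
    entries of \<open>A12\<close> lying over it, so each of them vanishes, and with it every term of
    \<open>D_eq\<close>.\<close>
  have supp: "p a * (cmod (ip (n * d) (g b) (e a)))\<^sup>2 = 0" if ab: "a < n * d" "b < n * d" and sb: "s b = 0" for a b
  proof -
    note b' = div_mod_less[OF ab(2)]
    have "D ((b div d) * d + b mod d) \<le> (\<Sum>x<n. D (x * d + b mod d))"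
      using b' D_nonneg by (intro member_le_sum) auto
    also have "\<dots> = 0" using D_sum[OF b'(2)] sb by (simp add: s_def)
    finally have "D b = 0" using D_nonneg[of b] by simp
    then show ?thesis
      unfolding D_eq using ab p by (subst (asm) sum_nonneg_eq_0_iff) auto
  qed
  have h_eq: "vN_entropy (R \<omega>) + w \<omega> * log 2 (w \<omega>) = - ((\<Sum>m<n. lam \<omega> m * ln (lam \<omega> m)) - w \<omega> * ln (w \<omega>)) / ln 2"
    if "\<omega> \<in> space P" for \<omega>
    unfolding vN_entropy_spectral[OF cR[OF that] spR[OF that]]
    by (simp add: log_def sum_divide_distrib diff_divide_distrib)
  have inth0: "integrable P (\<lambda>\<omega>. vN_entropy (R \<omega>) + w \<omega> * log 2 (w \<omega>))"
  proof (intro Bochner_Integration.integrable_add)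
    show "integrable P (\<lambda>\<omega>. vN_entropy (R \<omega>))"
      using vN_entropy_bounds[OF R] vN_entropy_measurable[OF R mR]
      by (intro integrable_const_bound[of _ "2 * real n"] AE_I2) auto
    have "\<bar>w \<omega> * log 2 (w \<omega>)\<bar> \<le> 2" if "\<omega> \<in> space P" for \<omega>
      using neg_x_log_x_bounds[OF w01[OF that]] by linarith
    then show "integrable P (\<lambda>\<omega>. w \<omega> * log 2 (w \<omega>))"
      using mw by (intro integrable_const_bound[of _ 2] AE_I2) auto
  qed
  have inth: "integrable P (\<lambda>\<omega>. (\<Sum>m<n. lam \<omega> m * ln (lam \<omega> m)) - w \<omega> * ln (w \<omega>))"
  proof -
    have "integrable P (\<lambda>\<omega>. - ln 2 * (vN_entropy (R \<omega>) + w \<omega> * log 2 (w \<omega>)))" using inth0 by (rule integrable_mult_right)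
    also have "?this \<longleftrightarrow> ?thesis" by (rule Bochner_Integration.integrable_cong[OF refl]) (simp add: h_eq)
    finally show ?thesis .
  qed
  have jc: "(\<Sum>a<n*d. p a * ln (p a)) - (\<Sum>a<n*d. \<Sum>b<n*d. p a * (cmod (ip (n*d) (g b) (e a)))\<^sup>2 * ln (s b))
    \<le> (\<integral>\<omega>. (\<Sum>m<n. lam \<omega> m * ln (lam \<omega> m)) - w \<omega> * ln (w \<omega>) \<partial>P)"
  proof (rule joint_convexity[where K = K and L = L and \<xi> = \<xi>])
    fix b assume "b < n * d"
    then show "0 \<le> s b" using s' div_mod_less(2) by (auto simp: s_def)
  next
    fix \<omega> r q assume \<omega>: "\<omega> \<in> space P" and rq: "r < n * d" "q < n * d"
    show "K \<omega> r q = (\<Sum>m<n. of_real (lam \<omega> m) * \<xi> \<omega> m r * cnj (\<xi> \<omega> m q))"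
      unfolding K_def \<xi>_def
      by (rule quad_product_decomp[OF cR[OF \<omega>] c\<phi>[OF \<omega>] spR[OF \<omega>] _ rq]) (rule v2[OF \<omega>])
    note rq' = div_mod_less[OF rq(1)] div_mod_less[OF rq(2)]
    have "(\<Sum>m<n. of_real (w \<omega>) * \<xi> \<omega> m r * cnj (\<xi> \<omega> m q))
        = of_real (w \<omega>) * (\<Sum>m<n. y \<omega> m (r div d) * cnj (y \<omega> m (q div d))) * (v \<omega> (r mod d) * cnj (v \<omega> (q mod d)))"
      by (simp add: \<xi>_def sum_distrib_left sum_distrib_right mult_ac)
    also have "(\<Sum>m<n. y \<omega> m (r div d) * cnj (y \<omega> m (q div d))) = (if r div d = q div d then 1 else 0)"
      using spR[OF \<omega>] rq' by (simp add: spectral_def onb_def)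
    finally show "L \<omega> r q = (\<Sum>m<n. of_real (w \<omega>) * \<xi> \<omega> m r * cnj (\<xi> \<omega> m q))"
      using v2[OF \<omega>] rq' by (simp add: L_def)
  next
    fix \<omega> m assume "\<omega> \<in> space P" "m < n"
    then show "(\<Sum>i<n*d. (cmod (\<xi> \<omega> m i))\<^sup>2) = 1"
      unfolding \<xi>_def using spR by (intro norm_product_vector v1 onb_norm[of n]) (auto simp: spectral_def)
  next
    have "of_real (\<integral>\<omega>. w \<omega> \<partial>P) = (\<integral>\<omega>. complex_of_real (w \<omega>) \<partial>P)" by simp
    also have "\<dots> = (\<integral>\<omega>. mtrace (kron (R \<omega>) (\<phi> \<omega>)) \<partial>P)"
      by (rule Bochner_Integration.integral_cong[OF refl]) (simp add: mtrace_kron_pure[OF cR pure] trR)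
    also have "\<dots> = (\<integral>\<omega>. (\<Sum>r<n*d. K \<omega> r r) \<partial>P)"
    proof (rule Bochner_Integration.integral_cong[OF refl])
      fix \<omega> assume \<omega>: "\<omega> \<in> space P"
      show "mtrace (kron (R \<omega>) (\<phi> \<omega>)) = (\<Sum>r<n*d. K \<omega> r r)"
        using carrier_matD[OF cR[OF \<omega>]] carrier_matD[OF c\<phi>[OF \<omega>]] by (simp add: mtrace_def K_def kron_def)
    qed
    also have "\<dots> = mtrace A12"
      using intK by (subst Bochner_Integration.integral_sum) (auto simp: mtrace_def A12_def K_def)
    also have "\<dots> = of_real (\<Sum>a<n*d. p a)" by (rule mtrace_spectral[OF c12(1) ep])
    finally show "(\<integral>\<omega>. w \<omega> \<partial>P) = (\<Sum>a<n*d. p a)" by (simp only: of_real_eq_iff)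
  qed (use intK intL \<rho> \<sigma> p supp lam w_eq intw inth in auto)
  also have "(\<integral>\<omega>. (\<Sum>m<n. lam \<omega> m * ln (lam \<omega> m)) - w \<omega> * ln (w \<omega>) \<partial>P)
      = (\<integral>\<omega>. - ln 2 * (vN_entropy (R \<omega>) + w \<omega> * log 2 (w \<omega>)) \<partial>P)"
    by (rule Bochner_Integration.integral_cong[OF refl]) (simp add: h_eq)
  also have "\<dots> = - ln 2 * (\<integral>\<omega>. vN_entropy (R \<omega>) + w \<omega> * log 2 (w \<omega>) \<partial>P)"
    by (rule integral_mult_right_zero)
  also have "(\<Sum>a<n*d. \<Sum>b<n*d. p a * (cmod (ip (n*d) (g b) (e a)))\<^sup>2 * ln (s b)) = (\<Sum>b<d. s' b * ln (s' b))"
  proof -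
    have "(\<Sum>a<n*d. \<Sum>b<n*d. p a * (cmod (ip (n*d) (g b) (e a)))\<^sup>2 * ln (s b)) = (\<Sum>b<n*d. D b * ln (s b))"
      unfolding D_eq sum_distrib_right by (rule sum.swap)
    also have "\<dots> = (\<Sum>x<n. \<Sum>b<d. D (x * d + b) * ln (s' b))"
      unfolding sum_lessThan_mult by (intro sum.cong refl) (simp add: s_def)
    also have "\<dots> = (\<Sum>b<d. (\<Sum>x<n. D (x * d + b)) * ln (s' b))"
      by (subst sum.swap) (simp add: sum_distrib_right)
    finally show ?thesis by (simp add: D_sum)
  qed
  finally have "((\<Sum>a<n*d. p a * ln (p a)) - (\<Sum>b<d. s' b * ln (s' b))) / ln 2
      \<le> (- ln 2 * (\<integral>\<omega>. vN_entropy (R \<omega>) + w \<omega> * log 2 (w \<omega>) \<partial>P)) / ln 2"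
    by (intro divide_right_mono) auto
  moreover have "vN_entropy A12 = - (\<Sum>a<n*d. p a * ln (p a)) / ln 2"
    unfolding vN_entropy_spectral[OF c12(1) ep] by (simp add: log_def sum_divide_distrib)
  moreover have "vN_entropy A2 = - (\<Sum>b<d. s' b * ln (s' b)) / ln 2"
    unfolding vN_entropy_spectral[OF c12(2) fs] by (simp add: log_def sum_divide_distrib)
  ultimately show ?thesis
    unfolding A12_def[symmetric] A2_def[symmetric] w_def[symmetric]
    by (simp add: diff_divide_distrib)
qed

section \<open>Single-letter kernels with a density\<close>

text \<open>The constant \<open>density\<close> for quantum states hides the measure-theoretic one.\<close>
abbreviation mdensity :: "'b measure \<Rightarrow> ('b \<Rightarrow> ennreal) \<Rightarrow> 'b measure" where
  "mdensity \<equiv> Nonnegative_Lebesgue_Integration.density"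

text \<open>Integrability of the logarithm makes the positive and negative parts in
  \<open>rel_entropy\<close> finite, so their difference is an ordinary integral.\<close>

lemma rel_entropy_density:
  fixes f :: "'b \<Rightarrow> real"
  assumes sf: "sigma_finite_measure \<nu>" and \<mu>: "\<mu> = mdensity \<nu> (\<lambda>x. ennreal (f x))"
    and f: "f \<in> borel_measurable \<nu>" "\<And>x. x \<in> space \<nu> \<Longrightarrow> 0 \<le> f x"
    and int: "integrable \<mu> (\<lambda>x. log 2 (f x))"
  shows "rel_entropy \<mu> \<nu> = ereal (\<integral>x. log 2 (f x) \<partial>\<mu>)"
proof -
  interpret sigma_finite_measure \<nu> by fact
  note [measurable] = f(1)
  have ac: "absolutely_continuous \<nu> \<mu>" unfolding \<mu> by (rule absolutely_continuousI_density) simp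
  have "AE x in \<nu>. ennreal (f x) = RN_deriv \<nu> \<mu> x"
    by (rule RN_deriv_unique[OF _ \<mu>[symmetric]]) simp
  then have ae\<nu>: "AE x in \<nu>. enn2real (RN_deriv \<nu> \<mu> x) = f x"
    using AE_space by eventually_elim (metis enn2real_ennreal f(2))
  have ae: "AE x in \<mu>. enn2real (RN_deriv \<nu> \<mu> x) = f x"
    by (rule absolutely_continuous_AE[OF _ ac ae\<nu>]) (simp add: \<mu>)
  have max: "ennreal (max 0 y) = ennreal y" for y by (cases "y \<ge> 0") (auto simp: max_def ennreal_neg)
  have "(\<integral>\<^sup>+x. ennreal (max 0 (log 2 (enn2real (RN_deriv \<nu> \<mu> x)))) \<partial>\<mu>) = (\<integral>\<^sup>+x. ennreal (log 2 (f x)) \<partial>\<mu>)"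
    by (rule nn_integral_cong_AE, use ae in eventually_elim) (simp only: max)
  moreover have "(\<integral>\<^sup>+x. ennreal (max 0 (- log 2 (enn2real (RN_deriv \<nu> \<mu> x)))) \<partial>\<mu>) = (\<integral>\<^sup>+x. ennreal (- log 2 (f x)) \<partial>\<mu>)"
    by (rule nn_integral_cong_AE, use ae in eventually_elim) (simp only: max)
  moreover have fin: "(\<integral>\<^sup>+x. ennreal (log 2 (f x)) \<partial>\<mu>) \<noteq> \<infinity>" "(\<integral>\<^sup>+x. ennreal (- log 2 (f x)) \<partial>\<mu>) \<noteq> \<infinity>"
    using int unfolding real_integrable_def by auto
  moreover have "enn2ereal a - enn2ereal b = ereal (enn2real a - enn2real b)" if "a \<noteq> \<infinity>" "b \<noteq> \<infinity>" for a b
    using that by (cases a; cases b) auto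
  ultimately show ?thesis
    using ac unfolding rel_entropy_def real_lebesgue_integral_def[OF int] by (simp add: \<mu>)
qed

text \<open>A density against a fixed measure yields the joint law, the marginal and the Bayesian
  inverse in closed form, on any source space. As \<open>h\<close> is at most 1,
  \<open>h * log 2 h\<close> is bounded, so the information splits into two finite integrals. The
  objective is the mean of \<open>m\<close> times a normalised entropy, rewritten without
  division.\<close>

lemma M_quantity_le_density:
  fixes P :: "'a measure" and N :: "((nat \<Rightarrow> real) \<times> (nat \<Rightarrow> 'a)) measure"
    and h :: "'a \<Rightarrow> (nat \<Rightarrow> real) \<times> (nat \<Rightarrow> 'a) \<Rightarrow> real"
  assumes src: "pure_source P \<phi> d" and finN: "finite_measure N"
    and mh: "(\<lambda>(\<omega>, x). h \<omega> x) \<in> borel_measurable (P \<Otimes>\<^sub>M N)"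
    and h01: "\<And>\<omega> x. \<omega> \<in> space P \<Longrightarrow> x \<in> space N \<Longrightarrow> 0 \<le> h \<omega> x \<and> h \<omega> x \<le> 1"
    and h1: "\<And>\<omega>. \<omega> \<in> space P \<Longrightarrow> (\<integral>x. h \<omega> x \<partial>N) = 1"
    and m: "\<And>x. m x = (\<integral>\<omega>. h \<omega> x \<partial>P)"
    and rate: "(\<integral>\<omega>. \<integral>x. h \<omega> x * log 2 (h \<omega> x) \<partial>N \<partial>P) - (\<integral>x. m x * log 2 (m x) \<partial>N) \<le> R"
  shows "M_quantity P \<phi> d R \<le> ereal (\<integral>x. vN_entropy (mat d d (\<lambda>(i,k). \<integral>\<omega>. of_real (h \<omega> x) * \<phi> \<omega> $$ (i, k) \<partial>P))
      + m x * log 2 (m x) \<partial>N)"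
proof -
  interpret P: prob_space P using src by (simp add: pure_source_def)
  interpret N: finite_measure N by fact
  interpret PN: pair_sigma_finite P N ..
  interpret NP: pair_sigma_finite N P ..
  interpret PNf: finite_measure "P \<Otimes>\<^sub>M N"
    by (rule finite_measure_pair_measure) (simp_all add: P.finite_measure_axioms finN)
  have mh'[measurable]: "(\<lambda>z. h (fst z) (snd z)) \<in> borel_measurable (P \<Otimes>\<^sub>M N)"
    using mh by (simp add: case_prod_unfold)
  have mh1[measurable]: "(\<lambda>x. h \<omega> x) \<in> borel_measurable N" if "\<omega> \<in> space P" for \<omega>
    using measurable_compose[OF measurable_Pair1'[OF that] mh'] by simp
  have mh2[measurable]: "(\<lambda>\<omega>. h \<omega> x) \<in> borel_measurable P" if "x \<in> space N" for x
    using measurable_compose[OF measurable_Pair2'[OF that] mh'] by simp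
  have mhs[measurable]: "(\<lambda>z. h (snd z) (fst z)) \<in> borel_measurable (N \<Otimes>\<^sub>M P)"
    using measurable_compose[OF measurable_pair_swap' mh'] by (simp add: case_prod_unfold)
  have mm[measurable]: "m \<in> borel_measurable N"
    unfolding m[abs_def] by (rule P.borel_measurable_lebesgue_integral) (simp add: case_prod_unfold)
  have inth2: "integrable P (\<lambda>\<omega>. h \<omega> x)" if "x \<in> space N" for x
    using h01 that by (intro P.integrable_const_bound[of _ 1] AE_I2) auto
  have inth1: "integrable N (\<lambda>x. h \<omega> x)" if "\<omega> \<in> space P" for \<omega>
    using h01 that by (intro N.integrable_const_bound[of _ 1] AE_I2) auto
  have nnm: "(\<integral>\<^sup>+\<omega>. ennreal (h \<omega> x) \<partial>P) = ennreal (m x)" if "x \<in> space N" for x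
    unfolding m using that h01 by (intro nn_integral_eq_integral inth2 AE_I2) auto
  have nn1: "(\<integral>\<^sup>+x. ennreal (h \<omega> x) \<partial>N) = 1" if "\<omega> \<in> space P" for \<omega>
    using nn_integral_eq_integral[OF inth1[OF that]] h1[OF that] h01 that by simp
  have m01: "0 \<le> m x" "m x \<le> 1" if x: "x \<in> space N" for x
  proof -
    show "0 \<le> m x" unfolding m using h01 x by (intro Bochner_Integration.integral_nonneg) auto
    have "m x \<le> (\<integral>\<omega>. 1 \<partial>P)" unfolding m using h01 x inth2 by (intro integral_mono) auto
    then show "m x \<le> 1" by (simp add: P.prob_space)
  qed
  define p where "p \<omega> = mdensity N (\<lambda>x. ennreal (h \<omega> x))" for \<omega>
  \<comment> \<open>Where \<open>m\<close> vanishes the choice of \<open>P\<close> is arbitrary: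
    this set is null for the marginal, but a kernel needs a probability measure everywhere.\<close>
  define r where "r x = (if m x > 0 then mdensity P (\<lambda>\<omega>. ennreal (h \<omega> x / m x)) else P)" for x
  have ps_p: "prob_space (p \<omega>)" if "\<omega> \<in> space P" for \<omega>
    using nn1[OF that] that by (intro prob_spaceI) (simp add: p_def emeasure_density)
  have mp: "p \<in> measurable P (prob_algebra N)"
  proof (intro measurable_prob_algebraI measurable_subprob_algebra ps_p)
    show "subprob_space (p \<omega>)" if "\<omega> \<in> space P" for \<omega> using ps_p[OF that] by (rule prob_space_imp_subprob_space)
    show "sets (p \<omega>) = sets N" for \<omega> by (simp add: p_def)
    fix A assume A[measurable]: "A \<in> sets N"
    have "(\<lambda>\<omega>. \<integral>\<^sup>+x. ennreal (h \<omega> x) * indicator A x \<partial>N) \<in> borel_measurable P"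
      by (rule N.borel_measurable_nn_integral) (simp add: case_prod_unfold)
    also have "?this \<longleftrightarrow> (\<lambda>\<omega>. emeasure (p \<omega>) A) \<in> borel_measurable P"
      by (intro measurable_cong) (simp add: p_def emeasure_density A)
    finally show "(\<lambda>\<omega>. emeasure (p \<omega>) A) \<in> borel_measurable P" .
  qed
  have ps_r: "prob_space (r x)" if "x \<in> space N" for x
  proof (cases "m x > 0")
    case True
    have "(\<integral>\<^sup>+\<omega>. ennreal (h \<omega> x / m x) \<partial>P) = (\<integral>\<^sup>+\<omega>. ennreal (h \<omega> x) * ennreal (1 / m x) \<partial>P)"
      using True h01 that by (intro nn_integral_cong) (simp add: ennreal_mult[symmetric])
    also have "\<dots> = ennreal (m x) * ennreal (1 / m x)"
      using that by (subst nn_integral_multc) (auto simp: nnm)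
    also have "\<dots> = 1" using True by (simp add: ennreal_mult[symmetric])
    finally show ?thesis using True that by (intro prob_spaceI) (simp add: r_def emeasure_density)
  qed (simp add: r_def P.prob_space_axioms)
  have mr: "r \<in> measurable N (prob_algebra P)"
  proof (intro measurable_prob_algebraI measurable_subprob_algebra ps_r)
    show "subprob_space (r x)" if "x \<in> space N" for x using ps_r[OF that] by (rule prob_space_imp_subprob_space)
    show "sets (r x) = sets P" for x by (simp add: r_def)
    fix A assume A[measurable]: "A \<in> sets P"
    have "(\<lambda>x. if m x > 0 then \<integral>\<^sup>+\<omega>. ennreal (h \<omega> x / m x) * indicator A \<omega> \<partial>P else emeasure P A) \<in> borel_measurable N"
      by (intro measurable_If P.borel_measurable_nn_integral) (simp_all add: case_prod_unfold)
    also have "?this \<longleftrightarrow> (\<lambda>x. emeasure (r x) A) \<in> borel_measurable N"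
      by (intro measurable_cong) (simp add: r_def emeasure_density A)
    finally show "(\<lambda>x. emeasure (r x) A) \<in> borel_measurable N" .
  qed
  define \<mu> where "\<mu> = mdensity (P \<Otimes>\<^sub>M N) (\<lambda>z. ennreal (h (fst z) (snd z)))"
  have joint: "joint_measure P p N = \<mu>"
  proof -
    have "joint_measure P p N = measure_of (space (P \<Otimes>\<^sub>M N)) (sets (P \<Otimes>\<^sub>M N)) (emeasure \<mu>)"
      unfolding joint_measure_def space_pair_measure[symmetric]
    proof (rule measure_of_eq[OF sets.space_closed])
      fix A assume "A \<in> sigma_sets (space (P \<Otimes>\<^sub>M N)) (sets (P \<Otimes>\<^sub>M N))"
      then have A[measurable]: "A \<in> sets (P \<Otimes>\<^sub>M N)" by (simp add: sets.sigma_sets_eq)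
      have "emeasure \<mu> A = (\<integral>\<^sup>+z. ennreal (h (fst z) (snd z)) * indicator A z \<partial>(P \<Otimes>\<^sub>M N))"
        by (simp add: \<mu>_def emeasure_density)
      also have "\<dots> = (\<integral>\<^sup>+\<omega>. \<integral>\<^sup>+x. ennreal (h \<omega> x) * indicator A (\<omega>, x) \<partial>N \<partial>P)"
        by (subst N.nn_integral_fst[symmetric]) auto
      also have "\<dots> = (\<integral>\<^sup>+\<omega>. emeasure (p \<omega>) (Pair \<omega> -` A) \<partial>P)"
      proof (rule nn_integral_cong)
        fix \<omega> assume \<omega>: "\<omega> \<in> space P"
        have "(\<integral>\<^sup>+x. ennreal (h \<omega> x) * indicator A (\<omega>, x) \<partial>N) = (\<integral>\<^sup>+x. ennreal (h \<omega> x) * indicator (Pair \<omega> -` A) x \<partial>N)"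
          by (intro nn_integral_cong) (simp add: indicator_def)
        also have "\<dots> = emeasure (p \<omega>) (Pair \<omega> -` A)"
          using sets_Pair1[OF A, of \<omega>] \<omega> by (simp add: p_def emeasure_density)
        finally show "(\<integral>\<^sup>+x. ennreal (h \<omega> x) * indicator A (\<omega>, x) \<partial>N) = emeasure (p \<omega>) (Pair \<omega> -` A)" .
      qed
      finally show "(\<integral>\<^sup>+\<omega>. emeasure (p \<omega>) (Pair \<omega> -` A) \<partial>P) = emeasure \<mu> A" ..
    qed
    also have "\<dots> = \<mu>" using measure_of_of_measure[of \<mu>] by (simp add: \<mu>_def)
    finally show ?thesis .
  qed
  have marg: "marginal_C P p N = mdensity N (\<lambda>x. ennreal (m x))"
    unfolding marginal_C_def joint
  proof (rule measure_eqI)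
    fix G assume "G \<in> sets (distr \<mu> N snd)"
    then have G[measurable]: "G \<in> sets N" by simp
    have "emeasure (distr \<mu> N snd) G = emeasure \<mu> (snd -` G \<inter> space (P \<Otimes>\<^sub>M N))"
      by (subst emeasure_distr) (simp_all add: \<mu>_def)
    also have "\<dots> = (\<integral>\<^sup>+z. ennreal (h (fst z) (snd z)) * indicator G (snd z) \<partial>(P \<Otimes>\<^sub>M N))"
      unfolding \<mu>_def by (subst emeasure_density) (auto intro!: nn_integral_cong simp: indicator_def)
    also have "\<dots> = (\<integral>\<^sup>+x. \<integral>\<^sup>+\<omega>. ennreal (h \<omega> x) * indicator G x \<partial>P \<partial>N)"
      by (subst PN.nn_integral_snd[symmetric]) auto
    also have "\<dots> = (\<integral>\<^sup>+x. ennreal (m x) * indicator G x \<partial>N)"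
      by (intro nn_integral_cong) (simp add: nn_integral_multc nnm)
    finally show "emeasure (distr \<mu> N snd) G = emeasure (mdensity N (\<lambda>x. ennreal (m x))) G"
      by (simp add: emeasure_density)
  qed simp
  have h0: "AE \<omega> in P. h \<omega> x = 0" if x: "x \<in> space N" and mx: "m x = 0" for x
  proof -
    have "(\<integral>\<^sup>+\<omega>. ennreal (h \<omega> x) \<partial>P) = 0" using nnm[OF x] mx by simp
    then have "AE \<omega> in P. ennreal (h \<omega> x) = 0" using x by (subst (asm) nn_integral_0_iff_AE) auto
    then show ?thesis using AE_space by eventually_elim (use h01 x in fastforce)
  qed
  have bayes: "bayes_inverse P p N r"
    unfolding bayes_inverse_def
  proof (intro conjI mr ballI)
    fix F G assume F[measurable]: "F \<in> sets P" and G[measurable]: "G \<in> sets N"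
    have mrF[measurable]: "(\<lambda>x. emeasure (r x) F) \<in> borel_measurable N"
      using measurable_compose[OF measurable_prob_algebraD[OF mr] measurable_emeasure_subprob_algebra[OF F]] by simp
    have "emeasure (joint_measure P p N) (F \<times> G)
        = (\<integral>\<^sup>+z. ennreal (h (fst z) (snd z)) * indicator (F \<times> G) z \<partial>(P \<Otimes>\<^sub>M N))"
      by (simp add: joint \<mu>_def emeasure_density)
    also have "\<dots> = (\<integral>\<^sup>+x. \<integral>\<^sup>+\<omega>. ennreal (h \<omega> x) * indicator (F \<times> G) (\<omega>, x) \<partial>P \<partial>N)"
      by (subst PN.nn_integral_snd[symmetric]) auto
    also have "\<dots> = (\<integral>\<^sup>+x. ennreal (m x) * (emeasure (r x) F * indicator G x) \<partial>N)"
    proof (rule nn_integral_cong)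
      fix x assume x: "x \<in> space N"
      have "(\<integral>\<^sup>+\<omega>. ennreal (h \<omega> x) * indicator F \<omega> \<partial>P) = ennreal (m x) * emeasure (r x) F"
      proof (cases "m x > 0")
        case True
        have "ennreal (m x) * emeasure (r x) F = (\<integral>\<^sup>+\<omega>. ennreal (m x) * (ennreal (h \<omega> x / m x) * indicator F \<omega>) \<partial>P)"
          using True x by (simp add: r_def emeasure_density nn_integral_cmult)
        also have "\<dots> = (\<integral>\<^sup>+\<omega>. ennreal (h \<omega> x) * indicator F \<omega> \<partial>P)"
        proof (rule nn_integral_cong)
          fix \<omega> assume "\<omega> \<in> space P"
          then have "ennreal (m x) * ennreal (h \<omega> x / m x) = ennreal (h \<omega> x)"
            using True h01 x by (subst ennreal_mult[symmetric]) auto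
          then show "ennreal (m x) * (ennreal (h \<omega> x / m x) * indicator F \<omega>) = ennreal (h \<omega> x) * indicator F \<omega>"
            by (simp add: mult.assoc[symmetric])
        qed
        finally show ?thesis ..
      next
        case False
        then have mx: "m x = 0" using m01(1)[OF x] by simp
        have "(\<integral>\<^sup>+\<omega>. ennreal (h \<omega> x) * indicator F \<omega> \<partial>P) = (\<integral>\<^sup>+\<omega>. 0 \<partial>P)"
          by (rule nn_integral_cong_AE, use h0[OF x mx] in eventually_elim) simp
        then show ?thesis using mx by simp
      qed
      moreover have "(\<integral>\<^sup>+\<omega>. ennreal (h \<omega> x) * indicator (F \<times> G) (\<omega>, x) \<partial>P)
          = (\<integral>\<^sup>+\<omega>. (ennreal (h \<omega> x) * indicator F \<omega>) * indicator G x \<partial>P)"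
        by (intro nn_integral_cong) (simp add: indicator_def)
      moreover have "\<dots> = (\<integral>\<^sup>+\<omega>. ennreal (h \<omega> x) * indicator F \<omega> \<partial>P) * indicator G x"
        by (rule nn_integral_multc) (use x in simp)
      ultimately show "(\<integral>\<^sup>+\<omega>. ennreal (h \<omega> x) * indicator (F \<times> G) (\<omega>, x) \<partial>P) = ennreal (m x) * (emeasure (r x) F * indicator G x)"
        by (simp only: mult.assoc)
    qed
    also have "\<dots> = (\<integral>\<^sup>+j\<in>G. emeasure (r j) F \<partial>(marginal_C P p N))"
      unfolding marg by (subst nn_integral_density) auto
    finally show "emeasure (joint_measure P p N) (F \<times> G) = (\<integral>\<^sup>+j\<in>G. emeasure (r j) F \<partial>(marginal_C P p N))" .
  qed
  \<comment> \<open>The density of the joint law with respect to the product of its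
    marginals.\<close>
  define \<rho> where "\<rho> z = (if m (snd z) > 0 then h (fst z) (snd z) / m (snd z) else 0)" for z
  have m\<rho>[measurable]: "\<rho> \<in> borel_measurable (P \<Otimes>\<^sub>M N)" unfolding \<rho>_def by simp
  have aePN: "AE z in P \<Otimes>\<^sub>M N. m (snd z) = 0 \<longrightarrow> h (fst z) (snd z) = 0"
  proof -
    have "AE x in N. AE \<omega> in P. m x = 0 \<longrightarrow> h \<omega> x = 0"
    proof (rule AE_I2)
      fix x assume "x \<in> space N"
      then show "AE \<omega> in P. m x = 0 \<longrightarrow> h \<omega> x = 0" using h0[of x] by (cases "m x = 0") auto
    qed
    then have "AE z in N \<Otimes>\<^sub>M P. m (fst z) = 0 \<longrightarrow> h (snd z) (fst z) = 0"
      by (intro NP.AE_pair_measure) auto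
    then show ?thesis
      by (subst PN.distr_pair_swap) (subst AE_distr_iff, auto simp: case_prod_unfold)
  qed
  have mulr: "m (snd z) * \<rho> z = h (fst z) (snd z)" if "m (snd z) = 0 \<longrightarrow> h (fst z) (snd z) = 0" "z \<in> space (P \<Otimes>\<^sub>M N)" for z
    using that m01(1)[of "snd z"] by (auto simp: \<rho>_def space_pair_measure)
  have fin_marg: "finite_measure (mdensity N (\<lambda>x. ennreal (m x)))"
  proof (rule finite_measureI)
    have "emeasure (mdensity N (\<lambda>x. ennreal (m x))) (space N) = (\<integral>\<^sup>+x. ennreal (m x) * indicator (space N) x \<partial>N)"
      by (simp add: emeasure_density)
    also have "\<dots> \<le> (\<integral>\<^sup>+x. 1 \<partial>N)"
    proof (rule nn_integral_mono)
      fix x assume "x \<in> space N"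
      then show "ennreal (m x) * indicator (space N) x \<le> 1" using ennreal_leI[OF m01(2)[of x]] by simp
    qed
    finally have "emeasure (mdensity N (\<lambda>x. ennreal (m x))) (space N) \<le> emeasure N (space N)" by simp
    then show "emeasure (mdensity N (\<lambda>x. ennreal (m x))) (space (mdensity N (\<lambda>x. ennreal (m x)))) \<noteq> \<infinity>"
      using N.emeasure_finite[of "space N"] by (auto simp: top_unique)
  qed
  have prod_eq: "P \<Otimes>\<^sub>M marginal_C P p N = mdensity (P \<Otimes>\<^sub>M N) (\<lambda>z. ennreal (m (snd z)))"
  proof -
    have "mdensity P (\<lambda>_. 1) \<Otimes>\<^sub>M mdensity N (\<lambda>x. ennreal (m x)) = mdensity (P \<Otimes>\<^sub>M N) (\<lambda>(x, y). 1 * ennreal (m y))"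
      by (intro pair_measure_density N.sigma_finite_measure_axioms finite_measure.sigma_finite_measure fin_marg) auto
    then show ?thesis by (simp add: marg density_1 case_prod_unfold)
  qed
  have sf: "sigma_finite_measure (P \<Otimes>\<^sub>M marginal_C P p N)"
    unfolding marg by (intro finite_measure.sigma_finite_measure finite_measure_pair_measure P.finite_measure_axioms fin_marg)
  have \<mu>_eq: "\<mu> = mdensity (P \<Otimes>\<^sub>M marginal_C P p N) (\<lambda>z. ennreal (\<rho> z))"
  proof -
    have "mdensity (P \<Otimes>\<^sub>M marginal_C P p N) (\<lambda>z. ennreal (\<rho> z))
        = mdensity (P \<Otimes>\<^sub>M N) (\<lambda>z. ennreal (m (snd z)) * ennreal (\<rho> z))"
      unfolding prod_eq by (rule density_density_eq) auto
    also have "\<dots> = \<mu>" unfolding \<mu>_def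
    proof (rule density_cong)
      show "AE z in P \<Otimes>\<^sub>M N. ennreal (m (snd z)) * ennreal (\<rho> z) = ennreal (h (fst z) (snd z))"
        using aePN AE_space
      proof eventually_elim
        case (elim z)
        then have "0 \<le> m (snd z)" by (auto simp: space_pair_measure m01)
        then have "ennreal (m (snd z)) * ennreal (\<rho> z) = ennreal (m (snd z) * \<rho> z)" by (simp add: ennreal_mult')
        then show ?case using mulr[OF elim] by simp
      qed
    qed auto
    finally show ?thesis ..
  qed
  have hlog: "\<bar>h \<omega> x * log 2 (h \<omega> x)\<bar> \<le> 2" if "\<omega> \<in> space P" "x \<in> space N" for \<omega> x
    using neg_x_log_x_bounds[of "h \<omega> x"] h01[OF that] by linarith
  have mlog: "\<bar>m x * log 2 (m x)\<bar> \<le> 2" if "x \<in> space N" for x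
    using neg_x_log_x_bounds[OF m01[OF that]] by linarith
  have int1: "integrable (P \<Otimes>\<^sub>M N) (\<lambda>z. h (fst z) (snd z) * log 2 (h (fst z) (snd z)))"
    using hlog by (intro PNf.integrable_const_bound[of _ 2] AE_I2) (auto simp: space_pair_measure)
  \<comment> \<open>\<open>log 2 (m x)\<close> is unbounded. Integrating over the source first
    replaces \<open>h\<close> by \<open>m\<close>, and \<open>m * log 2 m\<close> is
    bounded.\<close>
  have int2: "integrable (P \<Otimes>\<^sub>M N) (\<lambda>z. h (fst z) (snd z) * log 2 (m (snd z)))"
  proof (rule integrableI_bounded)
    have "(\<integral>\<^sup>+z. ennreal (norm (h (fst z) (snd z) * log 2 (m (snd z)))) \<partial>(P \<Otimes>\<^sub>M N))
        = (\<integral>\<^sup>+x. \<integral>\<^sup>+\<omega>. ennreal (h \<omega> x) * ennreal \<bar>log 2 (m x)\<bar> \<partial>P \<partial>N)"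
      by (subst PN.nn_integral_snd[symmetric]) (auto intro!: nn_integral_cong simp: abs_mult ennreal_mult[symmetric] h01)
    also have "\<dots> = (\<integral>\<^sup>+x. ennreal (m x) * ennreal \<bar>log 2 (m x)\<bar> \<partial>N)"
      by (intro nn_integral_cong) (simp add: nn_integral_multc nnm)
    also have "\<dots> \<le> (\<integral>\<^sup>+x. 2 \<partial>N)"
    proof (rule nn_integral_mono)
      fix x assume x: "x \<in> space N"
      have "ennreal (m x) * ennreal \<bar>log 2 (m x)\<bar> = ennreal (\<bar>m x * log 2 (m x)\<bar>)"
        using m01[OF x] by (simp add: ennreal_mult[symmetric] abs_mult)
      also have "\<dots> \<le> ennreal 2" using mlog[OF x] by (rule ennreal_leI)
      finally show "ennreal (m x) * ennreal \<bar>log 2 (m x)\<bar> \<le> 2" by simp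
    qed
    also have "\<dots> < \<infinity>" using N.emeasure_finite[of "space N"] by (simp add: ennreal_mult_less_top less_top[symmetric] ennreal_mult_eq_top_iff)
    finally show "(\<integral>\<^sup>+z. ennreal (norm (h (fst z) (snd z) * log 2 (m (snd z)))) \<partial>(P \<Otimes>\<^sub>M N)) < \<infinity>" .
  qed simp
  have Feq: "AE z in P \<Otimes>\<^sub>M N. h (fst z) (snd z) * log 2 (h (fst z) (snd z)) - h (fst z) (snd z) * log 2 (m (snd z))
      = h (fst z) (snd z) * log 2 (\<rho> z)"
    using aePN AE_space
  proof eventually_elim
    case (elim z)
    then have "0 \<le> m (snd z)" "0 \<le> h (fst z) (snd z)" using h01 m01 by (auto simp: space_pair_measure)
    then show ?case using elim(1)
      by (cases "h (fst z) (snd z) = 0"; cases "m (snd z) = 0") (auto simp: \<rho>_def log_divide algebra_simps)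
  qed
  have int3: "integrable (P \<Otimes>\<^sub>M N) (\<lambda>z. h (fst z) (snd z) * log 2 (\<rho> z))"
    by (rule Bochner_Integration.integrable_cong_AE_imp[OF Bochner_Integration.integrable_diff[OF int1 int2] _ Feq]) simp
  have "integrable \<mu> (\<lambda>z. log 2 (\<rho> z))"
    unfolding \<mu>_def using int3 h01
    by (subst integrable_density) (auto simp: space_pair_measure intro!: AE_I2)
  then have "mutual_AC P p N = ereal (\<integral>z. log 2 (\<rho> z) \<partial>\<mu>)"
    unfolding mutual_AC_def joint
    by (intro rel_entropy_density sf \<mu>_eq) (auto simp: prod_eq \<rho>_def space_pair_measure h01 m01)
  also have "(\<integral>z. log 2 (\<rho> z) \<partial>\<mu>) = (\<integral>z. h (fst z) (snd z) * log 2 (\<rho> z) \<partial>(P \<Otimes>\<^sub>M N))"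
    unfolding \<mu>_def using h01 by (subst integral_density) (auto simp: space_pair_measure intro!: AE_I2)
  also have "\<dots> = (\<integral>z. h (fst z) (snd z) * log 2 (h (fst z) (snd z)) - h (fst z) (snd z) * log 2 (m (snd z)) \<partial>(P \<Otimes>\<^sub>M N))"
    using Feq by (intro integral_cong_AE) auto
  also have "\<dots> = (\<integral>z. h (fst z) (snd z) * log 2 (h (fst z) (snd z)) \<partial>(P \<Otimes>\<^sub>M N)) - (\<integral>z. h (fst z) (snd z) * log 2 (m (snd z)) \<partial>(P \<Otimes>\<^sub>M N))"
    by (rule Bochner_Integration.integral_diff[OF int1 int2])
  also have "(\<integral>z. h (fst z) (snd z) * log 2 (h (fst z) (snd z)) \<partial>(P \<Otimes>\<^sub>M N)) = (\<integral>\<omega>. \<integral>x. h \<omega> x * log 2 (h \<omega> x) \<partial>N \<partial>P)"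
    using PN.integral_fst'[OF int1] by simp
  also have "(\<integral>z. h (fst z) (snd z) * log 2 (m (snd z)) \<partial>(P \<Otimes>\<^sub>M N)) = (\<integral>x. m x * log 2 (m x) \<partial>N)"
    using PN.integral_snd[of "\<lambda>\<omega> x. h \<omega> x * log 2 (m x)"] int2 by (simp add: case_prod_unfold m)
  finally have mutual: "mutual_AC P p N \<le> ereal R" using rate by simp
  define \<sigma> where "\<sigma> x = mat d d (\<lambda>(i,k). \<integral>\<omega>. of_real (h \<omega> x) * \<phi> \<omega> $$ (i, k) \<partial>P)" for x
  have m\<phi>: "(\<lambda>\<omega>. \<phi> \<omega> $$ (i, k)) \<in> borel_measurable P" if "i < d" "k < d" for i k
    using src that by (simp add: pure_source_def)
  have pure: "pure_state d (\<phi> \<omega>)" if "\<omega> \<in> space P" for \<omega> using src that by (simp add: pure_source_def)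
  have psd\<sigma>: "psd d (\<sigma> x)" and tr\<sigma>: "mtrace (\<sigma> x) = of_real (m x)" if x: "x \<in> space N" for x
    unfolding \<sigma>_def m using x h01
    by (intro weighted_mixture P.prob_space_axioms pure_state_density pure m\<phi> mh2; simp)+
  have avg: "m x * vN_entropy (avg_state d \<phi> (r x)) = vN_entropy (\<sigma> x) + m x * log 2 (m x)" if x: "x \<in> space N" for x
  proof (cases "m x > 0")
    case True
    have "avg_state d \<phi> (r x) $$ (i, k) = \<sigma> x $$ (i, k) / of_real (m x)" if ik: "i < d" "k < d" for i k
    proof -
      have "(\<integral>\<omega>. \<phi> \<omega> $$ (i, k) \<partial>(r x)) = (\<integral>\<omega>. (h \<omega> x / m x) *\<^sub>R \<phi> \<omega> $$ (i, k) \<partial>P)"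
        using True x h01 m\<phi>[OF ik] unfolding r_def by (simp, subst integral_density) (auto intro!: AE_I2)
      also have "\<dots> = (\<integral>\<omega>. of_real (h \<omega> x) * \<phi> \<omega> $$ (i, k) / of_real (m x) \<partial>P)"
        by (simp add: scaleR_conv_of_real)
      finally show ?thesis using ik by (simp add: avg_state_def \<sigma>_def)
    qed
    then show ?thesis using True
      by (intro vN_entropy_scale[OF psd\<sigma>[OF x]]) (auto simp: tr\<sigma>[OF x] avg_state_def)
  next
    \<comment> \<open>The unnormalised state has trace 0 here, so the two general entropy bounds
      squeeze its entropy to 0.\<close>
    case False
    then have mx: "m x = 0" using m01(1)[OF x] by simp
    have d0: "0 < d" using pure[of "SOME \<omega>. \<omega> \<in> space P"] P.not_empty some_in_eq by (force simp: pure_state_def scalar_prod_def intro!: Nat.gr0I)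
    have "vN_entropy (\<sigma> x) = 0"
      using vN_entropy_bounds(1)[OF psd\<sigma>[OF x]] vN_entropy_le_log_dim[OF psd\<sigma>[OF x] d0 refl] tr\<sigma>[OF x] mx by simp
    then show ?thesis using mx by simp
  qed
  have mavg: "(\<lambda>x. vN_entropy (avg_state d \<phi> (r x))) \<in> borel_measurable N"
  proof (rule vN_entropy_measurable)
    fix x assume x: "x \<in> space N"
    interpret r: prob_space "r x" by (rule ps_r[OF x])
    have sp: "space (r x) = space P" and st: "sets (r x) = sets P" by (simp_all add: r_def)
    have "avg_state d \<phi> (r x) = mat d d (\<lambda>(i,k). \<integral>\<omega>. of_real 1 * \<phi> \<omega> $$ (i, k) \<partial>(r x))"
      by (simp add: avg_state_def)
    moreover have "(\<lambda>\<omega>. \<phi> \<omega> $$ (i, k)) \<in> borel_measurable (r x)" if "i < d" "k < d" for i k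
      using m\<phi>[OF that] st by (simp cong: measurable_cong_sets)
    ultimately show "psd d (avg_state d \<phi> (r x))" "Re (mtrace (avg_state d \<phi> (r x))) \<le> 1"
      using weighted_mixture(2,3)[OF r.prob_space_axioms, of d \<phi> "\<lambda>_. 1"] pure_state_density[OF pure] sp
      by (simp_all add: r.prob_space)
  next
    fix i k assume ik: "i < d" "k < d"
    have "(\<lambda>x. \<integral>\<omega>. \<phi> \<omega> $$ (i, k) \<partial>(r x)) \<in> borel_measurable N"
      using measurable_compose[OF measurable_prob_algebraD[OF mr] integral_measurable_subprob_algebra[OF m\<phi>[OF ik]]] by simp
    then show "(\<lambda>x. avg_state d \<phi> (r x) $$ (i, k)) \<in> borel_measurable N" using ik by (simp add: avg_state_def)
  qed
  have "cond_AB_C d \<phi> P p N r = (\<integral>x. m x * vN_entropy (avg_state d \<phi> (r x)) \<partial>N)"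
    unfolding cond_AB_C_def marg using mavg m01 by (subst integral_density) (auto intro!: AE_I2)
  also have "\<dots> = (\<integral>x. vN_entropy (\<sigma> x) + m x * log 2 (m x) \<partial>N)"
    by (rule Bochner_Integration.integral_cong[OF refl]) (rule avg)
  finally have cond: "cond_AB_C d \<phi> P p N r = (\<integral>x. vN_entropy (\<sigma> x) + m x * log 2 (m x) \<partial>N)" .
  show ?thesis
    unfolding M_quantity_def \<sigma>_def[symmetric] cond[symmetric]
    by (rule Inf_lower) (use mp bayes mutual in blast)
qed

section \<open>Conditional states of a source block\<close>

lemma pure_state_kron:
  assumes A: "pure_state m A" and B: "pure_state l B"
  shows "pure_state (m * l) (kron A B)"
proof -
  obtain u where u: "(\<Sum>i<m. (cmod (u i))\<^sup>2) = 1" "\<forall>i<m. \<forall>k<m. A $$ (i, k) = u i * cnj (u k)" "A \<in> carrier_mat m m"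
    using pure_stateD[OF A] by blast
  obtain v where v: "(\<Sum>i<l. (cmod (v i))\<^sup>2) = 1" "\<forall>i<l. \<forall>k<l. B $$ (i, k) = v i * cnj (v k)" "B \<in> carrier_mat l l"
    using pure_stateD[OF B] by blast
  define y where "y = vec (m * l) (\<lambda>r. u (r div l) * v (r mod l))"
  have "conjugate y \<bullet> y = ip (m * l) (\<lambda>r. u (r div l) * v (r mod l)) (\<lambda>r. u (r div l) * v (r mod l))"
    by (simp add: y_def scalar_prod_def ip_def atLeast0LessThan)
  also have "\<dots> = 1" unfolding ip_self using norm_product_vector[OF u(1) v(1)] by simp
  finally have "conjugate y \<bullet> y = 1" .
  moreover have "kron A B = ket_bra y"
    using u v by (intro eq_matI) (auto simp: ket_bra_def y_def kron_def div_mod_less)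
  moreover have "y \<in> carrier_vec (m * l)" by (simp add: y_def)
  ultimately show ?thesis unfolding pure_state_def by blast
qed

locale block_source =
  fixes P :: "'a measure" and \<phi> :: "'a \<Rightarrow> complex mat" and d n :: nat
  assumes src: "pure_source P \<phi> d"
begin

abbreviation Pn :: "(nat \<Rightarrow> 'a) measure" where "Pn \<equiv> block_measure P n"

sublocale P: prob_space P using src by (simp add: pure_source_def)

sublocale pp: product_prob_space "\<lambda>_. P" "{..<n}" ..

lemma prob_Pn: "measure Pn (space Pn) = 1"
  by (rule prob_space.prob_space[OF prob_space_PiM]) (rule P.prob_space_axioms)

sublocale PnP: pair_sigma_finite Pn P ..
sublocale PnPn: pair_sigma_finite Pn Pn ..
sublocale PnP': pair_prob_space Pn P ..

lemma pure: "\<omega> \<in> space P \<Longrightarrow> pure_state d (\<phi> \<omega>)" using src by (simp add: pure_source_def)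

lemma m\<phi>: "i < d \<Longrightarrow> k < d \<Longrightarrow> (\<lambda>\<omega>. \<phi> \<omega> $$ (i, k)) \<in> borel_measurable P"
  using src by (simp add: pure_source_def)

lemma d_pos: "0 < d"
proof -
  obtain \<omega> where "\<omega> \<in> space P" using P.not_empty by blast
  from pure_stateD[OF pure[OF this]] show ?thesis by (cases d) auto
qed

lemma psd_letter: "\<omega> \<in> space P \<Longrightarrow> psd d (\<phi> \<omega>)" "\<omega> \<in> space P \<Longrightarrow> mtrace (\<phi> \<omega>) = 1"
  using pure_state_density[OF pure] by (auto simp: density_def)

lemma carrier_letter: "\<omega> \<in> space P \<Longrightarrow> \<phi> \<omega> \<in> carrier_mat d d"
  using psd_letter(1) by (simp add: psd_def)

lemma space_Pn: "a \<in> space Pn \<longleftrightarrow> (\<forall>i<n. a i \<in> space P) \<and> (\<forall>i\<ge>n. a i = undefined)"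
  by (auto simp: space_PiM PiE_iff extensional_def)

text \<open>Integrating over \<open>b\<close> with \<open>a\<close> fixed averages out the first
  \<open>k\<close> letters and conditions on the rest, without decomposing the product space into
  two groups of coordinates.\<close>

definition mix :: "nat \<Rightarrow> (nat \<Rightarrow> 'a) \<Rightarrow> (nat \<Rightarrow> 'a) \<Rightarrow> nat \<Rightarrow> 'a" where
  "mix k b a = (\<lambda>i. if i < k then b i else a i)"

lemma upd_space: "a \<in> space Pn \<Longrightarrow> \<omega> \<in> space P \<Longrightarrow> k < n \<Longrightarrow> a(k := \<omega>) \<in> space Pn"
  by (auto simp: space_Pn)

lemma mix_space: "a \<in> space Pn \<Longrightarrow> b \<in> space Pn \<Longrightarrow> mix k b a \<in> space Pn"
  by (auto simp: space_Pn mix_def)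

lemma mix_n: "a \<in> space Pn \<Longrightarrow> b \<in> space Pn \<Longrightarrow> mix n b a = b"
  by (auto simp: space_Pn mix_def fun_eq_iff)

lemma mix_upd: "mix (Suc k) (b(k := \<omega>)) a = mix k b (a(k := \<omega>))"
  by (auto simp: mix_def fun_eq_iff)

lemma measurable_upd:
  assumes "k < n" "f \<in> measurable M Pn" "h \<in> measurable M P"
  shows "(\<lambda>x. (f x)(k := h x)) \<in> measurable M Pn"
  using assms by (intro measurable_fun_upd[where J = "{..<n}"]) auto

lemma measurable_mix:
  assumes f: "f \<in> measurable M Pn" and h: "h \<in> measurable M Pn"
  shows "(\<lambda>x. mix k (f x) (h x)) \<in> measurable M Pn"
  unfolding mix_def
proof (rule measurable_PiM_single')
  fix i assume i: "i \<in> {..<n}"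
  have "(\<lambda>x. f x i) \<in> measurable M P" "(\<lambda>x. h x i) \<in> measurable M P"
    using measurable_compose[OF f measurable_component_singleton[OF i]] measurable_compose[OF h measurable_component_singleton[OF i]]
    by simp_all
  then show "(\<lambda>x. if i < k then f x i else h x i) \<in> measurable M P" by (cases "i < k") auto
next
  show "(\<lambda>x i. if i < k then f x i else h x i) \<in> space M \<rightarrow> (\<Pi>\<^sub>E i\<in>{..<n}. space P)"
  proof
    fix x assume x: "x \<in> space M"
    have "mix k (f x) (h x) \<in> space Pn" using measurable_space[OF f x] measurable_space[OF h x] by (rule mix_space[rotated])
    then show "(\<lambda>i. if i < k then f x i else h x i) \<in> (\<Pi>\<^sub>E i\<in>{..<n}. space P)" by (simp add: space_PiM mix_def)
  qed
qed

text \<open>Replacing one letter by an independent copy preserves the law of the block. This takes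
  the place of splitting off coordinate \<open>k\<close> from the product measure.\<close>

lemma distr_upd:
  assumes k: "k < n"
  shows "distr (Pn \<Otimes>\<^sub>M P) Pn (\<lambda>z. (fst z)(k := snd z)) = Pn"
proof (rule pp.PiM_eqI)
  fix A assume A: "\<And>i. i \<in> {..<n} \<Longrightarrow> A i \<in> sets P"
  \<comment> \<open>The letter of the old block at \<open>k\<close> is overwritten and therefore
    unconstrained.\<close>
  define A' where "A' = A(k := space P)"
  have A': "A' i \<in> sets P" if "i < n" for i using A that by (simp add: A'_def)
  have m: "(\<lambda>z. (fst z)(k := snd z)) \<in> measurable (Pn \<Otimes>\<^sub>M P) Pn"
    by (rule measurable_upd[OF k measurable_fst measurable_snd])
  have eq: "(\<lambda>z. (fst z)(k := snd z)) -` Pi\<^sub>E {..<n} A \<inter> space (Pn \<Otimes>\<^sub>M P) = Pi\<^sub>E {..<n} A' \<times> A k"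
  proof (intro equalityI subsetI)
    fix z assume z: "z \<in> (\<lambda>z. (fst z)(k := snd z)) -` Pi\<^sub>E {..<n} A \<inter> space (Pn \<Otimes>\<^sub>M P)"
    then have 1: "(fst z)(k := snd z) \<in> Pi\<^sub>E {..<n} A" and 2: "fst z \<in> space Pn"
      by (simp_all add: space_pair_measure mem_Times_iff)
    have "fst z i \<in> A' i" if "i < n" for i
      using 2 PiE_mem[OF 1, of i] that by (cases "i = k") (auto simp: A'_def space_Pn)
    moreover have "snd z \<in> A k" using PiE_mem[OF 1, of k] k by simp
    ultimately show "z \<in> Pi\<^sub>E {..<n} A' \<times> A k" using 2 by (cases z) (auto simp: PiE_iff space_PiM)
  next
    fix z assume z: "z \<in> Pi\<^sub>E {..<n} A' \<times> A k"
    then obtain b w where bw: "z = (b, w)" "b \<in> Pi\<^sub>E {..<n} A'" "w \<in> A k" by auto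
    have "b \<in> space Pn" using bw(2) A'[THEN sets.sets_into_space] by (fastforce simp: space_PiM PiE_iff)
    moreover have "w \<in> space P" using bw(3) A[of k] k sets.sets_into_space by auto
    moreover have "b(k := w) \<in> Pi\<^sub>E {..<n} A"
      using bw(2,3) k by (auto simp: PiE_iff A'_def extensional_def split: if_split_asm)
    ultimately show "z \<in> (\<lambda>z. (fst z)(k := snd z)) -` Pi\<^sub>E {..<n} A \<inter> space (Pn \<Otimes>\<^sub>M P)"
      using bw(1) by (simp add: space_pair_measure)
  qed
  have "emeasure (distr (Pn \<Otimes>\<^sub>M P) Pn (\<lambda>z. (fst z)(k := snd z))) (Pi\<^sub>E {..<n} A) = emeasure (Pn \<Otimes>\<^sub>M P) (Pi\<^sub>E {..<n} A' \<times> A k)"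
    using A by (subst emeasure_distr[OF m]) (auto simp: eq intro!: sets_PiM_I_finite)
  also have "\<dots> = emeasure Pn (Pi\<^sub>E {..<n} A') * emeasure P (A k)"
    using A A' k by (intro P.emeasure_pair_measure_Times) (auto intro!: sets_PiM_I_finite)
  also have "emeasure Pn (Pi\<^sub>E {..<n} A') = (\<Prod>i<n. emeasure P (A' i))"
    using A' by (intro pp.emeasure_PiM) auto
  also have "\<dots> = emeasure P (A' k) * (\<Prod>i\<in>{..<n} - {k}. emeasure P (A' i))"
    using k by (intro prod.remove) auto
  also have "(\<Prod>i\<in>{..<n} - {k}. emeasure P (A' i)) = (\<Prod>i\<in>{..<n} - {k}. emeasure P (A i))"
    by (intro prod.cong) (auto simp: A'_def)
  also have "emeasure P (A' k) * \<dots> * emeasure P (A k) = emeasure P (A k) * (\<Prod>i\<in>{..<n} - {k}. emeasure P (A i))"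
    by (simp add: A'_def P.emeasure_space_1 mult.commute)
  also have "\<dots> = (\<Prod>i<n. emeasure P (A i))" using k by (intro prod.remove[symmetric]) auto
  finally show "emeasure (distr (Pn \<Otimes>\<^sub>M P) Pn (\<lambda>z. (fst z)(k := snd z))) (Pi\<^sub>E {..<n} A) = (\<Prod>i<n. emeasure P (A i))" .
qed simp_all

text \<open>Fubini's theorem for the resampled block. Boundedness of \<open>f\<close> supplies all
  integrability.\<close>

lemma resample:
  fixes f :: "(nat \<Rightarrow> 'a) \<Rightarrow> 'b :: {banach, second_countable_topology}"
  assumes k: "k < n" and f: "f \<in> borel_measurable Pn" and B: "\<And>a. a \<in> space Pn \<Longrightarrow> norm (f a) \<le> B"
  shows "integrable (Pn \<Otimes>\<^sub>M P) (\<lambda>z. f ((fst z)(k := snd z)))"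
    "(\<integral>a. f a \<partial>Pn) = (\<integral>a. \<integral>\<omega>. f (a(k := \<omega>)) \<partial>P \<partial>Pn)"
    "(\<integral>a. f a \<partial>Pn) = (\<integral>\<omega>. \<integral>a. f (a(k := \<omega>)) \<partial>Pn \<partial>P)"
proof -
  have m: "(\<lambda>z. (fst z)(k := snd z)) \<in> measurable (Pn \<Otimes>\<^sub>M P) Pn"
    by (rule measurable_upd[OF k measurable_fst measurable_snd])
  show i: "integrable (Pn \<Otimes>\<^sub>M P) (\<lambda>z. f ((fst z)(k := snd z)))"
  proof (rule PnP'.integrable_const_bound[of _ B])
    show "AE z in Pn \<Otimes>\<^sub>M P. norm (f ((fst z)(k := snd z))) \<le> B"
      using measurable_space[OF m] B by (intro AE_I2) blast
    show "(\<lambda>z. f ((fst z)(k := snd z))) \<in> borel_measurable (Pn \<Otimes>\<^sub>M P)" by (rule measurable_compose[OF m f])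
  qed
  have e: "(\<integral>a. f a \<partial>Pn) = (\<integral>z. f ((fst z)(k := snd z)) \<partial>(Pn \<Otimes>\<^sub>M P))"
    using integral_distr[OF m, of f] f by (simp add: distr_upd[OF k])
  show "(\<integral>a. f a \<partial>Pn) = (\<integral>a. \<integral>\<omega>. f (a(k := \<omega>)) \<partial>P \<partial>Pn)"
    unfolding e using PnP.integral_fst'[OF i] by simp
  show "(\<integral>a. f a \<partial>Pn) = (\<integral>\<omega>. \<integral>a. f (a(k := \<omega>)) \<partial>Pn \<partial>P)"
    unfolding e using PnP.integral_snd[of "\<lambda>a \<omega>. f (a(k := \<omega>))"] i by (simp add: case_prod_unfold)
qed

section \<open>States of words\<close>

abbreviation word :: "nat \<Rightarrow> (nat \<Rightarrow> 'a) \<Rightarrow> complex mat" where "word \<equiv> tensor_word \<phi>"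

lemma word_cong: "(\<And>i. i < k \<Longrightarrow> a i = b i) \<Longrightarrow> word k a = word k b"
  by (induction k) auto

lemma pure_word: "(\<And>i. i < k \<Longrightarrow> b i \<in> space P) \<Longrightarrow> pure_state (d ^ k) (word k b)"
proof (induction k)
  case 0
  have "conjugate (vec 1 (\<lambda>_. 1)) \<bullet> vec 1 (\<lambda>_. 1 :: complex) = 1" by (simp add: scalar_prod_def)
  moreover have "(1\<^sub>m 1 :: complex mat) = ket_bra (vec 1 (\<lambda>_. 1))" by (intro eq_matI) (auto simp: ket_bra_def)
  ultimately show ?case unfolding pure_state_def by (auto intro!: bexI[of _ "vec 1 (\<lambda>_. 1)"])
next
  case (Suc k)
  then show ?case using pure_state_kron[of "d ^ k" "word k b" d "\<phi> (b k)"] pure by (simp add: mult.commute)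
qed

lemma word_density: "b \<in> space Pn \<Longrightarrow> k \<le> n \<Longrightarrow> density (d ^ k) (word k b)"
  by (rule pure_state_density, rule pure_word) (auto simp: space_Pn)

lemma word_props:
  assumes "b \<in> space Pn" "k \<le> n"
  shows "psd (d ^ k) (word k b)" "mtrace (word k b) = 1" "word k b \<in> carrier_mat (d ^ k) (d ^ k)"
  using word_density[OF assms] by (auto simp: density_def psd_def)

lemma word_entry_le: "b \<in> space Pn \<Longrightarrow> k \<le> n \<Longrightarrow> r < d ^ k \<Longrightarrow> s < d ^ k \<Longrightarrow> cmod (word k b $$ (r, s)) \<le> 1"
  using psd_entry_bound[OF word_props(1), of b k r s] word_props(2)[of b k] by simp

lemma word_Suc_index:
  assumes "b \<in> space Pn" "k < n" "r < d ^ Suc k" "s < d ^ Suc k"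
  shows "word (Suc k) b $$ (r, s) = word k b $$ (r div d, s div d) * \<phi> (b k) $$ (r mod d, s mod d)"
proof -
  have "b k \<in> space P" using assms by (simp add: space_Pn)
  then show ?thesis using kron_index[OF word_props(3) carrier_letter] assms by (simp add: mult.commute)
qed

lemma word_measurable:
  "k \<le> n \<Longrightarrow> r < d ^ k \<Longrightarrow> s < d ^ k \<Longrightarrow> (\<lambda>b. word k b $$ (r, s)) \<in> borel_measurable Pn"
proof (induction k arbitrary: r s)
  case 0
  then show ?case by simp
next
  case (Suc k)
  have rs: "r div d < d ^ k" "s div d < d ^ k" "r mod d < d" "s mod d < d"
    using Suc.prems div_mod_less[of r "d ^ k" d] div_mod_less[of s "d ^ k" d] by (simp_all add: mult.commute)
  have "(\<lambda>b. word k b $$ (r div d, s div d) * \<phi> (b k) $$ (r mod d, s mod d)) \<in> borel_measurable Pn"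
  proof (intro borel_measurable_times)
    show "(\<lambda>b. word k b $$ (r div d, s div d)) \<in> borel_measurable Pn" using Suc rs by simp
    show "(\<lambda>b. \<phi> (b k) $$ (r mod d, s mod d)) \<in> borel_measurable Pn"
      by (rule measurable_compose[where f = "\<lambda>b. b k" and g = "\<lambda>\<omega>. \<phi> \<omega> $$ (r mod d, s mod d)" and N = P])
        (use Suc.prems rs m\<phi> in auto)
  qed
  also have "?this \<longleftrightarrow> ?case" using Suc.prems by (intro measurable_cong) (simp add: word_Suc_index del: tensor_word.simps power_Suc)
  finally show ?case .
qed

end

locale block_weight = block_source +
  fixes g :: "(nat \<Rightarrow> 'a) \<Rightarrow> real"
  assumes mg: "g \<in> borel_measurable (block_measure P n)"
    and g01: "\<And>a. a \<in> space (block_measure P n) \<Longrightarrow> 0 \<le> g a \<and> g a \<le> 1"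
begin

text \<open>With \<open>g\<close> the conditional probability of a label given the block, \<open>W k a\<close> is the conditional
  probability of the label given the letters of \<open>a\<close> from position \<open>k\<close> on, \<open>\<rho> k a\<close> is the corresponding
  subnormalised state of the first \<open>k\<close> letters, and \<open>\<sigma> k a\<close> that of letter \<open>k\<close> given the letters after \<open>k\<close>.\<close>
definition W :: "nat \<Rightarrow> (nat \<Rightarrow> 'a) \<Rightarrow> real" where
  "W k a = (\<integral>b. g (mix k b a) \<partial>Pn)"

definition \<rho> :: "nat \<Rightarrow> (nat \<Rightarrow> 'a) \<Rightarrow> complex mat" where
  "\<rho> k a = mat (d ^ k) (d ^ k) (\<lambda>(r,s). \<integral>b. of_real (g (mix k b a)) * word k b $$ (r, s) \<partial>Pn)"

definition \<sigma> :: "nat \<Rightarrow> (nat \<Rightarrow> 'a) \<Rightarrow> complex mat" where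
  "\<sigma> k a = mat d d (\<lambda>(i,l). \<integral>\<omega>. of_real (W k (a(k := \<omega>))) * \<phi> \<omega> $$ (i, l) \<partial>P)"

lemma measurable_g_mix:
  assumes "f \<in> measurable M Pn" "h \<in> measurable M Pn"
  shows "(\<lambda>x. g (mix k (f x) (h x))) \<in> borel_measurable M"
  using measurable_compose[OF measurable_mix[OF assms] mg] .

lemma W_measurable[measurable]: "W k \<in> borel_measurable Pn"
  unfolding W_def[abs_def]
  by (rule pp.borel_measurable_lebesgue_integral)
    (simp add: case_prod_unfold measurable_g_mix[OF measurable_snd measurable_fst])

lemma integrable_g_mix: "a \<in> space Pn \<Longrightarrow> integrable Pn (\<lambda>b. g (mix k b a))"
  using g01 mix_space
  by (intro pp.integrable_const_bound[of _ 1] AE_I2 measurable_g_mix measurable_ident_sets measurable_const) auto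

lemma W_bounds: "a \<in> space Pn \<Longrightarrow> 0 \<le> W k a \<and> W k a \<le> 1"
proof -
  assume a: "a \<in> space Pn"
  have "0 \<le> W k a" unfolding W_def using g01 mix_space a by (intro Bochner_Integration.integral_nonneg) auto
  moreover have "W k a \<le> (\<integral>b. 1 \<partial>Pn)" unfolding W_def using g01 mix_space a integrable_g_mix[OF a]
    by (intro integral_mono) auto
  ultimately show ?thesis by (simp add: prob_Pn)
qed

lemma
  assumes a: "a \<in> space Pn" and k: "k \<le> n"
  shows integrable_\<rho>: "r < d ^ k \<Longrightarrow> s < d ^ k \<Longrightarrow> integrable Pn (\<lambda>b. of_real (g (mix k b a)) * word k b $$ (r, s))"
    and \<rho>_psd: "psd (d ^ k) (\<rho> k a)"
    and \<rho>_trace: "mtrace (\<rho> k a) = of_real (W k a)"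
proof -
  have mg': "(\<lambda>b. g (mix k b a)) \<in> borel_measurable Pn"
    using a by (intro measurable_g_mix measurable_ident_sets measurable_const) auto
  note mixture = weighted_mixture[OF pp.P.prob_space_axioms word_density[OF _ k] word_measurable[OF k] mg' g01[OF mix_space[OF a]]]
  show "r < d ^ k \<Longrightarrow> s < d ^ k \<Longrightarrow> integrable Pn (\<lambda>b. of_real (g (mix k b a)) * word k b $$ (r, s))"
    "psd (d ^ k) (\<rho> k a)" "mtrace (\<rho> k a) = of_real (W k a)"
    unfolding \<rho>_def W_def by (rule mixture; assumption)+
qed

lemma \<rho>_measurable:
  assumes "k \<le> n" "r < d ^ k" "s < d ^ k"
  shows "(\<lambda>a. \<rho> k a $$ (r, s)) \<in> borel_measurable Pn"
proof -
  have "(\<lambda>a. \<integral>b. of_real (g (mix k b a)) * word k b $$ (r, s) \<partial>Pn) \<in> borel_measurable Pn"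
  proof (rule pp.borel_measurable_lebesgue_integral)
    have "(\<lambda>z. word k (snd z) $$ (r, s)) \<in> borel_measurable (Pn \<Otimes>\<^sub>M Pn)"
      by (rule measurable_compose[OF measurable_snd word_measurable[OF assms]])
    then show "(\<lambda>(a, b). of_real (g (mix k b a)) * word k b $$ (r, s)) \<in> borel_measurable (Pn \<Otimes>\<^sub>M Pn)"
      using measurable_g_mix[OF measurable_snd measurable_fst] by (simp add: case_prod_unfold)
  qed
  then show ?thesis using assms by (simp add: \<rho>_def)
qed

text \<open>The letter at \<open>k\<close> is resampled in the averaged block and then, by
  \<open>mix_upd\<close>, counted as part of the conditioning block.\<close>

lemma W_Suc:
  assumes a: "a \<in> space Pn" and k: "k < n"
  shows "W (Suc k) a = (\<integral>\<omega>. W k (a(k := \<omega>)) \<partial>P)"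
proof -
  have "W (Suc k) a = (\<integral>\<omega>. \<integral>b. g (mix (Suc k) (b(k := \<omega>)) a) \<partial>Pn \<partial>P)"
    unfolding W_def using a g01[OF mix_space[OF a]]
    by (intro resample(3)[OF k, where B = 1] measurable_g_mix measurable_ident_sets measurable_const) auto
  then show ?thesis by (simp add: mix_upd W_def)
qed

text \<open>The same transfer of letter \<open>k\<close> as for \<open>W\<close>. Once it is fixed
  it leaves the inner average as the second tensor factor, and the remaining factor is the state of
  the first \<open>k\<close> letters.\<close>

lemma \<rho>_Suc:
  assumes a: "a \<in> space Pn" and k: "k < n"
  shows "\<rho> (Suc k) a = mat (d ^ k * d) (d ^ k * d) (\<lambda>(r,s). \<integral>\<omega>. kron (\<rho> k (a(k := \<omega>))) (\<phi> \<omega>) $$ (r, s) \<partial>P)"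
proof (intro eq_matI)
  fix r s assume "r < dim_row (mat (d ^ k * d) (d ^ k * d) (\<lambda>(r,s). \<integral>\<omega>. kron (\<rho> k (a(k := \<omega>))) (\<phi> \<omega>) $$ (r, s) \<partial>P))"
    "s < dim_col (mat (d ^ k * d) (d ^ k * d) (\<lambda>(r,s). \<integral>\<omega>. kron (\<rho> k (a(k := \<omega>))) (\<phi> \<omega>) $$ (r, s) \<partial>P))"
  then have rs: "r < d ^ k * d" "s < d ^ k * d" by auto
  then have rs': "r < d ^ Suc k" "s < d ^ Suc k" by (auto simp: mult.commute)
  note rd = div_mod_less[OF rs(1)] div_mod_less[OF rs(2)]
  have "\<rho> (Suc k) a $$ (r, s) = (\<integral>\<omega>. \<integral>b. of_real (g (mix (Suc k) (b(k := \<omega>)) a)) * word (Suc k) (b(k := \<omega>)) $$ (r, s) \<partial>Pn \<partial>P)"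
  proof -
    have m: "(\<lambda>b. of_real (g (mix (Suc k) b a)) * word (Suc k) b $$ (r, s)) \<in> borel_measurable Pn"
      using integrable_\<rho>[OF a _ rs'] k by (intro borel_measurable_integrable) simp
    have B: "norm (of_real (g (mix (Suc k) b a)) * word (Suc k) b $$ (r, s)) \<le> 1" if "b \<in> space Pn" for b
      using g01[OF mix_space[OF a that]] word_entry_le[OF that _ rs'] k by (simp add: norm_mult mult_le_one del: tensor_word.simps)
    show ?thesis using resample(3)[OF k m B] rs' by (simp add: \<rho>_def del: tensor_word.simps power_Suc)
  qed
  also have "\<dots> = (\<integral>\<omega>. kron (\<rho> k (a(k := \<omega>))) (\<phi> \<omega>) $$ (r, s) \<partial>P)"
  proof (rule Bochner_Integration.integral_cong[OF refl])
    fix \<omega> assume \<omega>: "\<omega> \<in> space P"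
    have "(\<integral>b. of_real (g (mix (Suc k) (b(k := \<omega>)) a)) * word (Suc k) (b(k := \<omega>)) $$ (r, s) \<partial>Pn)
      = (\<integral>b. (of_real (g (mix k b (a(k := \<omega>)))) * word k b $$ (r div d, s div d)) * \<phi> \<omega> $$ (r mod d, s mod d) \<partial>Pn)"
    proof (rule Bochner_Integration.integral_cong[OF refl])
      fix b assume b: "b \<in> space Pn"
      have "word k (b(k := \<omega>)) = word k b" by (rule word_cong) simp
      then show "of_real (g (mix (Suc k) (b(k := \<omega>)) a)) * word (Suc k) (b(k := \<omega>)) $$ (r, s)
        = (of_real (g (mix k b (a(k := \<omega>)))) * word k b $$ (r div d, s div d)) * \<phi> \<omega> $$ (r mod d, s mod d)"
        using word_Suc_index[OF upd_space[OF b \<omega> k] k rs'] by (simp add: mix_upd del: tensor_word.simps)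
    qed
    also have "\<dots> = (\<integral>b. of_real (g (mix k b (a(k := \<omega>)))) * word k b $$ (r div d, s div d) \<partial>Pn) * \<phi> \<omega> $$ (r mod d, s mod d)"
      by simp
    also have "\<dots> = kron (\<rho> k (a(k := \<omega>))) (\<phi> \<omega>) $$ (r, s)"
      using rd by (subst kron_index[OF _ carrier_letter[OF \<omega>] rs]) (auto simp: \<rho>_def)
    finally show "(\<integral>b. of_real (g (mix (Suc k) (b(k := \<omega>)) a)) * word (Suc k) (b(k := \<omega>)) $$ (r, s) \<partial>Pn)
      = kron (\<rho> k (a(k := \<omega>))) (\<phi> \<omega>) $$ (r, s)" .
  qed
  finally show "\<rho> (Suc k) a $$ (r, s) = mat (d ^ k * d) (d ^ k * d) (\<lambda>(r,s). \<integral>\<omega>. kron (\<rho> k (a(k := \<omega>))) (\<phi> \<omega>) $$ (r, s) \<partial>P) $$ (r, s)"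
    using rs by simp
qed (auto simp: \<rho>_def mult.commute)

lemma measurable_W_upd:
  assumes "k < n" "f \<in> measurable M Pn" "h \<in> measurable M P"
  shows "(\<lambda>x. W l ((f x)(k := h x))) \<in> borel_measurable M"
  using measurable_compose[OF measurable_upd[OF assms] W_measurable] .

lemma measurable_W_upd1: "k < n \<Longrightarrow> a \<in> space Pn \<Longrightarrow> (\<lambda>\<omega>. W l (a(k := \<omega>))) \<in> borel_measurable P"
  by (rule measurable_W_upd) auto

lemma
  assumes a: "a \<in> space Pn" and k: "k < n"
  shows \<sigma>_psd: "psd d (\<sigma> k a)"
    and \<sigma>_trace: "mtrace (\<sigma> k a) = of_real (W (Suc k) a)"
proof -
  note mixture = weighted_mixture[OF P.prob_space_axioms pure_state_density[OF pure] m\<phi> measurable_W_upd1[OF k a] W_bounds[OF upd_space[OF a _ k]]]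
  show "psd d (\<sigma> k a)" "mtrace (\<sigma> k a) = of_real (W (Suc k) a)"
    unfolding \<sigma>_def W_Suc[OF a k] by (rule mixture; assumption)+
qed

lemma \<sigma>_measurable:
  assumes k: "k < n" and "i < d" "l < d"
  shows "(\<lambda>a. \<sigma> k a $$ (i, l)) \<in> borel_measurable Pn"
proof -
  have "(\<lambda>a. \<integral>\<omega>. of_real (W k (a(k := \<omega>))) * \<phi> \<omega> $$ (i, l) \<partial>P) \<in> borel_measurable Pn"
  proof (rule P.borel_measurable_lebesgue_integral)
    have "(\<lambda>z. \<phi> (snd z) $$ (i, l)) \<in> borel_measurable (Pn \<Otimes>\<^sub>M P)"
      by (rule measurable_compose[OF measurable_snd m\<phi>[OF assms(2,3)]])
    then show "(\<lambda>(a, \<omega>). of_real (W k (a(k := \<omega>))) * \<phi> \<omega> $$ (i, l)) \<in> borel_measurable (Pn \<Otimes>\<^sub>M P)"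
      using measurable_W_upd[OF k measurable_fst measurable_snd] by (simp add: case_prod_unfold)
  qed
  then show ?thesis using assms by (simp add: \<sigma>_def)
qed

text \<open>Up to normalisation these are conditional entropies weighted by the probability of the
  label: \<open>V k + Y k\<close> is that of the first \<open>k\<close> letters given the letters
  from \<open>k\<close> on, and \<open>S k + Y (Suc k)\<close> that of letter \<open>k\<close> given
  the letters after it.\<close>

definition V :: "nat \<Rightarrow> real" where "V k = (\<integral>a. vN_entropy (\<rho> k a) \<partial>Pn)"
definition Y :: "nat \<Rightarrow> real" where "Y k = (\<integral>a. W k a * log 2 (W k a) \<partial>Pn)"
definition S :: "nat \<Rightarrow> real" where "S k = (\<integral>a. vN_entropy (\<sigma> k a) \<partial>Pn)"

lemma W_log_bounds: "a \<in> space Pn \<Longrightarrow> \<bar>W k a * log 2 (W k a)\<bar> \<le> 2" "a \<in> space Pn \<Longrightarrow> W k a * log 2 (W k a) \<le> 0"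
  using neg_x_log_x_bounds[of "W k a"] W_bounds[of a k] by (auto simp: abs_le_iff)

lemma \<rho>_entropy:
  assumes k: "k \<le> n"
  shows "(\<lambda>a. vN_entropy (\<rho> k a)) \<in> borel_measurable Pn" "a \<in> space Pn \<Longrightarrow> \<bar>vN_entropy (\<rho> k a)\<bar> \<le> 2 * real (d ^ k)"
proof -
  have tr: "Re (mtrace (\<rho> k a)) \<le> 1" if "a \<in> space Pn" for a
    using W_bounds[OF that] \<rho>_trace[OF that k] by simp
  show "(\<lambda>a. vN_entropy (\<rho> k a)) \<in> borel_measurable Pn"
    by (rule vN_entropy_measurable[OF \<rho>_psd[OF _ k] tr \<rho>_measurable[OF k]])
  show "a \<in> space Pn \<Longrightarrow> \<bar>vN_entropy (\<rho> k a)\<bar> \<le> 2 * real (d ^ k)"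
    using vN_entropy_bounds[OF \<rho>_psd[OF _ k] tr, of a] by simp
qed

lemma \<sigma>_entropy:
  assumes k: "k < n"
  shows "(\<lambda>a. vN_entropy (\<sigma> k a)) \<in> borel_measurable Pn" "a \<in> space Pn \<Longrightarrow> \<bar>vN_entropy (\<sigma> k a)\<bar> \<le> 2 * real d"
proof -
  have tr: "Re (mtrace (\<sigma> k a)) \<le> 1" if "a \<in> space Pn" for a
    using W_bounds[OF that] \<sigma>_trace[OF that k] by simp
  show "(\<lambda>a. vN_entropy (\<sigma> k a)) \<in> borel_measurable Pn"
    by (rule vN_entropy_measurable[OF \<sigma>_psd[OF _ k] tr \<sigma>_measurable[OF k]])
  show "a \<in> space Pn \<Longrightarrow> \<bar>vN_entropy (\<sigma> k a)\<bar> \<le> 2 * real d"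
    using vN_entropy_bounds[OF \<sigma>_psd[OF _ k] tr, of a] by simp
qed

lemma W_log_measurable: "(\<lambda>a. W k a * log 2 (W k a)) \<in> borel_measurable Pn"
  by measurable

text \<open>\<open>entropy_chain\<close> for each fixed \<open>a\<close>, with the state of the
  first \<open>k\<close> letters as a function of letter \<open>k\<close>. Averaging over
  \<open>a\<close> makes the inserted letter part of an ordinary source block.\<close>

lemma chain_step:
  assumes k: "k < n"
  shows "S k + V k + Y k \<le> V (Suc k)"
proof -
  define f where "f a = vN_entropy (\<rho> k a) + W k a * log 2 (W k a)" for a
  have mf: "f \<in> borel_measurable Pn" unfolding f_def[abs_def]
    using \<rho>_entropy(1)[of k] k by (intro borel_measurable_add W_log_measurable) simp_all
  have Bf: "norm (f a) \<le> 2 * real (d ^ k) + 2" if "a \<in> space Pn" for a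
    using \<rho>_entropy(2)[of k a] W_log_bounds(1)[of a k] k that unfolding f_def by (simp add: abs_le_iff)
  have pointwise: "vN_entropy (\<sigma> k a) + (\<integral>\<omega>. f (a(k := \<omega>)) \<partial>P) \<le> vN_entropy (\<rho> (Suc k) a)" if a: "a \<in> space Pn" for a
  proof -
    have tr: "mtrace (\<rho> k (a(k := \<omega>))) = of_real (W k (a(k := \<omega>)))" if "\<omega> \<in> space P" for \<omega>
      using \<rho>_trace[OF upd_space[OF a that k]] k by simp
    have "vN_entropy (mat d d (\<lambda>(i,l). \<integral>\<omega>. mtrace (\<rho> k (a(k := \<omega>))) * \<phi> \<omega> $$ (i, l) \<partial>P))
      + (\<integral>\<omega>. vN_entropy (\<rho> k (a(k := \<omega>))) + Re (mtrace (\<rho> k (a(k := \<omega>)))) * log 2 (Re (mtrace (\<rho> k (a(k := \<omega>))))) \<partial>P)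
      \<le> vN_entropy (mat (d ^ k * d) (d ^ k * d) (\<lambda>(r,s). \<integral>\<omega>. kron (\<rho> k (a(k := \<omega>))) (\<phi> \<omega>) $$ (r, s) \<partial>P))"
    proof (rule entropy_chain[OF src])
      show "psd (d ^ k) (\<rho> k (a(k := \<omega>)))" if "\<omega> \<in> space P" for \<omega> using \<rho>_psd[OF upd_space[OF a that k]] k by simp
      show "Re (mtrace (\<rho> k (a(k := \<omega>)))) \<le> 1" if "\<omega> \<in> space P" for \<omega>
        using W_bounds[OF upd_space[OF a that k]] tr[OF that] by simp
      show "(\<lambda>\<omega>. \<rho> k (a(k := \<omega>)) $$ (r, s)) \<in> borel_measurable P" if "r < d ^ k" "s < d ^ k" for r s
        using a k by (intro measurable_compose[OF measurable_upd \<rho>_measurable] that) auto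
    qed
    also have "mat (d ^ k * d) (d ^ k * d) (\<lambda>(r,s). \<integral>\<omega>. kron (\<rho> k (a(k := \<omega>))) (\<phi> \<omega>) $$ (r, s) \<partial>P) = \<rho> (Suc k) a"
      by (rule \<rho>_Suc[OF a k, symmetric])
    also have "mat d d (\<lambda>(i,l). \<integral>\<omega>. mtrace (\<rho> k (a(k := \<omega>))) * \<phi> \<omega> $$ (i, l) \<partial>P) = \<sigma> k a"
      by (intro eq_matI) (auto simp: \<sigma>_def tr intro!: Bochner_Integration.integral_cong)
    also have "(\<integral>\<omega>. vN_entropy (\<rho> k (a(k := \<omega>))) + Re (mtrace (\<rho> k (a(k := \<omega>)))) * log 2 (Re (mtrace (\<rho> k (a(k := \<omega>))))) \<partial>P)
        = (\<integral>\<omega>. f (a(k := \<omega>)) \<partial>P)"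
      by (rule Bochner_Integration.integral_cong[OF refl]) (simp add: f_def tr)
    finally show ?thesis .
  qed
  have if': "integrable Pn (\<lambda>a. \<integral>\<omega>. f (a(k := \<omega>)) \<partial>P)"
    using PnP.integrable_fst'[OF resample(1)[OF k mf Bf]] by simp
  have isg: "integrable Pn (\<lambda>a. vN_entropy (\<sigma> k a))"
    using \<sigma>_entropy[OF k] by (intro pp.integrable_const_bound[of _ "2 * real d"] AE_I2) auto
  have ir: "integrable Pn (\<lambda>a. vN_entropy (\<rho> j a))" if "j \<le> n" for j
    using \<rho>_entropy[OF that] by (intro pp.integrable_const_bound[of _ "2 * real (d ^ j)"] AE_I2) auto
  have iw: "integrable Pn (\<lambda>a. W j a * log 2 (W j a))" for j
    using W_log_bounds W_log_measurable by (intro pp.integrable_const_bound[of _ 2] AE_I2) auto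
  have "(\<integral>a. vN_entropy (\<sigma> k a) + (\<integral>\<omega>. f (a(k := \<omega>)) \<partial>P) \<partial>Pn) \<le> V (Suc k)"
    unfolding V_def using k by (intro integral_mono Bochner_Integration.integrable_add if' isg ir pointwise) auto
  also have "(\<integral>a. vN_entropy (\<sigma> k a) + (\<integral>\<omega>. f (a(k := \<omega>)) \<partial>P) \<partial>Pn) = S k + (\<integral>a. \<integral>\<omega>. f (a(k := \<omega>)) \<partial>P \<partial>Pn)"
    unfolding S_def by (rule Bochner_Integration.integral_add[OF isg if'])
  also have "(\<integral>a. \<integral>\<omega>. f (a(k := \<omega>)) \<partial>P \<partial>Pn) = (\<integral>a. f a \<partial>Pn)"
    by (rule resample(2)[OF k mf Bf, symmetric])
  also have "\<dots> = V k + Y k" unfolding f_def V_def Y_def using ir[of k] iw[of k] k by simp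
  finally show ?thesis by simp
qed

definition final :: "complex mat" where
  "final = mat (d ^ n) (d ^ n) (\<lambda>(r,s). \<integral>b. of_real (g b) * word n b $$ (r, s) \<partial>Pn)"

definition q :: real where "q = (\<integral>a. g a \<partial>Pn)"

lemma W_n: "a \<in> space Pn \<Longrightarrow> W n a = q"
  unfolding W_def q_def by (rule Bochner_Integration.integral_cong[OF refl]) (simp add: mix_n)

lemma \<rho>_n: "a \<in> space Pn \<Longrightarrow> \<rho> n a = final"
  unfolding \<rho>_def final_def by (intro eq_matI) (auto simp: mix_n intro!: Bochner_Integration.integral_cong)

text \<open>For \<open>k = 0\<close> the state is the 1 by 1 matrix \<open>W 0 a\<close>. Hence
  \<open>V 0 + Y 0 = 0\<close>, the start of the telescoping sum.\<close>

lemma V_0: "V 0 = - Y 0"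
proof -
  have "vN_entropy (\<rho> 0 a) = - (W 0 a * log 2 (W 0 a))" if a: "a \<in> space Pn" for a
  proof -
    have "spectral (Suc 0) (mfun (\<rho> 0 a)) (\<lambda>_ _. 1) (\<lambda>_. W 0 a)"
      by (simp add: spectral_def onb_def ip_def mfun_def \<rho>_def W_def)
    from vN_entropy_spectral[OF _ this] show ?thesis by (simp add: \<rho>_def)
  qed
  then have "V 0 = (\<integral>a. - (W 0 a * log 2 (W 0 a)) \<partial>Pn)"
    unfolding V_def by (intro Bochner_Integration.integral_cong refl)
  then show ?thesis by (simp add: Y_def)
qed

lemma chain_total: "(\<Sum>k<n. S k + Y (Suc k)) \<le> vN_entropy final + q * log 2 q"
proof -
  have "(\<Sum>k<m. S k + Y (Suc k)) \<le> V m + Y m" if "m \<le> n" for m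
    using that
  proof (induction m)
    case 0
    then show ?case by (simp add: V_0)
  next
    case (Suc m)
    then show ?case using chain_step[of m] by simp
  qed
  from this[of n] have "(\<Sum>k<n. S k + Y (Suc k)) \<le> V n + Y n" by simp
  also have "V n = vN_entropy final" unfolding V_def
    by (simp add: \<rho>_n prob_Pn cong: Bochner_Integration.integral_cong)
  also have "Y n = q * log 2 q" unfolding Y_def
    by (simp add: W_n prob_Pn cong: Bochner_Integration.integral_cong)
  finally show ?thesis .
qed

text \<open>Summed over the labels, \<open>- Y 0\<close> is the entropy that the label retains once
  the whole block is known, which is positive for a randomising encoder. Only its sign enters the
  rate estimate.\<close>

lemma Y_0_nonpos: "Y 0 \<le> 0"
proof -
  have "0 \<le> (\<integral>a. - (W 0 a * log 2 (W 0 a)) \<partial>Pn)"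
    using W_log_bounds(2) by (intro Bochner_Integration.integral_nonneg) auto
  then show ?thesis by (simp add: Y_def)
qed

lemma Y_n: "Y n = q * log 2 q" unfolding Y_def
  by (simp add: W_n prob_Pn cong: Bochner_Integration.integral_cong)

end

section \<open>The single-letter kernel of a block code\<close>

text \<open>Homogeneity of degree one lets the probability of a position factor out of the entropy
  of its symbol.\<close>

lemma homogeneous_entropy:
  assumes A: "psd N A" and A': "A' \<in> carrier_mat N N" and w: "mtrace A = of_real w" and \<mu>: "0 \<le> \<mu>"
    and eq: "\<And>r s. r < N \<Longrightarrow> s < N \<Longrightarrow> A' $$ (r, s) = of_real \<mu> * A $$ (r, s)"
  shows "vN_entropy A' + (\<mu> * w) * log 2 (\<mu> * w) = \<mu> * (vN_entropy A + w * log 2 w)"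
proof -
  have cA: "A \<in> carrier_mat N N" using A by (simp add: psd_def)
  obtain u l where ul: "spectral N (mfun A) u l" and l: "\<And>i. i < N \<Longrightarrow> 0 \<le> l i"
    using psd_spectral[OF A] by blast
  have wl: "w = (\<Sum>i<N. l i)" using w unfolding mtrace_spectral[OF cA ul] by (simp only: of_real_eq_iff)
  have "spectral N (mfun A') u (\<lambda>i. \<mu> * l i)"
    using ul eq by (simp add: spectral_def mfun_def sum_distrib_left mult.assoc)
  then have vA': "vN_entropy A' = - (\<Sum>i<N. \<mu> * l i * log 2 (\<mu> * l i))" by (rule vN_entropy_spectral[OF A'])
  have x: "\<mu> * x * log 2 (\<mu> * x) = \<mu> * (x * log 2 x) + \<mu> * log 2 \<mu> * x" if "0 \<le> x" for x
    using that \<mu> by (cases "x = 0"; cases "\<mu> = 0") (auto simp: log_mult algebra_simps)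
  have "w \<ge> 0" unfolding wl using l by (auto intro: sum_nonneg)
  have "(\<Sum>i<N. \<mu> * l i * log 2 (\<mu> * l i)) = (\<Sum>i<N. \<mu> * (l i * log 2 (l i)) + \<mu> * log 2 \<mu> * l i)"
    using l x by (intro sum.cong) auto
  also have "\<dots> = - (\<mu> * vN_entropy A) + \<mu> * log 2 \<mu> * w"
    by (simp add: vN_entropy_spectral[OF cA ul] wl sum.distrib sum_distrib_left)
  finally show ?thesis unfolding vA' x[OF \<open>w \<ge> 0\<close>] by (simp add: algebra_simps)
qed

text \<open>The classical Gibbs inequality against the uniform distribution on the labels.\<close>

lemma entropy_le_log_card:
  fixes q :: "nat \<Rightarrow> real"
  assumes q: "\<And>j. j < c \<Longrightarrow> 0 \<le> q j" "(\<Sum>j<c. q j) = 1" and c: "0 < c"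
  shows "(\<Sum>j<c. - (q j * log 2 (q j))) \<le> log 2 (real c)"
proof -
  have "(\<Sum>j<c. - (q j * ln (q j)) - q j * ln (real c)) \<le> (\<Sum>j<c. 1 / real c - q j)"
  proof (intro sum_mono)
    fix j assume "j \<in> {..<c}"
    then have "0 \<le> q j" using q by simp
    show "- (q j * ln (q j)) - q j * ln (real c) \<le> 1 / real c - q j"
    proof (cases "q j = 0")
      case False
      then have pos: "0 < q j" using \<open>0 \<le> q j\<close> by simp
      have "ln (1 / (real c * q j)) \<le> 1 / (real c * q j) - 1" using pos c by (intro ln_le_minus_one) simp
      then have "q j * ln (1 / (real c * q j)) \<le> q j * (1 / (real c * q j) - 1)" using pos by (intro mult_left_mono) auto
      then show ?thesis using pos c by (simp add: ln_div ln_mult algebra_simps)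
    qed simp
  qed
  also have "\<dots> = 0" using q(2) c by (simp add: sum_subtractf)
  finally have "(\<Sum>j<c. - (q j * ln (q j))) \<le> ln (real c)"
    using q(2) by (simp add: sum_subtractf sum_negf sum_distrib_right[symmetric])
  then have "(\<Sum>j<c. - (q j * ln (q j))) / ln 2 \<le> ln (real c) / ln 2" by (intro divide_right_mono) auto
  then show ?thesis by (simp add: log_def sum_divide_distrib)
qed

lemma integral_count_space_pair:
  fixes f :: "'b \<times> 'c \<Rightarrow> real"
  assumes K: "finite K" and M: "prob_space M"
    and m: "\<And>\<kappa>. \<kappa> \<in> K \<Longrightarrow> (\<lambda>a. f (\<kappa>, a)) \<in> borel_measurable M"
    and B: "\<And>\<kappa> a. \<kappa> \<in> K \<Longrightarrow> a \<in> space M \<Longrightarrow> \<bar>f (\<kappa>, a)\<bar> \<le> B"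
  shows "f \<in> borel_measurable (count_space K \<Otimes>\<^sub>M M)"
    "(\<integral>x. f x \<partial>(count_space K \<Otimes>\<^sub>M M)) = (\<Sum>\<kappa>\<in>K. \<integral>a. f (\<kappa>, a) \<partial>M)"
proof -
  interpret M: prob_space M by fact
  interpret K: finite_measure "count_space K" by (rule finite_measure_count_space) fact
  interpret KM: pair_sigma_finite "count_space K" M ..
  interpret KMf: finite_measure "count_space K \<Otimes>\<^sub>M M"
    by (rule finite_measure_pair_measure) (simp_all add: K.finite_measure_axioms M.finite_measure_axioms)
  show mf: "f \<in> borel_measurable (count_space K \<Otimes>\<^sub>M M)"
    using K m by (intro measurable_pair_measure_countable1 countable_finite)
  have "integrable (count_space K \<Otimes>\<^sub>M M) f"
    using B mf by (intro KMf.integrable_const_bound[of _ B] AE_I2) (auto simp: space_pair_measure)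
  from KM.integral_fst'[OF this]
  show "(\<integral>x. f x \<partial>(count_space K \<Otimes>\<^sub>M M)) = (\<Sum>\<kappa>\<in>K. \<integral>a. f (\<kappa>, a) \<partial>M)"
    using K by (simp add: lebesgue_integral_count_space_finite)
qed

context block_source
begin

text \<open>The symbol emitted by the single-letter kernel consists of a position \<open>k\<close>, a codeword label
  \<open>j\<close> and a block \<open>a\<close>. The label and the letters of \<open>a\<close> after \<open>k\<close> are those of a source block whose
  \<open>k\<close>-th letter is the input; the letters of \<open>a\<close> up to \<open>k\<close> are fresh. The position \<open>n\<close> is a flag, of
  probability \<open>1 - lam\<close>, for an uninformative symbol.\<close>
lemma M_quantity_le_block:
  fixes g :: "nat \<Rightarrow> (nat \<Rightarrow> 'a) \<Rightarrow> real" and lam R :: real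
  assumes n: "0 < n" and c: "0 < c" and lam: "0 \<le> lam" "lam \<le> 1"
    and mg: "\<And>j. j < c \<Longrightarrow> g j \<in> borel_measurable Pn"
    and g0: "\<And>j a. j < c \<Longrightarrow> a \<in> space Pn \<Longrightarrow> 0 \<le> g j a"
    and g1: "\<And>a. a \<in> space Pn \<Longrightarrow> (\<Sum>j<c. g j a) = 1"
    and rate: "lam * log 2 (real c) \<le> real n * R"
  shows "M_quantity P \<phi> d R \<le> ereal (lam / real n * (\<Sum>j<c. vN_entropy (mat (d ^ n) (d ^ n)
        (\<lambda>(r,s). \<integral>b. of_real (g j b) * word n b $$ (r, s) \<partial>Pn)) + (\<integral>b. g j b \<partial>Pn) * log 2 (\<integral>b. g j b \<partial>Pn))
      + (1 - lam) * log 2 (real d))"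
proof -
  have g01: "0 \<le> g j a \<and> g j a \<le> 1" if "j < c" "a \<in> space Pn" for j a
    using g0[OF that] g1[OF that(2)] member_le_sum[of j "{..<c}" "\<lambda>j. g j a"] g0 that by auto
  have bw: "block_weight P \<phi> d n (g j)" if "j < c" for j
    using mg[OF that] g01[OF that] by unfold_locales auto
  define W where "W j = block_weight.W P n (g j)" for j
  define \<sigma> where "\<sigma> j = block_weight.\<sigma> P \<phi> d n (g j)" for j
  define Y where "Y j = block_weight.Y P n (g j)" for j
  define S where "S j = block_weight.S P \<phi> d n (g j)" for j
  define q where "q j = (\<integral>b. g j b \<partial>Pn)" for j
  define fin where "fin j = mat (d ^ n) (d ^ n) (\<lambda>(r,s). \<integral>b. of_real (g j b) * word n b $$ (r, s) \<partial>Pn)" for j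
  note W_def' = block_weight.W_def[OF bw, folded W_def]
  note \<sigma>_def' = block_weight.\<sigma>_def[OF bw, folded W_def \<sigma>_def]
  note Y_def' = block_weight.Y_def[OF bw, folded W_def Y_def]
  note S_def' = block_weight.S_def[OF bw, folded \<sigma>_def S_def]
  note W_bounds = block_weight.W_bounds[OF bw, folded W_def]
  note W_meas = block_weight.W_measurable[OF bw, folded W_def]
  note W_upd = block_weight.measurable_W_upd[OF bw, folded W_def]
  note W_Suc = block_weight.W_Suc[OF bw, folded W_def]
  note \<sigma>_psd = block_weight.\<sigma>_psd[OF bw, folded \<sigma>_def]
  note \<sigma>_trace = block_weight.\<sigma>_trace[OF bw, folded \<sigma>_def W_def]
  note \<sigma>_entropy = block_weight.\<sigma>_entropy[OF bw, folded \<sigma>_def]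
  note W_log_bounds = block_weight.W_log_bounds[OF bw, folded W_def]
  note W_log_meas = block_weight.W_log_measurable[OF bw, folded W_def]
  have chain: "(\<Sum>k<n. S j k + Y j (Suc k)) \<le> vN_entropy (fin j) + q j * log 2 (q j)" if "j < c" for j
    using block_weight.chain_total[OF bw[OF that], folded S_def Y_def]
    unfolding block_weight.final_def[OF bw[OF that]] block_weight.q_def[OF bw[OF that]] fin_def q_def .
  have Y0: "Y j 0 \<le> 0" and Yn: "Y j n = q j * log 2 (q j)" if "j < c" for j
    using block_weight.Y_0_nonpos[OF bw[OF that], folded Y_def] block_weight.Y_n[OF bw[OF that], folded Y_def]
    unfolding block_weight.q_def[OF bw[OF that]] q_def by auto
  have gi: "integrable Pn (g j)" if "j < c" for j
    using mg[OF that] g01[OF that] by (intro pp.integrable_const_bound[of _ 1] AE_I2) auto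
  have q0: "0 \<le> q j" if "j < c" for j
    unfolding q_def using g0[OF that] by (intro Bochner_Integration.integral_nonneg) auto
  have q1: "(\<Sum>j<c. q j) = 1"
  proof -
    have "(\<Sum>j<c. q j) = (\<integral>b. (\<Sum>j<c. g j b) \<partial>Pn)"
      unfolding q_def using gi by (intro Bochner_Integration.integral_sum[symmetric]) auto
    also have "\<dots> = (\<integral>b. 1 \<partial>Pn)" by (rule Bochner_Integration.integral_cong[OF refl]) (rule g1)
    finally show ?thesis by (simp add: prob_Pn)
  qed
  have W1: "(\<Sum>j<c. W j k a) = 1" if a: "a \<in> space Pn" for k a
  proof -
    have "(\<Sum>j<c. W j k a) = (\<Sum>j<c. \<integral>b. g j (mix k b a) \<partial>Pn)" by (intro sum.cong) (auto simp: W_def')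
    also have "\<dots> = (\<integral>b. (\<Sum>j<c. g j (mix k b a)) \<partial>Pn)"
      using block_weight.integrable_g_mix[OF bw a] by (intro Bochner_Integration.integral_sum[symmetric]) auto
    also have "\<dots> = (\<integral>b. 1 \<partial>Pn)" by (rule Bochner_Integration.integral_cong[OF refl]) (rule g1[OF mix_space[OF a]])
    finally show ?thesis by (simp add: prob_Pn)
  qed
  \<comment> \<open>Each of the \<open>n\<close> positions is drawn with probability
    \<open>\<mu>\<close>. The remaining mass \<open>1 - lam\<close> is spread evenly over the labels
    at the flag position \<open>n\<close>.\<close>
  define \<mu> where "\<mu> = lam / real n"
  define \<beta> where "\<beta> = (1 - lam) / real c"
  have \<mu>: "0 \<le> \<mu>" "\<mu> \<le> 1" and \<beta>: "0 \<le> \<beta>" "\<beta> \<le> 1" and n\<mu>: "real n * \<mu> = lam" and c\<beta>: "real c * \<beta> = 1 - lam"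
    using lam n c by (auto simp: \<mu>_def \<beta>_def field_simps)
  define I where "I = {..n} \<times> {..<c}"
  \<comment> \<open>The symbols of \<open>M_quantity\<close> have first component a real sequence;
    position and label occupy its first two entries.\<close>
  define enc where "enc p = (\<lambda>i::nat. if i = 0 then real (fst p) else real (snd p))" for p :: "nat \<times> nat"
  define dec where "dec f = (nat \<lfloor>f 0\<rfloor>, nat \<lfloor>f (1::nat)\<rfloor>)" for f :: "nat \<Rightarrow> real"
  have dec_enc[simp]: "dec (enc p) = p" for p by (simp add: dec_def enc_def)
  have inj: "inj_on enc I" by (rule inj_on_inverseI[of _ dec]) simp
  define K where "K = enc ` I"
  have finK: "finite K" by (simp add: K_def I_def)
  have sumK: "(\<Sum>\<kappa>\<in>K. f (dec \<kappa>)) = (\<Sum>k<n. \<Sum>j<c. f (k, j)) + (\<Sum>j<c. f (n, j))" for f :: "nat \<times> nat \<Rightarrow> real"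
  proof -
    have "(\<Sum>\<kappa>\<in>K. f (dec \<kappa>)) = (\<Sum>p\<in>I. f p)" unfolding K_def by (subst sum.reindex[OF inj]) simp
    also have "\<dots> = (\<Sum>k\<le>n. \<Sum>j<c. f (k, j))" unfolding I_def by (simp add: sum.cartesian_product)
    finally show ?thesis by (simp add: lessThan_Suc_atMost[symmetric])
  qed
  have decK: "snd (dec \<kappa>) < c" "fst (dec \<kappa>) \<le> n" if "\<kappa> \<in> K" for \<kappa> using that by (auto simp: K_def I_def)
  define N where "N = count_space K \<Otimes>\<^sub>M Pn"
  \<comment> \<open>No letter of \<open>a\<close> up to \<open>k\<close> enters: \<open>W\<close>
    averages over those below \<open>k\<close>, and the one at \<open>k\<close> is overwritten by
    the input. Carrying them along gives all positions the same symbol space.\<close>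
  define hh where "hh p \<omega> a = (if fst p < n then \<mu> * W (snd p) (fst p) (a(fst p := \<omega>)) else \<beta>)" for p :: "nat \<times> nat" and \<omega> :: 'a and a
  define h where "h \<omega> x = hh (dec (fst x)) \<omega> (snd x)" for \<omega> x
  define mm where "mm p a = (if fst p < n then \<mu> * W (snd p) (Suc (fst p)) a else \<beta>)" for p :: "nat \<times> nat" and a
  have hh01: "0 \<le> hh p \<omega> a \<and> hh p \<omega> a \<le> 1" if "snd p < c" "\<omega> \<in> space P" "a \<in> space Pn" for p \<omega> a
    using W_bounds[OF that(1) upd_space[OF that(3,2), of "fst p"], of "fst p"] \<mu> \<beta> by (auto simp: hh_def mult_le_one)
  have mm01: "0 \<le> mm p a \<and> mm p a \<le> 1" if "snd p < c" "a \<in> space Pn" for p a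
    using W_bounds[OF that, of "Suc (fst p)"] \<mu> \<beta> by (auto simp: mm_def mult_le_one)
  have mhh: "(\<lambda>x. hh p (f x) (e x)) \<in> borel_measurable M" if "snd p < c" "f \<in> measurable M P" "e \<in> measurable M Pn" for p f e and M :: "'m measure"
    unfolding hh_def using W_upd[OF that(1) _ that(3,2), of "fst p" "fst p"] by (cases "fst p < n") auto
  have mmm: "(\<lambda>a. mm p a) \<in> borel_measurable Pn" if "snd p < c" for p
    unfolding mm_def using W_meas[OF that, of "Suc (fst p)"] by (cases "fst p < n") auto
  have m_eq: "(\<integral>\<omega>. hh p \<omega> a \<partial>P) = mm p a" if "snd p < c" "a \<in> space Pn" for p a
    using W_Suc[OF that, of "fst p"] by (cases "fst p < n") (simp_all add: hh_def mm_def P.prob_space)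
  have finN: "finite_measure N"
    unfolding N_def by (rule finite_measure_pair_measure) (simp_all add: finite_measure_count_space finK pp.P.finite_measure_axioms)
  have mh: "(\<lambda>(\<omega>, x). h \<omega> x) \<in> borel_measurable (P \<Otimes>\<^sub>M N)"
  proof -
    have k: "(\<lambda>z. fst (snd z)) \<in> measurable (P \<Otimes>\<^sub>M N) (count_space K)" unfolding N_def by measurable
    have s: "(\<lambda>z. snd (snd z)) \<in> measurable (P \<Otimes>\<^sub>M N) Pn" unfolding N_def by measurable
    have "(\<lambda>z. hh (dec (fst (snd z))) (fst z) (snd (snd z))) \<in> borel_measurable (P \<Otimes>\<^sub>M N)"
      by (rule measurable_compose_countable'[where f = "\<lambda>\<kappa> z. hh (dec \<kappa>) (fst z) (snd (snd z))", OF _ k countable_finite[OF finK]])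
        (use decK in \<open>intro mhh s measurable_fst; simp\<close>)
    then show ?thesis by (simp add: case_prod_unfold h_def)
  qed
  define m where "m x = (\<integral>\<omega>. h \<omega> x \<partial>P)" for x
  have m_eq': "m (\<kappa>, a) = mm (dec \<kappa>) a" if "\<kappa> \<in> K" "a \<in> space Pn" for \<kappa> a
    using m_eq[OF decK(1)[OF that(1)] that(2)] by (simp add: m_def h_def)
  have spN: "space N = K \<times> space Pn" by (simp add: N_def space_pair_measure)
  have xlog: "\<bar>x * log 2 x\<bar> \<le> 2" if "0 \<le> x" "x \<le> 1" for x :: real
    using neg_x_log_x_bounds[OF that] by linarith
  have \<mu>x: "\<mu> * x * log 2 (\<mu> * x) = \<mu> * (x * log 2 x) + \<mu> * log 2 \<mu> * x" if "0 \<le> x" for x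
    using that \<mu> by (cases "x = 0"; cases "\<mu> = 0") (auto simp: log_mult algebra_simps)
  have iW: "integrable Pn (W j k)" if "j < c" for j k
    using W_bounds[OF that] W_meas[OF that] by (intro pp.integrable_const_bound[of _ 1] AE_I2) auto
  have iWlog: "integrable Pn (\<lambda>a. W j k a * log 2 (W j k a))" if "j < c" for j k
    using W_log_bounds[OF that] W_log_meas[OF that] by (intro pp.integrable_const_bound[of _ 2] AE_I2) auto
  \<comment> \<open>The mean of \<open>W j k\<close> is the same for adjacent \<open>k\<close>, so
    that the terms with \<open>\<mu> * log 2 \<mu>\<close> cancel in the mutual information.\<close>
  have meanW: "(\<integral>a. W j (Suc k) a \<partial>Pn) = (\<integral>a. W j k a \<partial>Pn)" if "j < c" "k < n" for j k
  proof -
    have "(\<integral>a. W j k a \<partial>Pn) = (\<integral>a. \<integral>\<omega>. W j k (a(k := \<omega>)) \<partial>P \<partial>Pn)"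
      using W_bounds[OF that(1)] by (intro resample(2)[OF that(2) W_meas[OF that(1)], where B = 1]) auto
    also have "\<dots> = (\<integral>a. W j (Suc k) a \<partial>Pn)"
      by (rule Bochner_Integration.integral_cong[OF refl]) (simp add: W_Suc that)
    finally show ?thesis ..
  qed
  have norm1: "(\<integral>x. h \<omega> x \<partial>N) = 1" if \<omega>: "\<omega> \<in> space P" for \<omega>
  proof -
    have "(\<integral>x. h \<omega> x \<partial>N) = (\<Sum>\<kappa>\<in>K. \<integral>a. h \<omega> (\<kappa>, a) \<partial>Pn)"
    proof (unfold N_def, rule integral_count_space_pair(2)[OF finK pp.P.prob_space_axioms, where B = 1])
      show "(\<lambda>a. h \<omega> (\<kappa>, a)) \<in> borel_measurable Pn" if "\<kappa> \<in> K" for \<kappa>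
        unfolding h_def fst_conv snd_conv using \<omega> by (intro mhh decK that) auto
      show "\<bar>h \<omega> (\<kappa>, a)\<bar> \<le> 1" if "\<kappa> \<in> K" "a \<in> space Pn" for \<kappa> a
        unfolding h_def using hh01[OF decK(1)[OF that(1)] \<omega> that(2)] by simp
    qed
    also have "\<dots> = (\<Sum>\<kappa>\<in>K. (\<lambda>p. \<integral>a. hh p \<omega> a \<partial>Pn) (dec \<kappa>))" by (simp add: h_def)
    also have "\<dots> = (\<Sum>k<n. \<Sum>j<c. \<integral>a. hh (k, j) \<omega> a \<partial>Pn) + (\<Sum>j<c. \<integral>a. hh (n, j) \<omega> a \<partial>Pn)" by (rule sumK)
    also have "(\<Sum>j<c. \<integral>a. hh (n, j) \<omega> a \<partial>Pn) = 1 - lam" using c\<beta> by (simp add: hh_def prob_Pn)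
    also have "(\<Sum>k<n. \<Sum>j<c. \<integral>a. hh (k, j) \<omega> a \<partial>Pn) = (\<Sum>k<n. \<mu>)"
    proof (intro sum.cong refl)
      fix k assume "k \<in> {..<n}"
      then have k: "k < n" by simp
      have "(\<Sum>j<c. \<integral>a. hh (k, j) \<omega> a \<partial>Pn) = (\<integral>a. (\<Sum>j<c. hh (k, j) \<omega> a) \<partial>Pn)"
      proof (intro Bochner_Integration.integral_sum[symmetric])
        fix j assume "j \<in> {..<c}"
        then show "integrable Pn (\<lambda>a. hh (k, j) \<omega> a)"
          using hh01[of "(k, j)" \<omega>] \<omega> by (intro pp.integrable_const_bound[of _ 1] AE_I2 mhh) auto
      qed
      also have "\<dots> = (\<integral>a. \<mu> \<partial>Pn)"
        by (rule Bochner_Integration.integral_cong[OF refl])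
          (simp add: hh_def k sum_distrib_left[symmetric] W1[OF upd_space[OF _ \<omega> k]])
      finally show "(\<Sum>j<c. \<integral>a. hh (k, j) \<omega> a \<partial>Pn) = \<mu>" by (simp add: prob_Pn)
    qed
    finally show ?thesis using n\<mu> by simp
  qed
  have intm: "(\<integral>x. m x * log 2 (m x) \<partial>N)
      = (\<Sum>k<n. \<Sum>j<c. \<mu> * Y j (Suc k) + \<mu> * log 2 \<mu> * (\<integral>a. W j k a \<partial>Pn)) + (\<Sum>j<c. \<beta> * log 2 \<beta>)"
  proof -
    have "(\<integral>x. m x * log 2 (m x) \<partial>N) = (\<integral>x. mm (dec (fst x)) (snd x) * log 2 (mm (dec (fst x)) (snd x)) \<partial>N)"
      by (rule Bochner_Integration.integral_cong[OF refl]) (auto simp: spN m_eq')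
    also have "\<dots> = (\<Sum>\<kappa>\<in>K. \<integral>a. mm (dec (fst (\<kappa>, a))) (snd (\<kappa>, a)) * log 2 (mm (dec (fst (\<kappa>, a))) (snd (\<kappa>, a))) \<partial>Pn)"
    proof (unfold N_def, rule integral_count_space_pair(2)[OF finK pp.P.prob_space_axioms, where B = 2])
      show "(\<lambda>a. mm (dec (fst (\<kappa>, a))) (snd (\<kappa>, a)) * log 2 (mm (dec (fst (\<kappa>, a))) (snd (\<kappa>, a)))) \<in> borel_measurable Pn" if "\<kappa> \<in> K" for \<kappa>
        using mmm[OF decK(1)[OF that]] by simp
      show "\<bar>mm (dec (fst (\<kappa>, a))) (snd (\<kappa>, a)) * log 2 (mm (dec (fst (\<kappa>, a))) (snd (\<kappa>, a)))\<bar> \<le> 2" if "\<kappa> \<in> K" "a \<in> space Pn" for \<kappa> a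
        using mm01[OF decK(1)[OF that(1)] that(2)] by (intro xlog) auto
    qed
    also have "\<dots> = (\<Sum>\<kappa>\<in>K. (\<lambda>p. \<integral>a. mm p a * log 2 (mm p a) \<partial>Pn) (dec \<kappa>))" by simp
    also have "\<dots> = (\<Sum>k<n. \<Sum>j<c. \<integral>a. mm (k, j) a * log 2 (mm (k, j) a) \<partial>Pn) + (\<Sum>j<c. \<integral>a. mm (n, j) a * log 2 (mm (n, j) a) \<partial>Pn)"
      by (rule sumK)
    also have "(\<Sum>j<c. \<integral>a. mm (n, j) a * log 2 (mm (n, j) a) \<partial>Pn) = (\<Sum>j<c. \<beta> * log 2 \<beta>)" by (simp add: mm_def prob_Pn)
    also have "(\<Sum>k<n. \<Sum>j<c. \<integral>a. mm (k, j) a * log 2 (mm (k, j) a) \<partial>Pn)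
        = (\<Sum>k<n. \<Sum>j<c. \<mu> * Y j (Suc k) + \<mu> * log 2 \<mu> * (\<integral>a. W j k a \<partial>Pn))"
    proof (intro sum.cong refl)
      fix k j assume "k \<in> {..<n}" "j \<in> {..<c}"
      then have kj: "k < n" "j < c" by auto
      have "(\<integral>a. mm (k, j) a * log 2 (mm (k, j) a) \<partial>Pn)
          = (\<integral>a. \<mu> * (W j (Suc k) a * log 2 (W j (Suc k) a)) + \<mu> * log 2 \<mu> * W j (Suc k) a \<partial>Pn)"
        using W_bounds[OF kj(2)] kj by (intro Bochner_Integration.integral_cong refl) (simp add: mm_def \<mu>x)
      also have "\<dots> = \<mu> * Y j (Suc k) + \<mu> * log 2 \<mu> * (\<integral>a. W j (Suc k) a \<partial>Pn)"
        using iW[OF kj(2)] iWlog[OF kj(2)] by (simp add: Y_def'[OF kj(2)])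
      finally show "(\<integral>a. mm (k, j) a * log 2 (mm (k, j) a) \<partial>Pn) = \<mu> * Y j (Suc k) + \<mu> * log 2 \<mu> * (\<integral>a. W j k a \<partial>Pn)"
        by (simp add: meanW kj)
    qed
    finally show ?thesis .
  qed
  have inth: "(\<integral>\<omega>. \<integral>x. h \<omega> x * log 2 (h \<omega> x) \<partial>N \<partial>P)
      = (\<Sum>k<n. \<Sum>j<c. \<mu> * Y j k + \<mu> * log 2 \<mu> * (\<integral>a. W j k a \<partial>Pn)) + (\<Sum>j<c. \<beta> * log 2 \<beta>)"
  proof -
    define F where "F k j \<omega> = (\<integral>a. hh (k, j) \<omega> a * log 2 (hh (k, j) \<omega> a) \<partial>Pn)" for k j \<omega>
    have inner: "(\<integral>x. h \<omega> x * log 2 (h \<omega> x) \<partial>N) = (\<Sum>k<n. \<Sum>j<c. F k j \<omega>) + (\<Sum>j<c. \<beta> * log 2 \<beta>)" if \<omega>: "\<omega> \<in> space P" for \<omega>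
    proof -
      have "(\<integral>x. h \<omega> x * log 2 (h \<omega> x) \<partial>N) = (\<Sum>\<kappa>\<in>K. \<integral>a. h \<omega> (\<kappa>, a) * log 2 (h \<omega> (\<kappa>, a)) \<partial>Pn)"
      proof (unfold N_def, rule integral_count_space_pair(2)[OF finK pp.P.prob_space_axioms, where B = 2])
        show "(\<lambda>a. h \<omega> (\<kappa>, a) * log 2 (h \<omega> (\<kappa>, a))) \<in> borel_measurable Pn" if "\<kappa> \<in> K" for \<kappa>
        proof -
          have "(\<lambda>a. h \<omega> (\<kappa>, a)) \<in> borel_measurable Pn"
            unfolding h_def fst_conv snd_conv using \<omega> by (intro mhh decK that) auto
          then show ?thesis by simp
        qed
        show "\<bar>h \<omega> (\<kappa>, a) * log 2 (h \<omega> (\<kappa>, a))\<bar> \<le> 2" if "\<kappa> \<in> K" "a \<in> space Pn" for \<kappa> a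
          unfolding h_def using hh01[OF decK(1)[OF that(1)] \<omega> that(2)] by (intro xlog) auto
      qed
      also have "\<dots> = (\<Sum>\<kappa>\<in>K. (\<lambda>p. \<integral>a. hh p \<omega> a * log 2 (hh p \<omega> a) \<partial>Pn) (dec \<kappa>))" by (simp add: h_def)
      also have "\<dots> = (\<Sum>k<n. \<Sum>j<c. F k j \<omega>) + (\<Sum>j<c. \<integral>a. hh (n, j) \<omega> a * log 2 (hh (n, j) \<omega> a) \<partial>Pn)"
        unfolding F_def by (rule sumK)
      finally show ?thesis by (simp add: hh_def prob_Pn)
    qed
    \<comment> \<open>Averaging over the input letter and over the block into which it is inserted
      is averaging over one source block, by \<open>resample\<close>.\<close>
    have F: "(\<integral>\<omega>. F k j \<omega> \<partial>P) = \<mu> * Y j k + \<mu> * log 2 \<mu> * (\<integral>a. W j k a \<partial>Pn)" "integrable P (F k j)"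
      if kj: "k < n" "j < c" for k j
    proof -
      define f where "f a = \<mu> * W j k a * log 2 (\<mu> * W j k a)" for a
      have mf: "f \<in> borel_measurable Pn" unfolding f_def[abs_def] using W_meas[OF kj(2)] by measurable
      have Bf: "norm (f a) \<le> 2" if "a \<in> space Pn" for a
        unfolding f_def using W_bounds[OF kj(2) that, of k] \<mu> by (simp, intro xlog) (auto simp: mult_le_one)
      have Ff: "F k j \<omega> = (\<integral>a. f (a(k := \<omega>)) \<partial>Pn)" for \<omega>
        using kj by (simp add: F_def f_def hh_def)
      have "(\<integral>\<omega>. F k j \<omega> \<partial>P) = (\<integral>a. f a \<partial>Pn)" unfolding Ff by (rule resample(3)[OF kj(1) mf Bf, symmetric])
      also have "\<dots> = (\<integral>a. \<mu> * (W j k a * log 2 (W j k a)) + \<mu> * log 2 \<mu> * W j k a \<partial>Pn)"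
        using W_bounds[OF kj(2)] by (intro Bochner_Integration.integral_cong refl) (simp add: f_def \<mu>x)
      also have "\<dots> = \<mu> * Y j k + \<mu> * log 2 \<mu> * (\<integral>a. W j k a \<partial>Pn)"
        using iW[OF kj(2)] iWlog[OF kj(2)] by (simp add: Y_def'[OF kj(2)])
      finally show "(\<integral>\<omega>. F k j \<omega> \<partial>P) = \<mu> * Y j k + \<mu> * log 2 \<mu> * (\<integral>a. W j k a \<partial>Pn)" .
      show "integrable P (F k j)"
        using PnP.integrable_snd[of "\<lambda>a \<omega>. f (a(k := \<omega>))"] resample(1)[OF kj(1) mf Bf]
        by (simp add: case_prod_unfold Ff[abs_def])
    qed
    have iF: "integrable P (\<lambda>\<omega>. \<Sum>j<c. F k j \<omega>)" if "k < n" for k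
      using F(2)[OF that] by (intro Bochner_Integration.integrable_sum) auto
    have "(\<integral>\<omega>. \<integral>x. h \<omega> x * log 2 (h \<omega> x) \<partial>N \<partial>P) = (\<integral>\<omega>. (\<Sum>k<n. \<Sum>j<c. F k j \<omega>) + (\<Sum>j<c. \<beta> * log 2 \<beta>) \<partial>P)"
      by (rule Bochner_Integration.integral_cong[OF refl]) (rule inner)
    also have "\<dots> = (\<integral>\<omega>. (\<Sum>k<n. \<Sum>j<c. F k j \<omega>) \<partial>P) + (\<Sum>j<c. \<beta> * log 2 \<beta>)"
      using iF by (subst Bochner_Integration.integral_add) (auto simp: P.prob_space F(2) intro!: Bochner_Integration.integrable_sum)
    also have "(\<integral>\<omega>. (\<Sum>k<n. \<Sum>j<c. F k j \<omega>) \<partial>P) = (\<Sum>k<n. \<integral>\<omega>. (\<Sum>j<c. F k j \<omega>) \<partial>P)"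
      using iF by (intro Bochner_Integration.integral_sum) auto
    also have "\<dots> = (\<Sum>k<n. \<Sum>j<c. \<integral>\<omega>. F k j \<omega> \<partial>P)"
      using F(2) by (intro sum.cong refl Bochner_Integration.integral_sum) auto
    also have "\<dots> = (\<Sum>k<n. \<Sum>j<c. \<mu> * Y j k + \<mu> * log 2 \<mu> * (\<integral>a. W j k a \<partial>Pn))"
      using F(1) by (intro sum.cong refl) auto
    finally show ?thesis .
  qed
  have telescope: "(\<Sum>k<n. Y j k - Y j (Suc k)) = Y j 0 - Y j n" for j
    by (rule sum_lessThan_telescope')
  \<comment> \<open>The flag terms and the terms with \<open>\<mu> * log 2 \<mu>\<close> cancel.
    What remains for each label telescopes over the positions to at most
    \<open>- q j * log 2 (q j)\<close>, and summing over the labels gives the entropy of the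
    label.\<close>
  have "(\<integral>\<omega>. \<integral>x. h \<omega> x * log 2 (h \<omega> x) \<partial>N \<partial>P) - (\<integral>x. m x * log 2 (m x) \<partial>N)
      = (\<Sum>k<n. \<Sum>j<c. \<mu> * (Y j k - Y j (Suc k)))"
    unfolding inth intm by (simp add: sum_subtractf[symmetric] right_diff_distrib)
  also have "\<dots> = (\<Sum>j<c. \<mu> * (Y j 0 - Y j n))"
    by (subst sum.swap) (simp add: sum_distrib_left[symmetric] telescope)
  also have "\<dots> \<le> (\<Sum>j<c. \<mu> * - (q j * log 2 (q j)))"
    using Y0 Yn \<mu> by (intro sum_mono mult_left_mono) auto
  also have "\<dots> = \<mu> * (\<Sum>j<c. - (q j * log 2 (q j)))" by (simp only: sum_distrib_left)
  also have "\<dots> \<le> \<mu> * log 2 (real c)"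
    using \<mu> by (intro mult_left_mono entropy_le_log_card q0 q1 c)
  also have "\<dots> \<le> R" using rate n by (simp add: \<mu>_def field_simps)
  finally have rate': "(\<integral>\<omega>. \<integral>x. h \<omega> x * log 2 (h \<omega> x) \<partial>N \<partial>P) - (\<integral>x. m x * log 2 (m x) \<partial>N) \<le> R" .
  have "M_quantity P \<phi> d R \<le> ereal (\<integral>x. vN_entropy (mat d d (\<lambda>(i,l). \<integral>\<omega>. of_real (h \<omega> x) * \<phi> \<omega> $$ (i, l) \<partial>P)) + m x * log 2 (m x) \<partial>N)"
  proof (rule M_quantity_le_density[OF src finN mh _ norm1 m_def rate'])
    show "0 \<le> h \<omega> x \<and> h \<omega> x \<le> 1" if "\<omega> \<in> space P" "x \<in> space N" for \<omega> x
      unfolding h_def using that by (intro hh01 decK) (auto simp: spN)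
  qed
  \<comment> \<open>The flag reveals nothing about the letter, so its conditional state is the
    unconditional mean, with entropy at most \<open>log 2 d\<close>.\<close>
  define avg where "avg = mat d d (\<lambda>(i,l). \<integral>\<omega>. \<phi> \<omega> $$ (i, l) \<partial>P)"
  have "avg = mat d d (\<lambda>(i,l). \<integral>\<omega>. of_real 1 * \<phi> \<omega> $$ (i, l) \<partial>P)" by (simp add: avg_def)
  then have psd_avg: "psd d avg" and tr_avg: "mtrace avg = of_real 1"
    using weighted_mixture(2,3)[OF P.prob_space_axioms pure_state_density[OF pure] m\<phi>, of "\<lambda>_. 1"]
    by (simp_all add: P.prob_space)
  define J where "J p a = (if fst p < n then \<mu> * (vN_entropy (\<sigma> (snd p) (fst p) a) + W (snd p) (Suc (fst p)) a * log 2 (W (snd p) (Suc (fst p)) a))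
      else \<beta> * vN_entropy avg)" for p :: "nat \<times> nat" and a
  have J: "vN_entropy (mat d d (\<lambda>(i,l). \<integral>\<omega>. of_real (h \<omega> (\<kappa>, a)) * \<phi> \<omega> $$ (i, l) \<partial>P)) + m (\<kappa>, a) * log 2 (m (\<kappa>, a)) = J (dec \<kappa>) a"
    if \<kappa>: "\<kappa> \<in> K" and a: "a \<in> space Pn" for \<kappa> a
  proof (cases "fst (dec \<kappa>) < n")
    case True
    have "mat d d (\<lambda>(i,l). \<integral>\<omega>. of_real (h \<omega> (\<kappa>, a)) * \<phi> \<omega> $$ (i, l) \<partial>P) $$ (i, l) = of_real \<mu> * \<sigma> (snd (dec \<kappa>)) (fst (dec \<kappa>)) a $$ (i, l)"
      if "i < d" "l < d" for i l
      using that True by (simp add: h_def hh_def \<sigma>_def'[OF decK(1)[OF \<kappa>]] mult.assoc)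
    from homogeneous_entropy[OF \<sigma>_psd[OF decK(1)[OF \<kappa>] a True] _ \<sigma>_trace[OF decK(1)[OF \<kappa>] a True] \<mu>(1) this]
    show ?thesis using True by (simp add: m_eq'[OF \<kappa> a] mm_def J_def)
  next
    case False
    have "mat d d (\<lambda>(i,l). \<integral>\<omega>. of_real (h \<omega> (\<kappa>, a)) * \<phi> \<omega> $$ (i, l) \<partial>P) $$ (i, l) = of_real \<beta> * avg $$ (i, l)"
      if "i < d" "l < d" for i l
      using that False by (simp add: h_def hh_def avg_def)
    from homogeneous_entropy[OF psd_avg _ tr_avg \<beta>(1) this]
    show ?thesis using False by (simp add: m_eq'[OF \<kappa> a] mm_def J_def)
  qed
  have "(\<integral>x. vN_entropy (mat d d (\<lambda>(i,l). \<integral>\<omega>. of_real (h \<omega> x) * \<phi> \<omega> $$ (i, l) \<partial>P)) + m x * log 2 (m x) \<partial>N)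
      = (\<integral>x. J (dec (fst x)) (snd x) \<partial>N)"
    by (rule Bochner_Integration.integral_cong[OF refl]) (auto simp: spN J)
  also have "\<dots> = (\<Sum>\<kappa>\<in>K. \<integral>a. J (dec (fst (\<kappa>, a))) (snd (\<kappa>, a)) \<partial>Pn)"
  proof (unfold N_def, rule integral_count_space_pair(2)[OF finK pp.P.prob_space_axioms, where B = "\<mu> * (2 * real d + 2) + \<bar>\<beta> * vN_entropy avg\<bar>"])
    fix \<kappa> assume \<kappa>: "\<kappa> \<in> K"
    show "(\<lambda>a. J (dec (fst (\<kappa>, a))) (snd (\<kappa>, a))) \<in> borel_measurable Pn"
      using \<sigma>_entropy(1)[OF decK(1)[OF \<kappa>], of "fst (dec \<kappa>)"] W_log_meas[OF decK(1)[OF \<kappa>], of "Suc (fst (dec \<kappa>))"]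
      unfolding J_def by (cases "fst (dec \<kappa>) < n") simp_all
    fix a assume a: "a \<in> space Pn"
    show "\<bar>J (dec (fst (\<kappa>, a))) (snd (\<kappa>, a))\<bar> \<le> \<mu> * (2 * real d + 2) + \<bar>\<beta> * vN_entropy avg\<bar>"
    proof (cases "fst (dec \<kappa>) < n")
      case True
      have "\<bar>vN_entropy (\<sigma> (snd (dec \<kappa>)) (fst (dec \<kappa>)) a) + W (snd (dec \<kappa>)) (Suc (fst (dec \<kappa>))) a * log 2 (W (snd (dec \<kappa>)) (Suc (fst (dec \<kappa>))) a)\<bar> \<le> 2 * real d + 2"
        using \<sigma>_entropy(2)[OF decK(1)[OF \<kappa>] True a] W_log_bounds(1)[OF decK(1)[OF \<kappa>] a, of "Suc (fst (dec \<kappa>))"] by linarith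
      then show ?thesis using True \<mu> by (simp add: J_def abs_mult add_increasing2 mult_left_mono)
    next
      case False
      then show ?thesis using \<mu> by (simp add: J_def)
    qed
  qed
  also have "\<dots> = (\<Sum>\<kappa>\<in>K. (\<lambda>p. \<integral>a. J p a \<partial>Pn) (dec \<kappa>))" by simp
  also have "\<dots> = (\<Sum>k<n. \<Sum>j<c. \<integral>a. J (k, j) a \<partial>Pn) + (\<Sum>j<c. \<integral>a. J (n, j) a \<partial>Pn)" by (rule sumK)
  also have "(\<Sum>j<c. \<integral>a. J (n, j) a \<partial>Pn) = (1 - lam) * vN_entropy avg" using c\<beta> by (simp add: J_def prob_Pn)
  also have "(\<Sum>k<n. \<Sum>j<c. \<integral>a. J (k, j) a \<partial>Pn) = (\<Sum>k<n. \<Sum>j<c. \<mu> * (S j k + Y j (Suc k)))"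
  proof (intro sum.cong refl)
    fix k j assume "k \<in> {..<n}" "j \<in> {..<c}"
    then have kj: "k < n" "j < c" by auto
    have "integrable Pn (\<lambda>a. vN_entropy (\<sigma> j k a))"
      using \<sigma>_entropy[OF kj(2,1)] by (intro pp.integrable_const_bound[of _ "2 * real d"] AE_I2) auto
    then show "(\<integral>a. J (k, j) a \<partial>Pn) = \<mu> * (S j k + Y j (Suc k))"
      using iWlog[OF kj(2), of "Suc k"] kj by (simp add: J_def S_def'[OF kj(2)] Y_def'[OF kj(2)])
  qed
  also have "\<dots> = \<mu> * (\<Sum>j<c. \<Sum>k<n. S j k + Y j (Suc k))"
    by (subst sum.swap) (simp only: sum_distrib_left)
  also have "\<dots> + (1 - lam) * vN_entropy avg \<le> \<mu> * (\<Sum>j<c. vN_entropy (fin j) + q j * log 2 (q j)) + (1 - lam) * log 2 (real d)"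
  proof (intro add_mono mult_left_mono sum_mono)
    show "vN_entropy avg \<le> log 2 (real d)"
      using vN_entropy_le_log_dim[OF psd_avg d_pos refl] tr_avg by simp
  qed (use chain \<mu> lam in auto)
  finally have "(\<integral>x. vN_entropy (mat d d (\<lambda>(i,l). \<integral>\<omega>. of_real (h \<omega> x) * \<phi> \<omega> $$ (i, l) \<partial>P)) + m x * log 2 (m x) \<partial>N)
      \<le> \<mu> * (\<Sum>j<c. vN_entropy (fin j) + q j * log 2 (q j)) + (1 - lam) * log 2 (real d)" .
  then show ?thesis
    using \<open>M_quantity P \<phi> d R \<le> _\<close> unfolding \<mu>_def fin_def q_def by (meson ereal_less_eq(3) order_trans)
qed

end

section \<open>Entropy bound for a code\<close>

lemma quad_cong: "(\<And>r s. r < N \<Longrightarrow> s < N \<Longrightarrow> A r s = B r s) \<Longrightarrow> quad N A v = quad N B v"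
  unfolding quad_def by (intro sum.cong refl) simp

lemma cptp_psd:
  assumes D: "cptp Nin Nout D" and A: "psd Nin A"
  shows "psd Nout (D A)"
proof -
  have cA: "A \<in> carrier_mat Nin Nin" using A by (simp add: psd_def)
  then have cD: "D A \<in> carrier_mat Nout Nout" using D by (simp add: cptp_def)
  have "psd (1 * Nin) A" using A by simp
  then have "psd (1 * Nout) (ampl 1 Nin Nout D A)" using D unfolding cptp_def by blast
  moreover have "ampl 1 Nin Nout D A = D A"
  proof -
    have "mat Nin Nin (\<lambda>(r,s). A $$ (0 * Nin + r, 0 * Nin + s)) = A" using cA by (intro eq_matI) auto
    then show ?thesis using cD unfolding ampl_def by (intro eq_matI) auto
  qed
  ultimately show ?thesis by simp
qed

lemma cptp_diff:
  assumes D: "cptp Nin Nout D" and A: "A \<in> carrier_mat Nin Nin" and B: "B \<in> carrier_mat Nin Nin"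
    and rs: "r < Nout" "s < Nout"
  shows "D (A + (-1) \<cdot>\<^sub>m B) $$ (r, s) = D A $$ (r, s) - D B $$ (r, s)"
proof -
  have "D (A + (-1) \<cdot>\<^sub>m B) = D A + (-1) \<cdot>\<^sub>m D B" using D A B unfolding cptp_def by (metis smult_carrier_mat)
  moreover have "D A \<in> carrier_mat Nout Nout" "D B \<in> carrier_mat Nout Nout" using D A B by (auto simp: cptp_def)
  ultimately show ?thesis using rs by simp
qed

definition unit_mat :: "nat \<Rightarrow> nat \<times> nat \<Rightarrow> complex mat" where
  "unit_mat N p = mat N N (\<lambda>ij. if ij = p then 1 else 0)"

text \<open>The entries of \<open>D A\<close> are fixed linear combinations of those of
  \<open>A\<close>; this makes the decoded state a measurable function of the encoder's
  output.\<close>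

lemma cptp_expand:
  assumes D: "cptp Nin Nout D" and A: "A \<in> carrier_mat Nin Nin" and ik: "i < Nout" "k < Nout"
  shows "D A $$ (i, k) = (\<Sum>p\<in>{..<Nin} \<times> {..<Nin}. A $$ p * D (unit_mat Nin p) $$ (i, k))"
proof -
  have D1: "D (X + Y) $$ (i, k) = D X $$ (i, k) + D Y $$ (i, k)" if "X \<in> carrier_mat Nin Nin" "Y \<in> carrier_mat Nin Nin" for X Y
  proof -
    have "D (X + Y) = D X + D Y" "D X \<in> carrier_mat Nout Nout" "D Y \<in> carrier_mat Nout Nout"
      using D that by (auto simp: cptp_def)
    then show ?thesis using ik by simp
  qed
  have D2: "D (z \<cdot>\<^sub>m X) $$ (i, k) = z * D X $$ (i, k)" if "X \<in> carrier_mat Nin Nin" for z X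
  proof -
    have "D (z \<cdot>\<^sub>m X) = z \<cdot>\<^sub>m D X" "D X \<in> carrier_mat Nout Nout" using D that by (auto simp: cptp_def)
    then show ?thesis using ik by simp
  qed
  have u: "unit_mat Nin p \<in> carrier_mat Nin Nin" for p by (simp add: unit_mat_def)
  have "D (mat Nin Nin (\<lambda>ij. if ij \<in> Z then A $$ ij else 0)) $$ (i, k) = (\<Sum>p\<in>Z. A $$ p * D (unit_mat Nin p) $$ (i, k))"
    if "finite Z" for Z
    using that
  proof (induction Z rule: finite_induct)
    case empty
    have "mat Nin Nin (\<lambda>ij. if ij \<in> {} then A $$ ij else 0) = 0 \<cdot>\<^sub>m A" using A by (intro eq_matI) auto
    then show ?case using D2[OF A, of 0] by simp
  next
    case (insert p Z)
    have "mat Nin Nin (\<lambda>ij. if ij \<in> insert p Z then A $$ ij else 0)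
        = mat Nin Nin (\<lambda>ij. if ij \<in> Z then A $$ ij else 0) + A $$ p \<cdot>\<^sub>m unit_mat Nin p"
      using insert(2) by (intro eq_matI) (auto simp: unit_mat_def)
    then show ?case using insert D1[of "mat Nin Nin (\<lambda>ij. if ij \<in> Z then A $$ ij else 0)" "A $$ p \<cdot>\<^sub>m unit_mat Nin p"] D2[OF u]
      by (simp add: u add.commute)
  qed
  from this[of "{..<Nin} \<times> {..<Nin}"] have "D (mat Nin Nin (\<lambda>ij. if ij \<in> {..<Nin} \<times> {..<Nin} then A $$ ij else 0)) $$ (i, k)
      = (\<Sum>p\<in>{..<Nin} \<times> {..<Nin}. A $$ p * D (unit_mat Nin p) $$ (i, k))" by simp
  moreover have "mat Nin Nin (\<lambda>ij. if ij \<in> {..<Nin} \<times> {..<Nin} then A $$ ij else 0) = A" using A by (intro eq_matI) auto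
  ultimately show ?thesis by simp
qed

lemma space_state_space: "space (state_space N) = Collect (density N)"
  by (simp add: state_space_def)

lemma state_space_entry:
  assumes "r < N" "s < N"
  shows "(\<lambda>\<rho>. \<rho> $$ (r, s)) \<in> borel_measurable (state_space N)"
proof -
  let ?f = "\<lambda>\<rho>::complex mat. restrict (\<lambda>ij. \<rho> $$ ij) ({..<N} \<times> {..<N})"
  have "?f \<in> measurable (state_space N) (PiM ({..<N} \<times> {..<N}) (\<lambda>_. borel))"
    unfolding state_space_def by (rule measurable_vimage_algebra1) (auto simp: space_PiM)
  from measurable_compose[OF this measurable_component_singleton[of "(r, s)"]] assms show ?thesis by simp
qed

lemma kron_proj_index:
  assumes A: "A \<in> carrier_mat m m" and "x < m" "x' < m" "y < c" "y' < c"
  shows "kron A (proj_basis c i) $$ (x * c + y, x' * c + y') = (if y = i \<and> y' = i then A $$ (x, x') else 0)"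
proof -
  have P: "proj_basis c i \<in> carrier_mat c c" by (simp add: proj_basis_def)
  show ?thesis
    using assms(2-) by (subst kron_index[OF A P]) (auto simp: mult_add_less proj_basis_def)
qed

lemma quad_kron_proj:
  assumes A: "A \<in> carrier_mat m m" and i: "i < c"
  shows "quad (m * c) (mfun (kron A (proj_basis c i))) v = quad m (mfun A) (\<lambda>x. v (x * c + i))"
proof -
  have delta: "(\<Sum>y<c. if y = i then f y else 0) = f i" for f :: "nat \<Rightarrow> complex" using i by simp
  have "quad (m * c) (mfun (kron A (proj_basis c i))) v
      = (\<Sum>x<m. \<Sum>y<c. \<Sum>x'<m. \<Sum>y'<c. if y' = i then (if y = i then cnj (v (x * c + y)) * A $$ (x, x') * v (x' * c + y') else 0) else 0)"
    unfolding quad_def sum_lessThan_mult mfun_def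
    by (intro sum.cong refl) (auto simp: kron_proj_index[OF A])
  also have "\<dots> = (\<Sum>x<m. \<Sum>y<c. \<Sum>x'<m. (if y = i then cnj (v (x * c + y)) * A $$ (x, x') * v (x' * c + i) else 0))"
    by (simp only: delta)
  also have "\<dots> = (\<Sum>x<m. \<Sum>x'<m. \<Sum>y<c. (if y = i then cnj (v (x * c + y)) * A $$ (x, x') * v (x' * c + i) else 0))"
    by (intro sum.cong refl sum.swap)
  also have "\<dots> = (\<Sum>x<m. \<Sum>x'<m. cnj (v (x * c + i)) * A $$ (x, x') * v (x' * c + i))"
    by (simp only: delta)
  finally show ?thesis by (simp add: quad_def mfun_def)
qed

lemma density_kron_proj:
  assumes A: "density m A" and i: "i < c"
  shows "density (m * c) (kron A (proj_basis c i))"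
proof -
  have pA: "psd m A" and tA: "mtrace A = 1" using A by (auto simp: density_def)
  have cA: "A \<in> carrier_mat m m" using pA by (simp add: psd_def)
  have P: "proj_basis c i \<in> carrier_mat c c" by (simp add: proj_basis_def)
  have cK: "kron A (proj_basis c i) \<in> carrier_mat (m * c) (m * c)" using cA P by (simp add: kron_def)
  have "psd (m * c) (kron A (proj_basis c i))"
    unfolding psd_iff_quad
  proof (intro conjI allI impI cK)
    fix r s assume rs: "r < m * c" "s < m * c"
    have "A $$ (r div c, s div c) = cnj (A $$ (s div c, r div c))"
      using pA div_mod_less[OF rs(1)] div_mod_less[OF rs(2)] unfolding psd_iff_quad mfun_def by blast
    then show "mfun (kron A (proj_basis c i)) r s = cnj (mfun (kron A (proj_basis c i)) s r)"
      using div_mod_less[OF rs(1)] div_mod_less[OF rs(2)]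
      unfolding mfun_def kron_index[OF cA P rs] kron_index[OF cA P rs(2,1)] by (simp add: proj_basis_def)
  next
    fix v
    show "0 \<le> Re (quad (m * c) (mfun (kron A (proj_basis c i))) v)"
      unfolding quad_kron_proj[OF cA i] using pA unfolding psd_iff_quad by blast
  qed
  moreover have "mtrace (kron A (proj_basis c i)) = 1"
  proof -
    have "mtrace (kron A (proj_basis c i)) = (\<Sum>x<m. \<Sum>y<c. if y = i then A $$ (x, x) else 0)"
      using carrier_matD[OF cK] unfolding mtrace_def sum_lessThan_mult carrier_matD[OF cK]
      by (intro sum.cong refl) (auto simp: kron_proj_index[OF cA])
    also have "\<dots> = mtrace A" using i carrier_matD[OF cA] by (simp add: mtrace_def)
    finally show ?thesis using tA by simp
  qed
  ultimately show ?thesis by (simp add: density_def)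
qed

lemma density_quad_le:
  assumes A: "density N A"
  shows "Re (quad N (mfun A) v) \<le> (\<Sum>i<N. (cmod (v i))\<^sup>2)"
proof -
  have pA: "psd N A" and tA: "mtrace A = 1" using A by (auto simp: density_def)
  have cA: "A \<in> carrier_mat N N" using pA by (simp add: psd_def)
  obtain u l where ul: "spectral N (mfun A) u l" and l: "\<And>i. i < N \<Longrightarrow> 0 \<le> l i"
    using psd_spectral[OF pA] by blast
  have "complex_of_real (\<Sum>i<N. l i) = of_real 1" using tA by (simp add: mtrace_spectral[OF cA ul])
  then have sl: "(\<Sum>i<N. l i) = 1" by (simp only: of_real_eq_iff)
  have l1: "l i \<le> 1" if "i < N" for i using member_le_sum[of i "{..<N}" l] that l sl by simp
  have "Re (quad N (mfun A) v) = (\<Sum>i<N. l i * (cmod (ip N (u i) v))\<^sup>2)" by (simp add: quad_spectral[OF ul])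
  also have "\<dots> \<le> (\<Sum>i<N. 1 * (cmod (ip N (u i) v))\<^sup>2)" using l1 by (intro sum_mono mult_right_mono) auto
  also have "\<dots> = (\<Sum>i<N. (cmod (v i))\<^sup>2)" using ul by (simp add: onb_parseval_norm spectral_def)
  finally show ?thesis .
qed

lemma mtrace_mult:
  assumes "A \<in> carrier_mat N N" "B \<in> carrier_mat N N"
  shows "mtrace (A * B) = (\<Sum>i<N. \<Sum>k<N. A $$ (i, k) * B $$ (k, i))"
  using assms by (simp add: mtrace_def scalar_prod_def atLeast0LessThan)

text \<open>The classical labels sharing a \<open>\<kappa>\<close>-value are treated as part of the quantum system: \<open>\<kappa> = id\<close> keeps
  all labels classical, a constant \<open>\<kappa>\<close> absorbs them all, as is needed at rate \<open>R = 0\<close>.\<close>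
definition class_proj :: "nat \<Rightarrow> nat \<Rightarrow> (nat \<Rightarrow> nat) \<Rightarrow> nat \<Rightarrow> complex mat" where
  "class_proj m c \<kappa> j = mat (m * c) (m * c) (\<lambda>(r, s). if r = s \<and> \<kappa> (r mod c) = j then 1 else 0)"

lemma quad_class_proj:
  "quad (m * c) (mfun (class_proj m c \<kappa> j)) v = of_real (\<Sum>r<m*c. if \<kappa> (r mod c) = j then (cmod (v r))\<^sup>2 else 0)"
proof -
  have "quad (m * c) (mfun (class_proj m c \<kappa> j)) v
      = (\<Sum>r<m*c. \<Sum>s<m*c. if s = r then (if \<kappa> (r mod c) = j then cnj (v r) * v s else 0) else 0)"
    unfolding quad_def by (intro sum.cong refl) (auto simp: mfun_def class_proj_def)
  also have "\<dots> = (\<Sum>r<m*c. of_real (if \<kappa> (r mod c) = j then (cmod (v r))\<^sup>2 else 0))"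
  proof (intro sum.cong refl)
    fix r assume "r \<in> {..<m*c}"
    then show "(\<Sum>s<m*c. if s = r then (if \<kappa> (r mod c) = j then cnj (v r) * v s else 0) else 0)
        = of_real (if \<kappa> (r mod c) = j then (cmod (v r))\<^sup>2 else 0)"
      using complex_norm_square[of "v r"] by (simp add: mult.commute del: of_real_power)
  qed
  finally show ?thesis by simp
qed

lemma psd_class_proj: "psd (m * c) (class_proj m c \<kappa> j)"
  unfolding psd_iff_quad quad_class_proj
  by (auto simp: class_proj_def mfun_def intro!: sum_nonneg)

lemma mtrace_class_proj: "mtrace (class_proj m c \<kappa> j) = of_nat (m * card {y. y < c \<and> \<kappa> y = j})"
proof -
  have "mtrace (class_proj m c \<kappa> j) = (\<Sum>x<m. \<Sum>y<c. if \<kappa> y = j then 1 else 0)"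
    unfolding mtrace_def class_proj_def dim_row_mat sum_lessThan_mult
    by (intro sum.cong refl) (auto simp: mult_add_less)
  also have "(\<Sum>y<c. if \<kappa> y = j then 1 else 0 :: complex) = of_nat (card {y. y < c \<and> \<kappa> y = j})"
    by (simp add: sum.If_cases lessThan_def Int_def)
  finally show ?thesis by simp
qed

text \<open>A density matrix lies below the identity, and the projection onto label \<open>i\<close>
  below the one onto its whole class. Applying the decoder to this difference yields the comparison
  of \<open>X\<close> with \<open>T\<close>.\<close>

lemma psd_class_proj_diff:
  assumes A: "density m A" and i: "i < c"
  shows "psd (m * c) (class_proj m c \<kappa> (\<kappa> i) + (-1) \<cdot>\<^sub>m kron A (proj_basis c i))"
proof -
  define K where "K = kron A (proj_basis c i)"
  define U where "U = class_proj m c \<kappa> (\<kappa> i)"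
  have pK: "psd (m * c) K" using density_kron_proj[OF A i] by (simp add: K_def density_def)
  have pU: "psd (m * c) U" unfolding U_def by (rule psd_class_proj)
  have cA: "A \<in> carrier_mat m m" using A by (simp add: density_def psd_def)
  have c: "K \<in> carrier_mat (m * c) (m * c)" "U \<in> carrier_mat (m * c) (m * c)" using pK pU by (auto simp: psd_def)
  have e: "mfun (U + (-1) \<cdot>\<^sub>m K) r s = mfun U r s - mfun K r s" if "r < m * c" "s < m * c" for r s
    using c that by (simp add: mfun_def)
  show ?thesis unfolding K_def[symmetric] U_def[symmetric] psd_iff_quad
  proof (intro conjI allI impI)
    show "U + (-1) \<cdot>\<^sub>m K \<in> carrier_mat (m * c) (m * c)" using c by simp
    fix r s assume rs: "r < m * c" "s < m * c"
    have "mfun U r s = cnj (mfun U s r)" "mfun K r s = cnj (mfun K s r)"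
      using pU pK rs unfolding psd_iff_quad by blast+
    then have "mfun U r s - mfun K r s = cnj (mfun U s r - mfun K s r)" by (simp only: complex_cnj_diff)
    then show "mfun (U + (-1) \<cdot>\<^sub>m K) r s = cnj (mfun (U + (-1) \<cdot>\<^sub>m K) s r)" by (simp only: e rs)
  next
    fix v
    have "quad (m * c) (mfun (U + (-1) \<cdot>\<^sub>m K)) v = quad (m * c) (\<lambda>r s. mfun U r s - mfun K r s) v"
      by (rule quad_cong) (rule e)
    also have "\<dots> = quad (m * c) (mfun U) v - quad (m * c) (mfun K) v"
      by (simp add: quad_def right_diff_distrib left_diff_distrib sum_subtractf)
    finally have q: "Re (quad (m * c) (mfun (U + (-1) \<cdot>\<^sub>m K)) v) = Re (quad (m * c) (mfun U) v) - Re (quad (m * c) (mfun K) v)" by simp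
    have "Re (quad (m * c) (mfun K) v) \<le> (\<Sum>x<m. (cmod (v (x * c + i)))\<^sup>2)"
      unfolding K_def quad_kron_proj[OF cA i] by (rule density_quad_le[OF A])
    also have "\<dots> \<le> (\<Sum>x<m. \<Sum>y<c. if \<kappa> y = \<kappa> i then (cmod (v (x * c + y)))\<^sup>2 else 0)"
    proof (rule sum_mono)
      fix x
      have "(if \<kappa> i = \<kappa> i then (cmod (v (x * c + i)))\<^sup>2 else 0) \<le> (\<Sum>y<c. if \<kappa> y = \<kappa> i then (cmod (v (x * c + y)))\<^sup>2 else 0)"
        using i by (intro member_le_sum[where f = "\<lambda>y. if \<kappa> y = \<kappa> i then (cmod (v (x * c + y)))\<^sup>2 else 0"]) auto
      then show "(cmod (v (x * c + i)))\<^sup>2 \<le> (\<Sum>y<c. if \<kappa> y = \<kappa> i then (cmod (v (x * c + y)))\<^sup>2 else 0)" by simp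
    qed
    also have "\<dots> = Re (quad (m * c) (mfun U) v)"
      unfolding U_def quad_class_proj sum_lessThan_mult Re_complex_of_real by (intro sum.cong refl) simp
    finally show "0 \<le> Re (quad (m * c) (mfun (U + (-1) \<cdot>\<^sub>m K)) v)" using q by simp
  qed
qed

section \<open>From high fidelity to an entropy bound for the labelled block states\<close>

context block_source
begin

text \<open>\<open>g j a\<close> is the probability that the encoder, given the block
  \<open>a\<close>, emits a label of class \<open>j\<close>. A smoothed spectrum of the decoded
  class projection is the reference in Gibbs' inequality; the resulting linear functional of the
  word is bounded for each single encoder output and only then averaged. As \<open>u\<close> bounds
  the size of a class, \<open>dB * u\<close> is the effective quantum dimension.\<close>

lemma code_entropy_bound:
  fixes \<kappa> :: "nat \<Rightarrow> nat" and \<epsilon> t :: real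
  assumes code: "visible_code P d n c dB E D" and fid: "code_fidelity P \<phi> d n c E D \<ge> 1 - \<epsilon>" and \<epsilon>: "\<epsilon> < 1"
    and t: "0 < t" and \<kappa>: "\<And>i. i < c \<Longrightarrow> \<kappa> i < c'" and u: "\<And>j. j < c' \<Longrightarrow> card {y. y < c \<and> \<kappa> y = j} \<le> u"
  shows "\<exists>g. (\<forall>j<c'. g j \<in> borel_measurable Pn) \<and> (\<forall>j<c'. \<forall>a\<in>space Pn. 0 \<le> g j a) \<and> (\<forall>a\<in>space Pn. (\<Sum>j<c'. g j a) = 1) \<and>
     (\<Sum>j<c'. vN_entropy (mat (d ^ n) (d ^ n) (\<lambda>(r,s). \<integral>b. of_real (g j b) * word n b $$ (r, s) \<partial>Pn))
        + (\<integral>b. g j b \<partial>Pn) * log 2 (\<integral>b. g j b \<partial>Pn))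
      \<le> (1 + t) * (log 2 (real (dB * u)) + 3) + (1 + 1 / t) * (\<epsilon> * (log 2 (real (d ^ n)) + 1))"
    and "0 < c" "0 < dB" "0 < c'"
proof -
  define CS where "CS = state_space dB \<Otimes>\<^sub>M count_space {..<c}"
  have mE: "E \<in> measurable Pn (prob_algebra CS)" and D: "cptp (dB * c) (d ^ n) D"
    using code by (auto simp: visible_code_def CS_def)
  have psE: "prob_space (E a)" and stE: "sets (E a) = sets CS" if "a \<in> space Pn" for a
    using measurable_space[OF mE that] by (auto simp: space_prob_algebra)
  have spE: "space (E a) = space CS" if "a \<in> space Pn" for a using stE[OF that] by (rule sets_eq_imp_space_eq)
  have spCS: "space CS = Collect (density dB) \<times> {..<c}" by (simp add: CS_def space_pair_measure space_state_space)
  \<comment> \<open>Positivity of the code sizes: a probability measure on the encoder's outputs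
    needs a nonempty space, and a density matrix of size 0 would have trace 0.\<close>
  obtain a0 where a0: "a0 \<in> space Pn" using pp.P.not_empty by blast
  obtain \<sigma>0 i0 where "(\<sigma>0, i0) \<in> space CS" using prob_space.not_empty[OF psE[OF a0]] spE[OF a0] by auto
  then have \<sigma>0: "density dB \<sigma>0" and i0: "i0 < c" by (auto simp: spCS)
  show c: "0 < c" using i0 by simp
  show dB: "0 < dB"
  proof (rule ccontr)
    assume "\<not> 0 < dB"
    then have "mtrace \<sigma>0 = 0" using \<sigma>0 by (auto simp: density_def psd_def mtrace_def)
    then show False using \<sigma>0 by (simp add: density_def)
  qed
  show c': "0 < c'" using \<kappa>[OF i0] by simp
  have u1: "1 \<le> u"
  proof -
    have "i0 \<in> {y. y < c \<and> \<kappa> y = \<kappa> i0}" using i0 by simp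
    then have "0 < card {y. y < c \<and> \<kappa> y = \<kappa> i0}" by (subst card_gt_0_iff) auto
    then show ?thesis using u[OF \<kappa>[OF i0]] by simp
  qed
  define N where "N = d ^ n"
  define b where "b = real (dB * u)"
  have b1: "1 \<le> b"
  proof -
    have "1 * 1 \<le> dB * u" using dB u1 by (intro mult_le_mono) auto
    then have "real 1 \<le> real (dB * u)" by (intro of_nat_mono) simp
    then show ?thesis unfolding b_def by simp
  qed
  have N0: "0 < N" using d_pos by (simp add: N_def)
  \<comment> \<open>Every decoder output whose label lies in class \<open>j\<close> is dominated by
    \<open>T j\<close>, whose trace is at most \<open>b\<close> for \<open>j < c'\<close>.\<close>
  define T where "T j = D (class_proj dB c \<kappa> j)" for j
  define X where "X x = D (kron (fst x) (proj_basis c (snd x)))" for x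
  have cU: "class_proj dB c \<kappa> j \<in> carrier_mat (dB * c) (dB * c)" for j by (simp add: class_proj_def)
  have psdT: "psd N (T j)" for j unfolding T_def N_def by (rule cptp_psd[OF D psd_class_proj])
  have cT: "T j \<in> carrier_mat N N" for j using psdT[of j] by (simp add: psd_def)
  have trT: "mtrace (T j) = of_nat (dB * card {y. y < c \<and> \<kappa> y = j})" for j
    using D cU[of j] mtrace_class_proj[of dB c \<kappa> j] unfolding T_def cptp_def by simp
  have denK: "density (dB * c) (kron (fst x) (proj_basis c (snd x)))" if "x \<in> space CS" for x
    using that by (intro density_kron_proj) (auto simp: spCS)
  have denX: "density N (X x)" if x: "x \<in> space CS" for x
  proof -
    have k: "psd (dB * c) (kron (fst x) (proj_basis c (snd x)))" "mtrace (kron (fst x) (proj_basis c (snd x))) = 1"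
      using denK[OF x] by (auto simp: density_def)
    have "psd N (X x)" unfolding X_def N_def by (rule cptp_psd[OF D k(1)])
    moreover have "kron (fst x) (proj_basis c (snd x)) \<in> carrier_mat (dB * c) (dB * c)" using k(1) by (simp add: psd_def)
    then have "mtrace (X x) = 1" using D k(2) unfolding X_def cptp_def by simp
    ultimately show ?thesis by (simp add: density_def)
  qed
  have cX: "X x \<in> carrier_mat N N" if "x \<in> space CS" for x using denX[OF that] by (simp add: density_def psd_def)
  have XT: "Re (quad N (mfun (X x)) v) \<le> Re (quad N (mfun (T (\<kappa> (snd x)))) v)" if x: "x \<in> space CS" for x v
  proof -
    define K where "K = kron (fst x) (proj_basis c (snd x))"
    have cK: "K \<in> carrier_mat (dB * c) (dB * c)" using denK[OF x] by (simp add: K_def density_def psd_def)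
    have "psd N (D (class_proj dB c \<kappa> (\<kappa> (snd x)) + (-1) \<cdot>\<^sub>m K))"
      unfolding N_def K_def using x by (intro cptp_psd[OF D] psd_class_proj_diff) (auto simp: spCS)
    then have "0 \<le> Re (quad N (mfun (D (class_proj dB c \<kappa> (\<kappa> (snd x)) + (-1) \<cdot>\<^sub>m K))) v)" unfolding psd_iff_quad by blast
    also have "quad N (mfun (D (class_proj dB c \<kappa> (\<kappa> (snd x)) + (-1) \<cdot>\<^sub>m K))) v
        = quad N (\<lambda>r s. mfun (T (\<kappa> (snd x))) r s - mfun (X x) r s) v"
      by (rule quad_cong) (simp add: mfun_def T_def X_def K_def[symmetric] N_def cptp_diff[OF D cU cK])
    also have "\<dots> = quad N (mfun (T (\<kappa> (snd x)))) v - quad N (mfun (X x)) v"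
      by (simp add: quad_def right_diff_distrib left_diff_distrib sum_subtractf)
    finally show ?thesis by simp
  qed
  have "\<forall>j. \<exists>w\<tau>. spectral N (mfun (T j)) (fst w\<tau>) (snd w\<tau>) \<and> (\<forall>i<N. 0 \<le> snd w\<tau> i)"
  proof
    fix j
    from psd_spectral[OF psdT[of j]] obtain w \<tau> where "spectral N (mfun (T j)) w \<tau> \<and> (\<forall>i<N. 0 \<le> \<tau> i)" by blast
    then show "\<exists>w\<tau>. spectral N (mfun (T j)) (fst w\<tau>) (snd w\<tau>) \<and> (\<forall>i<N. 0 \<le> snd w\<tau> i)" by (intro exI[of _ "(w, \<tau>)"]) simp
  qed
  from choice[OF this] obtain w\<tau> where w\<tau>: "\<forall>j. spectral N (mfun (T j)) (fst (w\<tau> j)) (snd (w\<tau> j)) \<and> (\<forall>i<N. 0 \<le> snd (w\<tau> j) i)" ..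
  define w where "w j = fst (w\<tau> j)" for j
  define \<tau> where "\<tau> j = snd (w\<tau> j)" for j
  have spT: "spectral N (mfun (T j)) (w j) (\<tau> j)" and \<tau>0: "i < N \<Longrightarrow> 0 \<le> \<tau> j i" for j i using w\<tau> by (auto simp: w_def \<tau>_def)
  have \<tau>b: "(\<Sum>i<N. \<tau> j i) \<le> b" if "j < c'" for j
  proof -
    have "(\<Sum>i<N. \<tau> j i) = real (dB * card {y. y < c \<and> \<kappa> y = j})"
      using arg_cong[OF trans[OF mtrace_spectral[OF cT spT, symmetric] trT], of Re j] by simp
    also have "\<dots> \<le> b" unfolding b_def using u[OF that] by (simp only: of_nat_le_iff) simp
    finally show ?thesis .
  qed
  \<comment> \<open>The smoothed spectrum of the overlap bound, which is positive and sums to at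
    most 1 for each class, as Gibbs' inequality demands of its reference.\<close>
  define s where "s j i = (\<tau> j i / b + 1 / real N) / 2" for j i
  have s0: "0 < s j i" if "i < N" for i j using \<tau>0[OF that, of j] b1 N0 by (simp add: s_def add_nonneg_pos)
  have s1: "(\<Sum>i<N. s j i) \<le> 1" if "j < c'" for j
  proof -
    have "(\<Sum>i<N. s j i) = ((\<Sum>i<N. \<tau> j i) / b + 1) / 2"
      using N0 by (simp add: s_def sum.distrib sum_divide_distrib[symmetric])
    moreover have "(\<Sum>i<N. \<tau> j i) / b \<le> 1" using \<tau>b[OF that] b1 by (simp add: divide_le_eq)
    ultimately show ?thesis by simp
  qed
  \<comment> \<open>Written through the matrix of the word instead of its vector, the overlap is
    linear in the state and requires no measurable choice of vectors.\<close>
  define ov where "ov j i a = Re (quad N (mfun (word n a)) (w j i))" for j i a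
  define \<Lambda> where "\<Lambda> j a = (\<Sum>i<N. ov j i a * - log 2 (s j i))" for j a
  define \<alpha> where "\<alpha> = (1 + t) * (log 2 b + 3)"
  define \<beta> where "\<beta> = (1 + 1 / t) * (log 2 (real N) + 1)"
  have \<beta>0: "0 \<le> \<beta>" using t N0 unfolding \<beta>_def by (intro mult_nonneg_nonneg add_nonneg_nonneg) auto
  define f where "f a x = Re (mtrace (word n a * X x))" for a x
  have pw: "\<exists>v. (\<Sum>i<N. (cmod (v i))\<^sup>2) = 1 \<and> (\<forall>i<N. \<forall>k<N. word n a $$ (i, k) = v i * cnj (v k)) \<and> word n a \<in> carrier_mat N N"
    if "a \<in> space Pn" for a
    using pure_stateD[OF pure_word[of n a]] that by (simp add: space_Pn N_def)
  \<comment> \<open>The bound is affine in the fidelity \<open>f a x\<close> of a single encoder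
    output, so it survives averaging over outputs and blocks.\<close>
  have pointwise: "\<Lambda> (\<kappa> (snd x)) a \<le> \<alpha> + \<beta> * (1 - f a x)" if a: "a \<in> space Pn" and x: "x \<in> space CS" for a x
  proof -
    obtain v where v: "(\<Sum>i<N. (cmod (v i))\<^sup>2) = 1" "\<forall>i<N. \<forall>k<N. word n a $$ (i, k) = v i * cnj (v k)" "word n a \<in> carrier_mat N N"
      using pw[OF a] by blast
    obtain y xx where y: "spectral N (mfun (X x)) y xx" and xx: "\<And>i. i < N \<Longrightarrow> 0 \<le> xx i"
      using psd_spectral[of N "X x"] denX[OF x] unfolding density_def by blast
    have "complex_of_real (\<Sum>i<N. xx i) = of_real 1" using denX[OF x] by (simp add: density_def mtrace_spectral[OF cX[OF x] y])
    then have xx1: "(\<Sum>i<N. xx i) = 1" by (simp only: of_real_eq_iff)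
    have \<kappa>x: "\<kappa> (snd x) < c'" using x \<kappa> by (auto simp: spCS)
    have fe: "f a x = Re (quad N (mfun (X x)) v)"
    proof -
      have "mtrace (word n a * X x) = (\<Sum>i<N. \<Sum>k<N. v i * cnj (v k) * X x $$ (k, i))"
        unfolding mtrace_mult[OF v(3) cX[OF x]] using v(2) by (intro sum.cong refl) simp
      also have "\<dots> = (\<Sum>k<N. \<Sum>i<N. v i * cnj (v k) * X x $$ (k, i))" by (rule sum.swap)
      also have "\<dots> = quad N (mfun (X x)) v" unfolding quad_def mfun_def by (simp only: mult_ac)
      finally show ?thesis by (simp add: f_def)
    qed
    have oe: "ov j i a = (cmod (ip N (w j i) v))\<^sup>2" for j i
    proof -
      have "quad N (mfun (word n a)) (w j i) = (\<Sum>r<N. \<Sum>s<N. (cnj (w j i r) * v r) * (cnj (v s) * w j i s))"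
        unfolding quad_def mfun_def using v(2) by (intro sum.cong refl) simp
      also have "\<dots> = ip N (w j i) v * cnj (ip N (w j i) v)"
        unfolding ip_cnj unfolding ip_def sum_product[symmetric] ..
      finally show ?thesis unfolding ov_def complex_norm_square[symmetric] by simp
    qed
    have "\<Lambda> (\<kappa> (snd x)) a \<le> (1 + t) * (log 2 b + 3) + (1 + 1 / t) * ((1 - Re (quad N (mfun (X x)) v)) * (log 2 (real N) + 1))"
      unfolding \<Lambda>_def oe s_def
      by (rule neg_log_overlap_bound[OF spT \<tau>0 \<tau>b[OF \<kappa>x] b1 y xx xx1 XT[OF x] v(1) t])
    then show ?thesis unfolding fe \<alpha>_def \<beta>_def by (simp only: mult_ac)
  qed
  define G where "G j = {x \<in> space CS. \<kappa> (snd x) = j}" for j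
  have G[measurable]: "G j \<in> sets CS" for j
  proof -
    have "(\<lambda>x. \<kappa> (snd x)) \<in> measurable CS (count_space UNIV)"
      unfolding CS_def by (rule measurable_compose[OF measurable_snd]) simp
    from measurable_sets[OF this, of "{j}"] show ?thesis by (simp add: G_def vimage_def Int_def conj_commute)
  qed
  define g where "g j a = measure (E a) (G j)" for j a
  have mg: "g j \<in> borel_measurable Pn" for j
    unfolding g_def[abs_def] using measurable_compose[OF mE measurable_measure_prob_algebra[OF G]] .
  have g0: "0 \<le> g j a" for j a by (simp add: g_def)
  have g1: "(\<Sum>j<c'. g j a) = 1" if a: "a \<in> space Pn" for a
  proof -
    interpret Ea: prob_space "E a" by (rule psE[OF a])
    have "(\<Sum>j<c'. g j a) = measure (E a) (\<Union>j<c'. G j)"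
      unfolding g_def using stE[OF a] G
      by (intro Ea.finite_measure_finite_Union[symmetric]) (auto simp: G_def disjoint_family_on_def)
    also have "(\<Union>j<c'. G j) = space (E a)" using \<kappa> by (auto simp: spE[OF a] G_def spCS)
    finally show ?thesis by (simp add: Ea.prob_space)
  qed
  have gle: "g j a \<le> 1" if "j < c'" "a \<in> space Pn" for j a
    using member_le_sum[of j "{..<c'}" "\<lambda>j. g j a"] g0 g1[OF that(2)] that by simp
  have mX: "(\<lambda>x. X x $$ (r, s')) \<in> borel_measurable CS" if rs: "r < N" "s' < N" for r s'
  proof -
    have "(\<lambda>x. \<Sum>p\<in>{..<dB*c} \<times> {..<dB*c}. (fst x $$ (fst p div c, snd p div c) * (if fst p mod c = snd x \<and> snd p mod c = snd x then 1 else 0))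
          * D (unit_mat (dB * c) p) $$ (r, s')) \<in> borel_measurable CS"
    proof (intro borel_measurable_sum borel_measurable_times borel_measurable_const)
      fix p assume "p \<in> {..<dB*c} \<times> {..<dB*c}"
      then have p: "fst p < dB * c" "snd p < dB * c" by auto
      show "(\<lambda>x. fst x $$ (fst p div c, snd p div c)) \<in> borel_measurable CS"
        unfolding CS_def using div_mod_less(1)[OF p(1)] div_mod_less(1)[OF p(2)]
        by (intro measurable_compose[OF measurable_fst] state_space_entry)
      show "(\<lambda>x. if fst p mod c = snd x \<and> snd p mod c = snd x then 1 else 0 :: complex) \<in> borel_measurable CS"
        unfolding CS_def by (rule measurable_compose[OF measurable_snd]) simp
    qed
    also have "?this \<longleftrightarrow> ?thesis"
    proof (rule measurable_cong)
      fix x assume x: "x \<in> space CS"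
      have c1: "fst x \<in> carrier_mat dB dB" using x by (auto simp: spCS density_def psd_def)
      have c2: "proj_basis c (snd x) \<in> carrier_mat c c" by (simp add: proj_basis_def)
      have c3: "kron (fst x) (proj_basis c (snd x)) \<in> carrier_mat (dB * c) (dB * c)"
        using denK[OF x] by (simp add: density_def psd_def)
      show "(\<Sum>p\<in>{..<dB*c} \<times> {..<dB*c}. (fst x $$ (fst p div c, snd p div c) * (if fst p mod c = snd x \<and> snd p mod c = snd x then 1 else 0))
          * D (unit_mat (dB * c) p) $$ (r, s')) = X x $$ (r, s')"
        unfolding X_def cptp_expand[OF D c3 rs[unfolded N_def]]
      proof (intro sum.cong refl arg_cong2[of _ _ _ _ "(*)"])
        fix p assume "p \<in> {..<dB*c} \<times> {..<dB*c}"
        then obtain r' q' where p: "p = (r', q')" "r' < dB * c" "q' < dB * c" by auto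
        show "fst x $$ (fst p div c, snd p div c) * (if fst p mod c = snd x \<and> snd p mod c = snd x then 1 else 0)
            = kron (fst x) (proj_basis c (snd x)) $$ p"
          using p kron_index[OF c1 c2 p(2,3)] div_mod_less[OF p(2)] div_mod_less[OF p(3)] by (auto simp: proj_basis_def)
      qed
    qed
    finally show ?thesis .
  qed
  have iX: "integrable (E a) (\<lambda>x. X x $$ (r, s'))" if a: "a \<in> space Pn" and rs: "r < N" "s' < N" for a r s'
  proof -
    interpret Ea: prob_space "E a" by (rule psE[OF a])
    show ?thesis
    proof (rule Ea.integrable_const_bound[of _ 1])
      have "cmod (X x $$ (r, s')) \<le> 1" if "x \<in> space CS" for x
        using psd_entry_bound[OF _ rs, of "X x"] denX[OF that] by (simp add: density_def)
      then show "AE x in E a. norm (X x $$ (r, s')) \<le> 1" using spE[OF a] by (intro AE_I2) simp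
      show "(\<lambda>x. X x $$ (r, s')) \<in> borel_measurable (E a)"
        using mX[OF rs] measurable_cong_sets[OF stE[OF a] refl] by blast
    qed
  qed
  define \<Phi> where "\<Phi> a = Re (mtrace (word n a * code_output d n c E D a))" for a
  have \<Phi>: "(\<Sum>j<c'. g j a * \<Lambda> j a) \<le> \<alpha> + \<beta> * (1 - \<Phi> a)" if a: "a \<in> space Pn" for a
  proof -
    interpret Ea: prob_space "E a" by (rule psE[OF a])
    have cw: "word n a \<in> carrier_mat N N" using pw[OF a] by blast
    have co: "code_output d n c E D a \<in> carrier_mat N N" by (simp add: code_output_def N_def)
    have if1: "integrable (E a) (\<lambda>x. \<Sum>k<N. word n a $$ (i, k) * X x $$ (k, i))" if "i < N" for i
      using iX[OF a] that by (intro Bochner_Integration.integrable_sum integrable_mult_right) auto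
    have "mtrace (word n a * code_output d n c E D a) = (\<Sum>i<N. \<Sum>k<N. \<integral>x. word n a $$ (i, k) * X x $$ (k, i) \<partial>(E a))"
      unfolding mtrace_mult[OF cw co] by (intro sum.cong refl) (simp add: code_output_def X_def N_def)
    also have "\<dots> = (\<Sum>i<N. \<integral>x. (\<Sum>k<N. word n a $$ (i, k) * X x $$ (k, i)) \<partial>(E a))"
      using iX[OF a] by (intro sum.cong refl Bochner_Integration.integral_sum[symmetric]) auto
    also have "\<dots> = (\<integral>x. (\<Sum>i<N. \<Sum>k<N. word n a $$ (i, k) * X x $$ (k, i)) \<partial>(E a))"
      using if1 by (intro Bochner_Integration.integral_sum[symmetric]) auto
    also have "\<dots> = (\<integral>x. mtrace (word n a * X x) \<partial>(E a))"
      using cX spE[OF a] by (intro Bochner_Integration.integral_cong refl) (simp add: mtrace_mult[OF cw])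
    finally have tr: "mtrace (word n a * code_output d n c E D a) = (\<integral>x. mtrace (word n a * X x) \<partial>(E a))" .
    have "integrable (E a) (\<lambda>x. \<Sum>i<N. \<Sum>k<N. word n a $$ (i, k) * X x $$ (k, i))"
      using if1 by (intro Bochner_Integration.integrable_sum[where I = "{..<N}" and f = "\<lambda>i x. \<Sum>k<N. word n a $$ (i, k) * X x $$ (k, i)"]) auto
    then have it: "integrable (E a) (\<lambda>x. mtrace (word n a * X x))"
      by (rule Bochner_Integration.integrable_cong[OF refl, THEN iffD1, rotated]) (simp add: mtrace_mult[OF cw cX] spE[OF a])
    then have if2: "integrable (E a) (f a)" unfolding f_def[abs_def] by simp
    have \<Phi>f: "\<Phi> a = (\<integral>x. f a x \<partial>(E a))" unfolding \<Phi>_def tr f_def using it by simp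
    have iG: "integrable (E a) (\<lambda>x. indicator (G j) x * \<Lambda> j a)" for j
      using G stE[OF a] by (intro integrable_mult_left integrable_real_indicator) (auto simp: Ea.emeasure_finite less_top[symmetric])
    have split: "\<Lambda> (\<kappa> (snd x)) a = (\<Sum>j<c'. indicator (G j) x * \<Lambda> j a)" if x: "x \<in> space CS" for x
    proof -
      have "(\<Sum>j<c'. indicator (G j) x * \<Lambda> j a) = (\<Sum>j<c'. if j = \<kappa> (snd x) then \<Lambda> j a else 0)"
        using x by (intro sum.cong) (auto simp: G_def)
      also have "\<dots> = \<Lambda> (\<kappa> (snd x)) a" using x \<kappa> by (auto simp: spCS)
      finally show ?thesis ..
    qed
    have "(\<Sum>j<c'. g j a * \<Lambda> j a) = (\<integral>x. (\<Sum>j<c'. indicator (G j) x * \<Lambda> j a) \<partial>(E a))"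
      using iG G stE[OF a] sets.sets_into_space[OF G] spE[OF a]
      by (subst Bochner_Integration.integral_sum) (auto simp: g_def Int_absorb2)
    also have "\<dots> \<le> (\<integral>x. \<alpha> + \<beta> * (1 - f a x) \<partial>(E a))"
    proof (rule integral_mono)
      show "integrable (E a) (\<lambda>x. \<Sum>j<c'. indicator (G j) x * \<Lambda> j a)"
        by (intro Bochner_Integration.integrable_sum iG)
      show "integrable (E a) (\<lambda>x. \<alpha> + \<beta> * (1 - f a x))" using if2 by simp
      fix x assume "x \<in> space (E a)"
      then have x: "x \<in> space CS" by (simp add: spE[OF a])
      show "(\<Sum>j<c'. indicator (G j) x * \<Lambda> j a) \<le> \<alpha> + \<beta> * (1 - f a x)"
        unfolding split[OF x, symmetric] by (rule pointwise[OF a x])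
    qed
    also have "\<dots> = \<alpha> + \<beta> * (1 - \<Phi> a)"
      using if2 by (simp add: \<Phi>f Ea.prob_space)
    finally show ?thesis .
  qed
  \<comment> \<open>The Bochner integral of a non-integrable function is 0 by convention, whereas
    the fidelity is at least \<open>1 - \<epsilon> > 0\<close>.\<close>
  have i\<Phi>: "integrable Pn \<Phi>"
  proof (rule ccontr)
    assume "\<not> integrable Pn \<Phi>"
    then have "code_fidelity P \<phi> d n c E D = 0"
      unfolding code_fidelity_def \<Phi>_def[symmetric] by (rule not_integrable_integral_eq)
    then show False using fid \<epsilon> by simp
  qed
  have igw: "integrable Pn (\<lambda>b. of_real (g j b) * word n b $$ (r, s'))" if "j < c'" "r < N" "s' < N" for j r s'
    using that g0 gle[OF that(1)] unfolding N_def
    by (intro weighted_mixture(1)[OF pp.P.prob_space_axioms word_density word_measurable mg]) auto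
  define fin where "fin j = mat (d ^ n) (d ^ n) (\<lambda>(r,s). \<integral>b. of_real (g j b) * word n b $$ (r, s) \<partial>Pn)" for j
  \<comment> \<open>Averaging the overlaps with the weight \<open>g j\<close> gives the diagonal of
    the class state \<open>fin j\<close> in the eigenbasis of \<open>T j\<close>.\<close>
  have quad_fin: "integrable Pn (\<lambda>b. g j b * ov j i b)" "(\<integral>b. g j b * ov j i b \<partial>Pn) = Re (quad N (mfun (fin j)) (w j i))" if j: "j < c'" for j i
  proof -
    have e: "Re (quad N (\<lambda>r s. of_real (g j b) * word n b $$ (r, s)) (w j i)) = g j b * ov j i b" for b
    proof -
      have "quad N (\<lambda>r s. of_real (g j b) * word n b $$ (r, s)) (w j i) = of_real (g j b) * quad N (mfun (word n b)) (w j i)"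
        unfolding quad_def mfun_def sum_distrib_left by (simp only: mult_ac)
      then show ?thesis by (simp add: ov_def)
    qed
    note qi = quad_integral[of N Pn "\<lambda>b r s. of_real (g j b) * word n b $$ (r, s)", OF igw[OF j], of "w j i"]
    show "integrable Pn (\<lambda>b. g j b * ov j i b)" using integrable_Re[OF qi(1)] by (simp add: e)
    have "quad N (mfun (fin j)) (w j i) = quad N (\<lambda>r s. \<integral>b. of_real (g j b) * word n b $$ (r, s) \<partial>Pn) (w j i)"
      by (rule quad_cong) (simp add: mfun_def fin_def N_def)
    then show "(\<integral>b. g j b * ov j i b \<partial>Pn) = Re (quad N (mfun (fin j)) (w j i))"
      using qi by (simp add: integral_Re[symmetric] e del: integral_Re)
  qed
  have i\<Lambda>: "integrable Pn (\<lambda>a. g j a * \<Lambda> j a)" and \<Lambda>_eq: "(\<integral>a. g j a * \<Lambda> j a \<partial>Pn) = (\<Sum>i<N. Re (quad N (mfun (fin j)) (w j i)) * - log 2 (s j i))" if j: "j < c'" for j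
  proof -
    have e: "g j a * \<Lambda> j a = (\<Sum>i<N. (g j a * ov j i a) * - log 2 (s j i))" for a
      unfolding \<Lambda>_def sum_distrib_left by (simp only: mult.assoc)
    show "integrable Pn (\<lambda>a. g j a * \<Lambda> j a)"
      unfolding e by (intro Bochner_Integration.integrable_sum integrable_mult_left quad_fin(1)[OF j])
    show "(\<integral>a. g j a * \<Lambda> j a \<partial>Pn) = (\<Sum>i<N. Re (quad N (mfun (fin j)) (w j i)) * - log 2 (s j i))"
      unfolding e quad_fin(2)[OF j, symmetric]
      by (subst Bochner_Integration.integral_sum) (auto intro: quad_fin(1)[OF j])
  qed
  have gibbs: "vN_entropy (fin j) + (\<integral>b. g j b \<partial>Pn) * log 2 (\<integral>b. g j b \<partial>Pn) \<le> (\<integral>a. g j a * \<Lambda> j a \<partial>Pn)" if j: "j < c'" for j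
  proof -
    interpret bw: block_weight P \<phi> d n "g j"
      using mg g0 gle[OF j] by unfold_locales auto
    have finj: "fin j = bw.\<rho> n a0" using bw.\<rho>_n[OF a0] by (simp add: fin_def bw.final_def)
    have pf: "psd N (fin j)" unfolding finj N_def by (rule bw.\<rho>_psd[OF a0]) simp
    have cf: "fin j \<in> carrier_mat N N" using pf by (simp add: psd_def)
    have tf: "mtrace (fin j) = of_real (\<integral>b. g j b \<partial>Pn)"
      unfolding finj using bw.\<rho>_trace[OF a0, of n] bw.W_n[OF a0] by (simp add: bw.q_def)
    obtain y p where y: "spectral N (mfun (fin j)) y p" and p: "\<And>i. i < N \<Longrightarrow> 0 \<le> p i"
      using psd_spectral[OF pf] by blast
    have qp: "(\<integral>b. g j b \<partial>Pn) = (\<Sum>i<N. p i)" using tf unfolding mtrace_spectral[OF cf y] by (simp only: of_real_eq_iff)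
    have onb: "onb N (w j)" using spT by (simp add: spectral_def)
    show ?thesis
      unfolding \<Lambda>_eq[OF j] vN_entropy_spectral[OF cf y]
      by (rule gibbs_spectral[OF y p onb s0 s1[OF j] qp])
  qed
  have "(\<Sum>j<c'. vN_entropy (fin j) + (\<integral>b. g j b \<partial>Pn) * log 2 (\<integral>b. g j b \<partial>Pn)) \<le> (\<Sum>j<c'. \<integral>a. g j a * \<Lambda> j a \<partial>Pn)"
    using gibbs by (intro sum_mono) auto
  also have "\<dots> = (\<integral>a. (\<Sum>j<c'. g j a * \<Lambda> j a) \<partial>Pn)"
    using i\<Lambda> by (intro Bochner_Integration.integral_sum[symmetric]) auto
  also have "\<dots> \<le> (\<integral>a. \<alpha> + \<beta> * (1 - \<Phi> a) \<partial>Pn)"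
    using i\<Lambda> i\<Phi> \<Phi> by (intro integral_mono) auto
  also have "\<dots> = \<alpha> + \<beta> * (1 - code_fidelity P \<phi> d n c E D)"
    using i\<Phi> by (simp add: code_fidelity_def \<Phi>_def[symmetric] prob_Pn)
  also have "\<dots> \<le> \<alpha> + \<beta> * \<epsilon>" using fid \<beta>0 by (intro add_left_mono mult_left_mono) auto
  also have "\<dots> = (1 + t) * (log 2 (real (dB * u)) + 3) + (1 + 1 / t) * (\<epsilon> * (log 2 (real (d ^ n)) + 1))"
    by (simp only: \<alpha>_def \<beta>_def b_def N_def mult_ac)
  finally have "(\<Sum>j<c'. vN_entropy (fin j) + (\<integral>b. g j b \<partial>Pn) * log 2 (\<integral>b. g j b \<partial>Pn))
      \<le> (1 + t) * (log 2 (real (dB * u)) + 3) + (1 + 1 / t) * (\<epsilon> * (log 2 (real (d ^ n)) + 1))" .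
  then show "\<exists>g. (\<forall>j<c'. g j \<in> borel_measurable Pn) \<and> (\<forall>j<c'. \<forall>a\<in>space Pn. 0 \<le> g j a) \<and> (\<forall>a\<in>space Pn. (\<Sum>j<c'. g j a) = 1) \<and>
     (\<Sum>j<c'. vN_entropy (mat (d ^ n) (d ^ n) (\<lambda>(r,s). \<integral>b. of_real (g j b) * word n b $$ (r, s) \<partial>Pn))
        + (\<integral>b. g j b \<partial>Pn) * log 2 (\<integral>b. g j b \<partial>Pn))
      \<le> (1 + t) * (log 2 (real (dB * u)) + 3) + (1 + 1 / t) * (\<epsilon> * (log 2 (real (d ^ n)) + 1))"
    using mg g0 g1 unfolding fin_def by (intro exI[of _ g]) auto
qed

end

section \<open>The converse bound\<close>

text \<open>Since \<open>n * t >= 1\<close>, the additive constant 3 costs at most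
  \<open>3 * t\<close> per letter, whence \<open>5 * t\<close>. The infidelity
  \<open>t\<^sup>2\<close> turns the factor \<open>1 + 1 / t\<close> into
  \<open>t\<^sup>2 + t\<close>, which multiplies a per-letter constant.\<close>

lemma per_letter_bound:
  fixes n d :: nat and b C t Q :: real
  assumes n: "1 \<le> real n * t" and d: "0 < d" and t: "0 < t" "t < 1"
    and C: "C \<le> (1 + t) * (b + 3) + (1 + 1 / t) * (t\<^sup>2 * (log 2 (real (d ^ n)) + 1))"
    and b: "b \<le> real n * (Q + 2 * t)"
  shows "C / real n \<le> (1 + t) * (Q + 5 * t) + (t\<^sup>2 + t) * (log 2 (real d) + 1)"
proof -
  have n0: "0 < real n" using n t by (cases "n = 0") auto
  have n1: "1 \<le> real n" using n0 by simp
  have "b + 3 \<le> real n * (Q + 5 * t)" using b n by (simp add: algebra_simps)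
  then have "(1 + t) * (b + 3) \<le> (1 + t) * (real n * (Q + 5 * t))" using t by (intro mult_left_mono) auto
  moreover have "(1 + 1 / t) * (t\<^sup>2 * (log 2 (real (d ^ n)) + 1)) = (t\<^sup>2 + t) * (real n * log 2 (real d) + 1)"
    using t d by (simp add: log_nat_power field_simps power2_eq_square)
  moreover have "(t\<^sup>2 + t) * (real n * log 2 (real d) + 1) \<le> (t\<^sup>2 + t) * (real n * (log 2 (real d) + 1))"
    using t n1 by (intro mult_left_mono) (auto simp: algebra_simps)
  ultimately have "C \<le> real n * ((1 + t) * (Q + 5 * t) + (t\<^sup>2 + t) * (log 2 (real d) + 1))"
    using C by (simp add: algebra_simps)
  then show ?thesis using n0 by (simp add: divide_le_eq mult.commute)
qed

text \<open>The single parameter \<open>t\<close> is the excess of both rates, the square root of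
  the infidelity and the weight in the overlap bound. One block length with
  \<open>n * t >= 1\<close> suffices for each \<open>t\<close>, so no limit in \<open>n\<close> is
  taken.\<close>

lemma M_quantity_le_rate:
  fixes R Q t :: real
  assumes src: "pure_source P \<phi> d" and R: "0 \<le> R" and t: "0 < t" "t < 1"
    and code: "\<forall>\<epsilon>>0. \<forall>\<delta>>0. \<forall>\<^sub>F n in sequentially. \<exists>c dB E D. visible_code P d n c dB E D \<and>
        code_fidelity P \<phi> d n c E D \<ge> 1 - \<epsilon> \<and>
        log 2 (real c) / real n \<le> R + \<delta> \<and> log 2 (real dB) / real n \<le> Q + \<delta>"
  defines "lam \<equiv> (if R = 0 then 1 else R / (R + t))"
  shows "M_quantity P \<phi> d R \<le> ereal (lam * ((1 + t) * (Q + 5 * t) + (t\<^sup>2 + t) * (log 2 (real d) + 1)) + (1 - lam) * log 2 (real d))"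
proof -
  have "\<forall>\<^sub>F n in sequentially. \<exists>c dB E D. visible_code P d n c dB E D \<and>
        code_fidelity P \<phi> d n c E D \<ge> 1 - t\<^sup>2 \<and>
        log 2 (real c) / real n \<le> R + t \<and> log 2 (real dB) / real n \<le> Q + t"
    using code t by simp
  moreover have "\<forall>\<^sub>F n in sequentially. 1 / t \<le> real n"
    using filterlim_real_sequentially unfolding filterlim_at_top by blast
  ultimately have "\<exists>n. (\<exists>c dB E D. visible_code P d n c dB E D \<and> code_fidelity P \<phi> d n c E D \<ge> 1 - t\<^sup>2 \<and>
        log 2 (real c) / real n \<le> R + t \<and> log 2 (real dB) / real n \<le> Q + t) \<and> 1 / t \<le> real n"
    by (intro eventually_happens'[OF sequentially_bot] eventually_conj)
  then obtain n c dB E D where vc: "visible_code P d n c dB E D" and F: "code_fidelity P \<phi> d n c E D \<ge> 1 - t\<^sup>2"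
    and c: "log 2 (real c) / real n \<le> R + t" and dB: "log 2 (real dB) / real n \<le> Q + t" and nt: "1 / t \<le> real n"
    by blast
  interpret block_source P \<phi> d n using src by unfold_locales
  have nt': "1 \<le> real n * t" using nt t by (simp add: divide_le_eq)
  have n: "0 < n" using nt' by (cases "n = 0") auto
  have t2: "t\<^sup>2 < 1" using t by (simp add: power_less_one_iff)
  have c': "log 2 (real c) \<le> real n * (R + t)" and dB': "log 2 (real dB) \<le> real n * (Q + t)"
    using c dB n by (simp_all add: divide_le_eq mult.commute)
  have lam: "0 \<le> lam" "lam \<le> 1" using R t by (auto simp: lam_def)
  \<comment> \<open>At rate 0 all labels form one class of size \<open>c\<close>, so the classical
    part carries one symbol; otherwise every label is its own class.\<close>
  define \<kappa> :: "nat \<Rightarrow> nat" where "\<kappa> i = (if R = 0 then 0 else i)" for i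
  define m u where "m = (if R = 0 then 1 else c)" and "u = (if R = 0 then c else 1)"
  have \<kappa>: "\<kappa> i < m" if "i < c" for i using that by (simp add: \<kappa>_def m_def)
  have u: "card {y. y < c \<and> \<kappa> y = j} \<le> u" if "j < m" for j
  proof (cases "R = 0")
    case True
    have "card {y. y < c \<and> \<kappa> y = j} \<le> card {..<c}" by (intro card_mono) auto
    then show ?thesis using True by (simp add: u_def)
  next
    case False
    have "card {y. y < c \<and> \<kappa> y = j} \<le> card {j}" using False by (intro card_mono) (auto simp: \<kappa>_def)
    then show ?thesis using False by (simp add: u_def)
  qed
  note bound = code_entropy_bound[OF vc F t2 t(1) \<kappa> u]
  from bound(1) obtain g where mg: "\<And>j. j < m \<Longrightarrow> g j \<in> borel_measurable Pn" and g0: "\<And>j a. j < m \<Longrightarrow> a \<in> space Pn \<Longrightarrow> 0 \<le> g j a"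
    and g1: "\<And>a. a \<in> space Pn \<Longrightarrow> (\<Sum>j<m. g j a) = 1"
    and C: "(\<Sum>j<m. vN_entropy (mat (d ^ n) (d ^ n) (\<lambda>(r,s). \<integral>b. of_real (g j b) * word n b $$ (r, s) \<partial>Pn))
        + (\<integral>b. g j b \<partial>Pn) * log 2 (\<integral>b. g j b \<partial>Pn))
      \<le> (1 + t) * (log 2 (real (dB * u)) + 3) + (1 + 1 / t) * (t\<^sup>2 * (log 2 (real (d ^ n)) + 1))"
    by blast
  have pos: "0 < c" "0 < dB" "0 < m" using bound(2-4) by auto
  \<comment> \<open>At rate 0 the absorbed labels contribute \<open>log 2 c <= n * t\<close>; this
    is the second \<open>t\<close>.\<close>
  have ub: "log 2 (real (dB * u)) \<le> real n * (Q + 2 * t)"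
  proof (cases "R = 0")
    case True
    then have "log 2 (real (dB * u)) = log 2 (real dB) + log 2 (real c)" using pos by (simp add: u_def log_mult)
    then show ?thesis using c' dB' True by (simp add: algebra_simps)
  next
    case False
    have "real n * (Q + t) \<le> real n * (Q + 2 * t)" using t by (intro mult_left_mono) auto
    then show ?thesis using False dB' by (simp add: u_def)
  qed
  have rate: "lam * log 2 (real m) \<le> real n * R"
  proof (cases "R = 0")
    case False
    then have "lam * log 2 (real c) \<le> lam * (real n * (R + t))" using c' lam by (intro mult_left_mono)
    also have "\<dots> = real n * R" using False R t by (simp add: lam_def)
    finally show ?thesis using False by (simp add: m_def)
  qed (simp add: m_def)
  have "M_quantity P \<phi> d R \<le> ereal (lam / real n * (\<Sum>j<m. vN_entropy (mat (d ^ n) (d ^ n)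
        (\<lambda>(r,s). \<integral>b. of_real (g j b) * word n b $$ (r, s) \<partial>Pn)) + (\<integral>b. g j b \<partial>Pn) * log 2 (\<integral>b. g j b \<partial>Pn))
      + (1 - lam) * log 2 (real d))"
    by (rule M_quantity_le_block[OF n pos(3) lam mg g0 g1 rate])
  also have "\<dots> \<le> ereal (lam * ((1 + t) * (Q + 5 * t) + (t\<^sup>2 + t) * (log 2 (real d) + 1)) + (1 - lam) * log 2 (real d))"
    unfolding ereal_less_eq times_divide_eq_left times_divide_eq_right[symmetric]
    by (intro add_right_mono mult_left_mono lam(1) per_letter_bound[OF nt' d_pos t C ub])
  finally show ?thesis .
qed

theorem theorem10p1:
  fixes P :: "'a measure" and \<phi> :: "'a \<Rightarrow> complex mat" and d :: nat and R :: real
  assumes "pure_source P \<phi> d"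
    and "R \<ge> 0"
  shows "Qstar P \<phi> d R \<ge> M_quantity P \<phi> d R"
  unfolding Qstar_def
proof (rule Inf_greatest)
  fix x
  assume "x \<in> {ereal Q | Q. \<forall>\<epsilon>>0. \<forall>\<delta>>0. \<forall>\<^sub>F n in sequentially.
      \<exists>c dB E D. visible_code P d n c dB E D \<and> code_fidelity P \<phi> d n c E D \<ge> 1 - \<epsilon> \<and>
        log 2 (real c) / real n \<le> R + \<delta> \<and> log 2 (real dB) / real n \<le> Q + \<delta>}"
  then obtain Q where x: "x = ereal Q" and code: "\<forall>\<epsilon>>0. \<forall>\<delta>>0. \<forall>\<^sub>F n in sequentially.
      \<exists>c dB E D. visible_code P d n c dB E D \<and> code_fidelity P \<phi> d n c E D \<ge> 1 - \<epsilon> \<and>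
        log 2 (real c) / real n \<le> R + \<delta> \<and> log 2 (real dB) / real n \<le> Q + \<delta>" by blast
  define L where "L = log 2 (real d)"
  define lam where "lam t = (if R = 0 then 1 else R / (R + t))" for t :: real
  define f where "f t = lam t * ((1 + t) * (Q + 5 * t) + (t\<^sup>2 + t) * (L + 1)) + (1 - lam t) * L" for t
  \<comment> \<open>For \<open>R > 0\<close> the factor tends to 1 as \<open>t\<close> shrinks. At
    \<open>R = 0\<close> the quotient would be 0 for every \<open>t\<close>, hence the separate
    value 1.\<close>
  have lam: "(lam \<longlongrightarrow> 1) (at_right 0)"
  proof (cases "R = 0")
    case False
    have "((\<lambda>t. R / (R + t)) \<longlongrightarrow> R / (R + 0)) (at_right 0)"
      using False by (intro tendsto_intros) auto
    then show ?thesis using False by (simp add: lam_def[abs_def])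
  qed (simp add: lam_def[abs_def])
  have "(f \<longlongrightarrow> 1 * ((1 + 0) * (Q + 5 * 0) + (0\<^sup>2 + 0) * (L + 1)) + (1 - 1) * L) (at_right 0)"
    unfolding f_def[abs_def] by (intro tendsto_intros lam)
  then have "((\<lambda>t. ereal (f t)) \<longlongrightarrow> ereal Q) (at_right 0)" by (intro tendsto_ereal) simp
  moreover have "\<forall>\<^sub>F t in at_right 0. M_quantity P \<phi> d R \<le> ereal (f t)"
    unfolding eventually_at_right_field
    using M_quantity_le_rate[OF assms _ _ code] by (intro exI[of _ 1]) (auto simp: f_def lam_def L_def)
  ultimately show "M_quantity P \<phi> d R \<le> x"
    unfolding x by (rule tendsto_lowerbound) simp
qed

end
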